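(* Assume a curvature estimate \[ \max_{\|Z\|=1} \| (P_C - P_{\tilde C})Z \| \le \frac{c}{\hat\sigma} \| C - \tilde C \|\quad\text{for all }C,\tilde C\in \mathcal{M}_{\mathrm{c}}, \] where $\hat\sigma = \mathrm{dist}(C,\overline{\mathcal{M}_{\mathrm{c}}} \setminus \mathcal{M}_{\mathrm{c}})$ and where $c>0$ is independent of $C, \tilde C$. Let $X,Y \in \mathcal M$ with corresponding tangent space projections $P_X$ and $P_Y$. Then \[ \| P_X - P_Y \|_{\ell_2(\mathbb N^d) \to \ell_2(\mathbb N^d)} \le \left( \frac{\sqrt{2}c}{\sigma} + 2(\sqrt{2}+1)\sum_{\mu=1}^d \frac{1}{\sigma^\mu_{r_\mu}} \right) \| X - Y \|_{\ell_2(\mathbb N^d)} \] where $\sigma = \mathrm{dist}(X,\overline{\mathcal M}^w \setminus \mathcal M)$ and $\sigma^\mu_{r_\mu}$ is the smallest (positive) singular value of the $\mu$-th matricization of $X$.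
   Context: Let $d,r_1,\dots,r_d$ be positive integers. $\mathbb R^{r_1\times\dots\times r_d}_*$ denotes the open set of tensors with full multilinear rank $(r_1,\dots,r_d)$. $\times_\mu$ denotes left multiplication of a matrix (possibly with infinitely many rows) onto the $\mu$-th mode of a tensor; $\|\cdot\|$ without subscript is the Frobenius norm. $\mathcal M_{\mathrm c}\subset\mathbb R^{r_1\times\dots\times r_d}_*$ is a smooth (embedded) submanifold satisfying $C\times_1T^1\times_2\cdots\times_dT^d\in\mathcal M_{\mathrm c}$ for all $C\in\mathcal M_{\mathrm c}$ and all invertible $T^\mu\in\mathbb R^{r_\mu\times r_\mu}$; $P_C$ is the orthogonal projection of $\mathbb R^{r_1\times\dots\times r_d}$ onto the tangent space $T_C\mathcal M_{\mathrm c}$. Elements $U^\mu\in(\ell_2(\mathbb N))^{r_\mu}$ are treated as matrices with $r_\mu$ columns in $\ell_2(\mathbb N)$, and \[\mathcal M=\{X=C\times_1U^1\times_2\cdots\times_dU^d:\ C\in\mathcal M_{\mathrm c},\ U^\mu\in(\ell_2(\mathbb N))^{r_\mu},\ (U^\mu)^{\mathsf T}U^\mu\text{ invertible}\}\subset\ell_2(\mathbb N^d).\] $\overline{\mathcal M}^w$ is the weak closure of $\mathcal M$ in $\ell_2(\mathbb N^d)$; distances are in the $\ell_2(\mathbb N^d)$ norm for $\mathcal M$ and in the Frobenius norm for $\mathcal M_{\mathrm c}$. The $\mu$-th matricization of $X$ is $X$ regarded as an element of $\ell_2(\mathbb N)\otimes\ell_2(\mathbb N^{d-1})$ (mode $\mu$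 versus the remaining modes); for $X\in\mathcal M$ it has rank $r_\mu$ and singular values $\sigma^\mu_1\ge\dots\ge\sigma^\mu_{r_\mu}>0$. $P_X$ is the orthogonal projection of $\ell_2(\mathbb N^d)$ onto the tangent space $T_X\mathcal M$, which consists of all $\dot C\times_1U^1\times_2\cdots\times_dU^d+C\times_1\dot U^1\times_2\cdots\times_dU^d+\dots+C\times_1U^1\times_2\cdots\times_d\dot U^d$ with $\dot C\in T_C\mathcal M_{\mathrm c}$, $\dot U^\mu\in(\ell_2(\mathbb N))^{r_\mu}$, $(U^\mu)^{\mathsf T}\dot U^\mu=0$. *)

theory Defs
  imports "Jordan_Normal_Form.Matrix" "HOL-Analysis.Analysis"
begin

section \<open>Square-summable real families\<close>

typedef 'a ell2 = "{f :: 'a \<Rightarrow> real. (\<lambda>i. (f i)\<^sup>2) summable_on UNIV}"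
  morphisms coord Abs_ell2
  by (rule exI[of _ "\<lambda>_. 0"]) simp

setup_lifting type_definition_ell2

lemma square_summable_mult:
  fixes f g :: "'a \<Rightarrow> real"
  assumes "(\<lambda>i. (f i)\<^sup>2) summable_on A" "(\<lambda>i. (g i)\<^sup>2) summable_on A"
  shows "(\<lambda>i. f i * g i) summable_on A"
proof -
  have "(\<lambda>i. (f i)\<^sup>2 + (g i)\<^sup>2) summable_on A"
    using assms by (rule summable_on_add)
  moreover have "norm (f i * g i) \<le> (f i)\<^sup>2 + (g i)\<^sup>2" for i
  proof -
    have "norm (f i * g i) \<le> 2 * (\<bar>f i\<bar> * \<bar>g i\<bar>)"
      by (simp add: abs_mult)
    also have "\<dots> \<le> (f i)\<^sup>2 + (g i)\<^sup>2"
      using sum_squares_bound[of "\<bar>f i\<bar>" "\<bar>g i\<bar>"] by (simp add: mult.assoc)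
    finally show ?thesis .
  qed
  ultimately have "(\<lambda>i. norm (f i * g i)) summable_on A"
    by (rule summable_on_comparison_test[where f = "\<lambda>i. (f i)\<^sup>2 + (g i)\<^sup>2"]) auto
  then show ?thesis by (rule abs_summable_summable)
qed

lemma square_summable_add:
  fixes f g :: "'a \<Rightarrow> real"
  assumes "(\<lambda>i. (f i)\<^sup>2) summable_on A" "(\<lambda>i. (g i)\<^sup>2) summable_on A"
  shows "(\<lambda>i. (f i + g i)\<^sup>2) summable_on A"
proof -
  have "(\<lambda>i. (f i)\<^sup>2 + (g i)\<^sup>2 + 2 * (f i * g i)) summable_on A"
    by (intro summable_on_add assms summable_on_cmult_right square_summable_mult)
  then show ?thesis by (simp add: power2_sum mult.assoc)
qed

lemma square_summable_scale:
  fixes f :: "'a \<Rightarrow> real"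
  assumes "(\<lambda>i. (f i)\<^sup>2) summable_on A"
  shows "(\<lambda>i. (a * f i)\<^sup>2) summable_on A"
  using summable_on_cmult_right[OF assms, of "a\<^sup>2"] by (simp add: power_mult_distrib)

lemma square_summable_sum:
  fixes f :: "'b \<Rightarrow> 'a \<Rightarrow> real"
  assumes "\<And>j. j \<in> J \<Longrightarrow> (\<lambda>i. (f j i)\<^sup>2) summable_on A"
  shows "(\<lambda>i. (\<Sum>j\<in>J. f j i)\<^sup>2) summable_on A"
  using assms
proof (induction J rule: infinite_finite_induct)
  case (insert x F)
  then show ?case using square_summable_add[of "f x" A "\<lambda>i. \<Sum>j\<in>F. f j i"] by simp
qed auto

instantiation ell2 :: (type) real_inner
begin

lift_definition zero_ell2 :: "'a ell2" is "\<lambda>_. 0" by simp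
lift_definition plus_ell2 :: "'a ell2 \<Rightarrow> 'a ell2 \<Rightarrow> 'a ell2" is "\<lambda>f g i. f i + g i"
  by (rule square_summable_add)
lift_definition uminus_ell2 :: "'a ell2 \<Rightarrow> 'a ell2" is "\<lambda>f i. - f i" by simp
lift_definition minus_ell2 :: "'a ell2 \<Rightarrow> 'a ell2 \<Rightarrow> 'a ell2" is "\<lambda>f g i. f i - g i"
  subgoal for f g using square_summable_add[of f UNIV "\<lambda>i. - g i"] by simp
  done
lift_definition scaleR_ell2 :: "real \<Rightarrow> 'a ell2 \<Rightarrow> 'a ell2" is "\<lambda>a f i. a * f i"
  by (rule square_summable_scale)
lift_definition inner_ell2 :: "'a ell2 \<Rightarrow> 'a ell2 \<Rightarrow> real" is "\<lambda>f g. \<Sum>\<^sub>\<infinity>i. f i * g i" .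

definition norm_ell2 :: "'a ell2 \<Rightarrow> real" where "norm_ell2 x = sqrt (inner x x)"
definition sgn_ell2 :: "'a ell2 \<Rightarrow> 'a ell2" where "sgn_ell2 x = inverse (norm x) *\<^sub>R x"
definition dist_ell2 :: "'a ell2 \<Rightarrow> 'a ell2 \<Rightarrow> real" where "dist_ell2 x y = norm (x - y)"
definition uniformity_ell2 :: "('a ell2 \<times> 'a ell2) filter"
  where "uniformity_ell2 = (INF e\<in>{0<..}. principal {(x, y). dist x y < e})"
definition open_ell2 :: "'a ell2 set \<Rightarrow> bool"
  where "open_ell2 U = (\<forall>x\<in>U. \<forall>\<^sub>F (x', y) in uniformity. x' = x \<longrightarrow> y \<in> U)"

instance
proof
  fix x y z :: "'a ell2" and a b :: real
  show "x + y + z = x + (y + z)" by transfer (simp add: add.assoc)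
  show "x + y = y + x" by transfer (simp add: add.commute)
  show "0 + x = x" by transfer simp
  show "- x + x = 0" by transfer simp
  show "x - y = x + - y" by transfer simp
  show "a *\<^sub>R (x + y) = a *\<^sub>R x + a *\<^sub>R y" by transfer (simp add: algebra_simps)
  show "(a + b) *\<^sub>R x = a *\<^sub>R x + b *\<^sub>R x" by transfer (simp add: algebra_simps)
  show "a *\<^sub>R b *\<^sub>R x = (a * b) *\<^sub>R x" by transfer (simp add: algebra_simps)
  show "1 *\<^sub>R x = x" by transfer simp
  show "inner x y = inner y x" by transfer (simp add: mult.commute)
  show "inner (x + y) z = inner x z + inner y z"
    by transfer (simp add: distrib_right infsum_add square_summable_mult)
  show "inner (a *\<^sub>R x) y = a * inner x y"
    by transfer (simp add: mult.assoc infsum_cmult_right')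
  show "0 \<le> inner x x" by transfer (simp add: infsum_nonneg)
  show "inner x x = 0 \<longleftrightarrow> x = 0"
  proof
    assume "inner x x = 0"
    then show "x = 0"
    proof transfer
      fix f :: "'a \<Rightarrow> real"
      assume f: "(\<lambda>i. (f i)\<^sup>2) summable_on UNIV" and 0: "(\<Sum>\<^sub>\<infinity>i. f i * f i) = 0"
      have "(f i)\<^sup>2 = 0" for i
        using nonneg_infsum_le_0D[of "\<lambda>i. (f i)\<^sup>2" UNIV i] f 0 by (simp add: power2_eq_square)
      then show "f = (\<lambda>_. 0)" by auto
    qed
  next
    assume "x = 0"
    then show "inner x x = 0" by transfer simp
  qed
qed (simp_all only: norm_ell2_def sgn_ell2_def dist_ell2_def uniformity_ell2_def open_ell2_def)

end


section \<open>General notions\<close>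

text \<open>Meaningful for complete subspaces \<open>S\<close> only.\<close>

definition orth_proj :: "'a::real_inner set \<Rightarrow> 'a \<Rightarrow> 'a"
  where "orth_proj S x = (THE p. p \<in> S \<and> (\<forall>s\<in>S. inner (x - p) s = 0))"

definition weak_topology :: "'a::real_normed_vector topology"
  where "weak_topology =
    topology_generated_by {f -` U | (f :: 'a \<Rightarrow> real) U. bounded_linear f \<and> open U}"

text \<open>
  Continuous differentiability of order \<open>k\<close> on a relatively open subset \<open>S\<close> of a
  finite-dimensional subspace \<open>E\<close>. The derivatives are taken along \<open>E\<close>; \<open>f' x\<close> is determined
  on \<open>E\<close> only.
\<close>

primrec cont_diff_on ::
  "nat \<Rightarrow> 'a::real_normed_vector set \<Rightarrow> 'a set \<Rightarrow> ('a \<Rightarrow> 'b::real_normed_vector) \<Rightarrow> bool"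
  where
    "cont_diff_on 0 E S f \<longleftrightarrow> continuous_on S f"
  | "cont_diff_on (Suc k) E S f \<longleftrightarrow>
      (\<exists>f'. (\<forall>x\<in>S. (f has_derivative f' x) (at x within S)) \<and>
            (\<forall>v\<in>E. cont_diff_on k E S (\<lambda>x. f' x v)))"

definition smooth_on ::
  "'a::real_normed_vector set \<Rightarrow> 'a set \<Rightarrow> ('a \<Rightarrow> 'b::real_normed_vector) \<Rightarrow> bool"
  where "smooth_on E S f \<longleftrightarrow> (\<forall>k. cont_diff_on k E S f)"

text \<open>
  Smooth embedded submanifolds of a finite-dimensional subspace \<open>E\<close>, by slice charts:
  \<open>\<phi>\<close> is a smooth diffeomorphism between relatively open subsets of \<open>E\<close> that straightens \<open>M\<close>
  to an \<open>n\<close>-dimensional linear subspace.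
\<close>

definition embedded_submanifold :: "'a::real_normed_vector set \<Rightarrow> 'a set \<Rightarrow> bool"
  where "embedded_submanifold E M \<longleftrightarrow> M \<subseteq> E \<and>
    (\<exists>n. \<forall>p\<in>M. \<exists>U V \<phi> \<psi> W.
      openin (top_of_set E) U \<and> p \<in> U \<and> openin (top_of_set E) V \<and>
      homeomorphism U V \<phi> \<psi> \<and> smooth_on E U \<phi> \<and> smooth_on E V \<psi> \<and>
      subspace W \<and> W \<subseteq> E \<and> dim W = n \<and> \<phi> ` (M \<inter> U) = W \<inter> V)"

definition tangent_space :: "'a::real_normed_vector set \<Rightarrow> 'a \<Rightarrow> 'a set"
  where "tangent_space M p = {v. \<exists>\<gamma> \<epsilon>. 0 < \<epsilon> \<and> smooth_on UNIV {-\<epsilon><..<\<epsilon>} \<gamma> \<and>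
    \<gamma> ` {-\<epsilon><..<\<epsilon>} \<subseteq> M \<and> \<gamma> 0 = p \<and> (\<gamma> has_vector_derivative v) (at (0::real))}"


section \<open>Tensors\<close>

text \<open>
  The modes are the elements of a finite type \<open>'d\<close> (so \<open>d = CARD('d) \<ge> 1\<close>), multi-indices are
  functions \<open>'d \<Rightarrow> nat\<close> counted from \<open>0\<close>, and \<open>('d \<Rightarrow> nat) ell2\<close> is the space of
  square-summable tensors of order \<open>d\<close>. The tensors of size \<open>r\<close> are identified with those
  supported in \<open>index_box r\<close>; the Frobenius norm is then the norm of \<open>ell2\<close>.
\<close>

definition index_box :: "('d \<Rightarrow> nat) \<Rightarrow> ('d \<Rightarrow> nat) set"
  where "index_box r = {i. \<forall>\<mu>. i \<mu> < r \<mu>}"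

definition tensors :: "('d \<Rightarrow> nat) \<Rightarrow> ('d \<Rightarrow> nat) ell2 set"
  where "tensors r = {C. \<forall>i. i \<notin> index_box r \<longrightarrow> coord C i = 0}"

text \<open>
  \<open>matricization \<mu> X k\<close> is row \<open>k\<close> of the \<open>\<mu>\<close>-th matricization. The multi-indices of the
  remaining modes are represented by the \<open>i\<close> with \<open>i \<mu> = 0\<close>.
\<close>

lift_definition matricization :: "'d \<Rightarrow> ('d \<Rightarrow> nat) ell2 \<Rightarrow> nat \<Rightarrow> ('d \<Rightarrow> nat) ell2"
  is "\<lambda>\<mu> X k i. if i \<mu> = 0 then X (i(\<mu> := k)) else 0"
proof -
  fix \<mu> :: 'd and X :: "('d \<Rightarrow> nat) \<Rightarrow> real" and k
  assume X: "(\<lambda>i. (X i)\<^sup>2) summable_on UNIV"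
  have inj: "inj_on (\<lambda>i. i(\<mu> := k)) {i :: 'd \<Rightarrow> nat. i \<mu> = 0}"
    by (rule inj_onI) (metis (mono_tags, lifting) fun_upd_triv fun_upd_upd mem_Collect_eq)
  have "(\<lambda>i. (X i)\<^sup>2) summable_on (\<lambda>i. i(\<mu> := k)) ` {i. i \<mu> = 0}"
    using X by (rule summable_on_subset_banach) simp
  then have "(\<lambda>i. (X (i(\<mu> := k)))\<^sup>2) summable_on {i. i \<mu> = 0}"
    by (simp add: summable_on_reindex[OF inj] o_def)
  then show "(\<lambda>i. (if i \<mu> = 0 then X (i(\<mu> := k)) else 0)\<^sup>2) summable_on UNIV"
    by (subst summable_on_cong_neutral[where T = "{i. i \<mu> = 0}"
          and g = "\<lambda>i. (X (i(\<mu> := k)))\<^sup>2"]) auto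
qed

definition full_rank_tensors :: "('d \<Rightarrow> nat) \<Rightarrow> ('d \<Rightarrow> nat) ell2 set"
  where "full_rank_tensors r = {C \<in> tensors r. \<forall>\<mu>. dim (range (matricization \<mu> C)) = r \<mu>}"

text \<open>
  \<open>\<sigma>\<close> is a positive singular value of the operator with rows \<open>A k\<close>, i.e.
  \<open>A v = \<sigma> u\<close> and \<open>A\<^sup>T u = \<sigma> v\<close> for unit vectors \<open>u\<close>, \<open>v\<close>.
\<close>

definition pos_singular_value :: "(nat \<Rightarrow> 'b ell2) \<Rightarrow> real \<Rightarrow> bool"
  where "pos_singular_value A \<sigma> \<longleftrightarrow> 0 < \<sigma> \<and>
    (\<exists>(u :: nat ell2) v. norm u = 1 \<and> norm v = 1 \<and>
      (\<forall>k. inner (A k) v = \<sigma> * coord u k) \<and>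
      (\<forall>j. ((\<lambda>k. coord (A k) j * coord u k) has_sum (\<sigma> * coord v j)) UNIV))"

text \<open>The set is finite and nonempty if the matricization has finite positive rank.\<close>

definition smallest_singular_value :: "'d \<Rightarrow> ('d \<Rightarrow> nat) ell2 \<Rightarrow> real"
  where "smallest_singular_value \<mu> X = Min {\<sigma>. pos_singular_value (matricization \<mu> X) \<sigma>}"

lemma square_summable_elementary_tensor:
  fixes u :: "'d::finite \<Rightarrow> nat \<Rightarrow> real"
  assumes "\<And>\<mu>. (\<lambda>i. (u \<mu> i)\<^sup>2) summable_on UNIV"
  shows "(\<lambda>i. (\<Prod>\<mu>\<in>UNIV. u \<mu> (i \<mu>))\<^sup>2) summable_on UNIV"
proof -
  have "Infinite_Set_Sum.abs_summable_on (\<lambda>i. (u \<mu> i)\<^sup>2) UNIV" for \<mu>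
    using assms[of \<mu>] unfolding abs_summable_equivalent[symmetric] by simp
  then have "Infinite_Set_Sum.abs_summable_on (\<lambda>i. \<Prod>\<mu>\<in>UNIV. (u \<mu> (i \<mu>))\<^sup>2) (PiE UNIV (\<lambda>_. UNIV))"
    by (intro abs_summable_on_prod_PiE) auto
  then have "(\<lambda>i. norm (\<Prod>\<mu>\<in>UNIV. (u \<mu> (i \<mu>))\<^sup>2)) summable_on UNIV"
    unfolding abs_summable_equivalent PiE_UNIV_domain by simp
  then have "(\<lambda>i. \<Prod>\<mu>\<in>UNIV. (u \<mu> (i \<mu>))\<^sup>2) summable_on UNIV"
    by (rule abs_summable_summable)
  then show ?thesis by (simp add: prod_power_distrib)
qed

text \<open>
  \<open>tucker r C U\<close> is the simultaneous multiplication of \<open>U \<mu>\<close> onto mode \<open>\<mu>\<close> of \<open>C\<close>, for all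
  \<open>\<mu>\<close>. Here \<open>U \<mu>\<close> is the matrix with columns \<open>U \<mu> 0, \<dots>, U \<mu> (r \<mu> - 1)\<close>; further columns are
  ignored.
\<close>

lift_definition tucker ::
  "('d::finite \<Rightarrow> nat) \<Rightarrow> ('d \<Rightarrow> nat) ell2 \<Rightarrow> ('d \<Rightarrow> nat \<Rightarrow> nat ell2) \<Rightarrow> ('d \<Rightarrow> nat) ell2"
  is "\<lambda>r C U i. \<Sum>j\<in>index_box r. C j * (\<Prod>\<mu>\<in>UNIV. U \<mu> (j \<mu>) (i \<mu>))"
  by (rule square_summable_sum, rule square_summable_scale,
      rule square_summable_elementary_tensor)

lift_definition mat_columns :: "real mat \<Rightarrow> nat \<Rightarrow> nat ell2"
  is "\<lambda>A k i. if i < dim_row A then A $$ (i, k) else 0"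
  subgoal for A k
    by (rule finite_nonzero_values_imp_summable_on, rule finite_subset[of _ "{..<dim_row A}"]) auto
  done

definition gram :: "nat \<Rightarrow> (nat \<Rightarrow> nat ell2) \<Rightarrow> real mat"
  where "gram n U = Matrix.mat n n (\<lambda>(j, k). inner (U j) (U k))"

definition tucker_manifold ::
  "('d::finite \<Rightarrow> nat) \<Rightarrow> ('d \<Rightarrow> nat) ell2 set \<Rightarrow> ('d \<Rightarrow> nat) ell2 set"
  where "tucker_manifold r Mc =
    {tucker r C U | C U. C \<in> Mc \<and> (\<forall>\<mu>. invertible_mat (gram (r \<mu>) (U \<mu>)))}"

text \<open>
  A representation \<open>X = tucker r C U\<close> is unique up to invertible changes of basis in the modes,
  and each representation yields the same tangent vectors.
\<close>

definition tucker_tangent_space ::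
  "('d::finite \<Rightarrow> nat) \<Rightarrow> ('d \<Rightarrow> nat) ell2 set \<Rightarrow> ('d \<Rightarrow> nat) ell2 \<Rightarrow> ('d \<Rightarrow> nat) ell2 set"
  where "tucker_tangent_space r Mc X =
    {tucker r C' U + (\<Sum>\<mu>\<in>UNIV. tucker r C (U(\<mu> := U' \<mu>))) | C U C' U'.
      X = tucker r C U \<and> C \<in> Mc \<and> (\<forall>\<mu>. invertible_mat (gram (r \<mu>) (U \<mu>))) \<and>
      C' \<in> tangent_space Mc C \<and>
      (\<forall>\<mu>. \<forall>j<r \<mu>. \<forall>k<r \<mu>. inner (U \<mu> j) (U' \<mu> k) = 0)}"

end

theory Submission
  imports Defs "Jordan_Normal_Form.Determinant"
begin

text \<open>
  Let \<open>X = C \<times>\<^sub>1 U\<^sup>1 \<dots> \<times>\<^sub>d U\<^sup>d\<close> and \<open>Y = D \<times>\<^sub>1 V\<^sup>1 \<dots> \<times>\<^sub>d V\<^sup>d\<close>. By the invariance of the core manifold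
  the factors may be replaced by any bases of the column spaces. The proof uses principal vectors:
  orthonormal bases with \<open>\<langle>u\<^sub>j, v\<^sub>k\<rangle> = 0\<close> for \<open>j \<noteq> k\<close> and \<open>\<langle>u\<^sub>k, v\<^sub>k\<rangle> = s\<^sub>k \<ge> 0\<close> in every mode
  (\<open>principal_representations\<close>), which exist by a singular value decomposition of the inner product
  between the column spaces of \<open>X\<close> and \<open>Y\<close>. All comparisons between \<open>X\<close> and \<open>Y\<close> then become
  diagonal.

  The norm of the difference of two orthogonal projections is bounded by \<open>K\<close> as soon as each vector
  of either space can be approximated in the other one up to \<open>K\<close> times its norm
  (\<open>norm_diff_orth_proj_le\<close>). A tangent vector at \<open>X\<close> is an orthogonal sum of a core part
  \<open>C' \<times>\<^sub>1 U\<^sup>1 \<dots> \<times>\<^sub>d U\<^sup>d\<close> and one part \<open>C \<times>\<^sub>\<mu> W \<times> \<dots>\<close> for each mode, with \<open>W\<close> orthogonal to \<open>U\<^sup>\<mu>\<close>, and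
  the parts are approximated separately (\<open>tangent_space_approx\<close>). Put \<open>\<delta> = \<parallel>X - Y\<parallel>\<close>, let \<open>\<tau>\<^sub>\<mu>\<close> be the
  smallest singular value in mode \<open>\<mu>\<close>, and \<open>\<epsilon>\<^sub>\<mu> = \<delta> / \<tau>\<^sub>\<mu>\<close>.

  \<^item> The sines of the principal angles are at most \<open>\<epsilon>\<^sub>\<mu>\<close> (\<open>angle_bound\<close>). Hence exchanging the factors
    in the core part costs at most \<open>sqrt 2 * \<Sum> \<epsilon>\<^sub>\<mu>\<close> (\<open>norm_frame_diff_le\<close>).

  \<^item> Projecting \<open>C'\<close> onto the tangent space at \<open>D\<close> costs \<open>c / \<sigma>' * \<parallel>C - D\<parallel>\<close> by assumption, where \<open>\<sigma>'\<close>
    is the distance of \<open>C\<close> to the boundary of the core manifold. Here \<open>\<parallel>C - D\<parallel> \<le> sqrt 2 * \<delta>\<close>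
    (\<open>norm_core_diff_le\<close>), and \<open>\<sigma> \<le> \<sigma>'\<close> because the factors of \<open>X\<close> embed that boundary isometrically
    into the weak boundary of the manifold (\<open>weak_boundary_distance_le\<close>).

  \<^item> The part of mode \<open>\<mu>\<close> is \<open>\<Sum> W\<^sub>k \<otimes> a\<^sub>k\<close> with the rows \<open>a\<^sub>k\<close> of \<open>X\<close> in mode \<open>\<mu>\<close>. With the rows \<open>b\<^sub>k\<close> of
    \<open>Y\<close>, replacing \<open>a\<^sub>k\<close> by \<open>s\<^sub>k b\<^sub>k\<close> costs at most \<open>\<epsilon>\<^sub>\<mu>\<close>, and removing from \<open>W\<^sub>k\<close> the column space of \<open>Y\<close>
    costs another \<open>\<epsilon>\<^sub>\<mu>\<close> (\<open>mode_tangent_approx\<close>).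

  From \<open>Y\<close> to \<open>X\<close> only the lower bound \<open>\<tau>\<^sub>\<mu> - \<delta>\<close> is available for the singular values
  (\<open>lower_bound_swap\<close>). This suffices: if \<open>2 * (sqrt 2 + 1) * \<Sum> \<epsilon>\<^sub>\<mu> \<ge> 1\<close> then the estimate is trivial,
  since the difference of two projections has norm at most \<open>1\<close>; and otherwise
  \<open>\<delta> / (\<tau>\<^sub>\<mu> - \<delta>) \<le> (sqrt 2 + 1) * \<epsilon>\<^sub>\<mu>\<close>, so that each mode contributes at most \<open>2 * (sqrt 2 + 1) * \<epsilon>\<^sub>\<mu>\<close>.

  Since division by zero yields zero, \<open>\<sigma> > 0\<close> has to be proved as well
  (\<open>weak_boundary_distance_pos\<close>). This combines two facts: submanifolds are locally closed, and the
  multilinear rank does not increase under weak limits (\<open>weak_closure_rank\<close>).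
\<close>

section \<open>Orthonormal families and finite-dimensional subspaces\<close>

definition orthonormal :: "nat \<Rightarrow> (nat \<Rightarrow> 'a::real_inner) \<Rightarrow> bool"
  where "orthonormal n e \<longleftrightarrow> (\<forall>i<n. \<forall>j<n. inner (e i) (e j) = (if i = j then 1 else 0))"

lemma orthonormalD: "orthonormal n e \<Longrightarrow> i < n \<Longrightarrow> j < n \<Longrightarrow> inner (e i) (e j) = (if i = j then 1 else 0)"
  by (auto simp: orthonormal_def)

lemma orthonormal_norm: "orthonormal n e \<Longrightarrow> i < n \<Longrightarrow> norm (e i) = 1"
  by (simp add: orthonormal_def norm_eq_sqrt_inner)

lemma inner_orthonormal_sum:
  assumes "orthonormal n e" "j < n"
  shows "inner (\<Sum>i<n. x i *\<^sub>R e i) (e j) = x j" "inner (e j) (\<Sum>i<n. x i *\<^sub>R e i) = x j"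
proof -
  have "inner (\<Sum>i<n. x i *\<^sub>R e i) (e j) = (\<Sum>i<n. if i = j then x i else 0)"
    unfolding inner_sum_left by (rule sum.cong) (use assms in \<open>auto simp: orthonormalD\<close>)
  then show "inner (\<Sum>i<n. x i *\<^sub>R e i) (e j) = x j" using assms by simp
  then show "inner (e j) (\<Sum>i<n. x i *\<^sub>R e i) = x j" by (simp add: inner_commute)
qed

lemma in_span_family:
  "v \<in> span (e ` {..<n}) \<longleftrightarrow> (\<exists>x. v = (\<Sum>i<n::nat. x i *\<^sub>R (e i :: 'a::real_vector)))"
proof
  assume "v \<in> span (e ` {..<n})"
  then show "\<exists>x. v = (\<Sum>i<n. x i *\<^sub>R e i)"
  proof (induction rule: span_induct_alt)
    case base
    show ?case by (rule exI[of _ "\<lambda>_. 0"]) simp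
  next
    case (step c x y)
    from step obtain j z where j: "j < n" "x = e j" "y = (\<Sum>i<n. z i *\<^sub>R e i)" by auto
    have "c *\<^sub>R e j = (\<Sum>i<n. (if i = j then c else 0) *\<^sub>R e i)"
      using j(1) by (simp add: if_distrib[of "\<lambda>c. c *\<^sub>R _"] sum.delta cong: if_cong)
    then have "c *\<^sub>R x + y = (\<Sum>i<n. ((if i = j then c else 0) + z i) *\<^sub>R e i)"
      using j by (simp add: sum.distrib scaleR_left_distrib)
    then show ?case by (rule exI[of _ "\<lambda>i. (if i = j then c else 0) + z i"])
  qed
next
  assume "\<exists>x. v = (\<Sum>i<n. x i *\<^sub>R e i)"
  then show "v \<in> span (e ` {..<n})"
    by (auto intro!: span_sum span_scale intro: span_base)
qed

lemma sum_in_span_family: "(\<Sum>i<n::nat. x i *\<^sub>R e i) \<in> span (e ` {..<n})"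
  using in_span_family by blast

lemma inner_span_family_eq_0:
  assumes "y \<in> span (g ` {..<n::nat})" "\<And>i. i < n \<Longrightarrow> inner x (g i) = 0"
  shows "inner (x::'a::real_inner) y = 0"
  using assms(1) by (induction rule: span_induct_alt) (auto simp: inner_add_right assms(2))

lemma orthonormal_expand:
  assumes "orthonormal n e" "v \<in> span (e ` {..<n})"
  shows "v = (\<Sum>i<n. inner v (e i) *\<^sub>R e i)"
proof -
  obtain x where x: "v = (\<Sum>i<n. x i *\<^sub>R e i)" using assms(2) in_span_family by blast
  have "inner v (e j) = x j" if "j < n" for j
    unfolding x using inner_orthonormal_sum(1)[OF assms(1) that] .
  then have "(\<Sum>i<n. inner v (e i) *\<^sub>R e i) = (\<Sum>i<n. x i *\<^sub>R e i)"
    by (intro sum.cong) auto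
  then show ?thesis using x by simp
qed

lemma norm_sum_orthogonal:
  fixes v :: "'b \<Rightarrow> 'a::real_inner"
  assumes "finite I" "\<And>i j. i \<in> I \<Longrightarrow> j \<in> I \<Longrightarrow> i \<noteq> j \<Longrightarrow> inner (v i) (v j) = 0"
  shows "(norm (\<Sum>i\<in>I. v i))\<^sup>2 = (\<Sum>i\<in>I. (norm (v i))\<^sup>2)"
proof -
  have "(norm (\<Sum>i\<in>I. v i))\<^sup>2 = (\<Sum>i\<in>I. \<Sum>j\<in>I. inner (v i) (v j))"
    unfolding power2_norm_eq_inner inner_sum_left inner_sum_right by (rule sum.swap)
  also have "\<dots> = (\<Sum>i\<in>I. \<Sum>j\<in>I. if j = i then inner (v i) (v i) else 0)"
    by (intro sum.cong refl) (use assms in auto)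
  also have "\<dots> = (\<Sum>i\<in>I. (norm (v i))\<^sup>2)"
    using assms(1) by (simp add: power2_norm_eq_inner)
  finally show ?thesis .
qed

lemma norm_orthonormal_sum:
  assumes "orthonormal n e"
  shows "(norm (\<Sum>i<n. x i *\<^sub>R e i))\<^sup>2 = (\<Sum>i<n. (x i)\<^sup>2)"
proof -
  have "(norm (\<Sum>i<n. x i *\<^sub>R e i))\<^sup>2 = (\<Sum>i<n. (norm (x i *\<^sub>R e i))\<^sup>2)"
    by (rule norm_sum_orthogonal) (use assms in \<open>auto simp: orthonormalD\<close>)
  then show ?thesis
    using assms by (simp add: orthonormal_norm power_mult_distrib)
qed

text \<open>
  A Bessel inequality for orthogonal systems that are not normalised, such as the differences of
  two orthonormal systems: apply the Cauchy--Schwarz inequality to \<open>v\<close> and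
  \<open>\<Sum>i\<in>I. inner v (d i) *\<^sub>R d i\<close>.
\<close>

lemma Bessel_scaled:
  fixes d :: "'b \<Rightarrow> 'a::real_inner"
  assumes "finite I" "\<And>i j. i \<in> I \<Longrightarrow> j \<in> I \<Longrightarrow> i \<noteq> j \<Longrightarrow> inner (d i) (d j) = 0"
    and "\<And>i. i \<in> I \<Longrightarrow> (norm (d i))\<^sup>2 \<le> \<kappa>" and "0 \<le> \<kappa>"
  shows "(\<Sum>i\<in>I. (inner v (d i))\<^sup>2) \<le> \<kappa> * (norm v)\<^sup>2"
proof -
  define w where "w = (\<Sum>i\<in>I. inner v (d i) *\<^sub>R d i)"
  define S where "S = (\<Sum>i\<in>I. (inner v (d i))\<^sup>2)"
  have vw: "inner v w = S"
    by (simp add: w_def S_def inner_sum_right power2_eq_square)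
  have S0: "S \<ge> 0" by (simp add: S_def sum_nonneg)
  have "(norm w)\<^sup>2 = (\<Sum>i\<in>I. (norm (inner v (d i) *\<^sub>R d i))\<^sup>2)"
    unfolding w_def by (rule norm_sum_orthogonal) (use assms in auto)
  also have "\<dots> \<le> (\<Sum>i\<in>I. (inner v (d i))\<^sup>2 * \<kappa>)"
    by (intro sum_mono) (use assms in \<open>auto simp: power_mult_distrib intro!: mult_left_mono\<close>)
  finally have w: "(norm w)\<^sup>2 \<le> \<kappa> * S" by (simp add: S_def sum_distrib_left mult.commute)
  have "S\<^sup>2 \<le> (norm v * norm w)\<^sup>2"
    using Cauchy_Schwarz_ineq2[of v w] S0 unfolding vw by (intro power_mono) auto
  also have "\<dots> \<le> (norm v)\<^sup>2 * (\<kappa> * S)"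
    using w by (simp add: power_mult_distrib mult_left_mono)
  finally have "S * S \<le> S * (\<kappa> * (norm v)\<^sup>2)" by (simp add: power2_eq_square algebra_simps)
  then have "S \<le> \<kappa> * (norm v)\<^sup>2"
    using S0 assms(4) by (cases "S = 0") (auto simp: mult_le_cancel_left)
  then show ?thesis by (simp add: S_def)
qed

lemma orthonormal_independent:
  assumes "orthonormal n e"
  shows "inj_on e {..<n}" "independent (e ` {..<n})"
proof -
  show inj: "inj_on e {..<n}"
  proof (rule inj_onI)
    fix i j assume ij: "i \<in> {..<n}" "j \<in> {..<n}" "e i = e j"
    then have "inner (e i) (e j) = 1" using assms orthonormalD[of n e j j] by simp
    then show "i = j" using ij assms orthonormalD[of n e i j] by (auto split: if_splits)
  qed
  show "independent (e ` {..<n})"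
  proof (rule independent_if_scalars_zero)
    fix f x assume f: "(\<Sum>x\<in>e ` {..<n}. f x *\<^sub>R x) = 0" and x: "x \<in> e ` {..<n}"
    then obtain j where j: "j < n" "x = e j" by auto
    have "0 = (\<Sum>i<n. f (e i) *\<^sub>R e i)" using f by (simp add: sum.reindex[OF inj])
    then show "f x = 0"
      using inner_orthonormal_sum(1)[OF assms j(1), of "\<lambda>i. f (e i)"] j by simp
  qed simp
qed

lemma dim_span_orthonormal: "orthonormal n e \<Longrightarrow> dim (span (e ` {..<n})) = n"
  using orthonormal_independent[of n e] by (simp add: dim_eq_card_independent card_image)

lemma orthonormal_extend:
  assumes e: "orthonormal n e" and v: "norm v = 1" and orth: "\<And>i. i < n \<Longrightarrow> inner v (e i) = 0"
  shows "orthonormal (Suc n) (e(n := v))" "span ((e(n := v)) ` {..<Suc n}) = span (insert v (e ` {..<n}))"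
proof -
  have "inner v v = 1" using v by (simp add: norm_eq_sqrt_inner)
  then show "orthonormal (Suc n) (e(n := v))"
    using e orth by (auto simp: orthonormal_def less_Suc_eq inner_commute)
  have "(e(n := v)) ` {..<Suc n} = insert v (e ` {..<n})"
    by (auto simp: lessThan_Suc)
  then show "span ((e(n := v)) ` {..<Suc n}) = span (insert v (e ` {..<n}))" by simp
qed

lemma Gram_Schmidt:
  assumes "finite S"
  shows "\<exists>n e. orthonormal n (e :: nat \<Rightarrow> 'a::real_inner) \<and> span (e ` {..<n}) = span S"
  using assms
proof induction
  case empty
  show ?case by (intro exI[of _ 0]) (simp add: orthonormal_def)
next
  case (insert x S)
  then obtain n e where e: "orthonormal n (e :: nat \<Rightarrow> 'a)" "span (e ` {..<n}) = span S" by blast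
  define p where "p = (\<Sum>i<n. inner x (e i) *\<^sub>R e i)"
  define y where "y = x - p"
  have p: "p \<in> span S" unfolding p_def e(2)[symmetric] by (rule sum_in_span_family)
  have orth: "inner y (e i) = 0" if "i < n" for i
    using inner_orthonormal_sum(1)[OF e(1) that] by (simp add: y_def inner_diff_left p_def)
  show ?case
  proof (cases "y = 0")
    case True
    then have "x \<in> span S" using p by (simp add: y_def)
    then have "span (insert x S) = span S" by (rule span_redundant)
    then show ?thesis using e by metis
  next
    case False
    define v where "v = (1 / norm y) *\<^sub>R y"
    have v: "norm v = 1" "\<And>i. i < n \<Longrightarrow> inner v (e i) = 0"
      using False orth by (auto simp: v_def)
    have "span (insert v (e ` {..<n})) = span (insert x S)"
      unfolding span_eq
    proof
      have "v \<in> span (insert x S)"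
        using p span_mono[of S "insert x S"] unfolding v_def y_def
        by (intro span_scale span_diff) (auto intro: span_base)
      moreover have "e ` {..<n} \<subseteq> span (insert x S)"
        using e(2) span_mono[of S "insert x S"] span_superset[of "e ` {..<n}"] by blast
      ultimately show "insert v (e ` {..<n}) \<subseteq> span (insert x S)" by simp
      have S: "span S \<subseteq> span (insert v (e ` {..<n}))"
        using e(2) span_mono[of "e ` {..<n}" "insert v (e ` {..<n})"] by blast
      have "x = norm y *\<^sub>R v + p" using False by (simp add: v_def y_def)
      then have "x \<in> span (insert v (e ` {..<n}))"
        using S p by (metis span_add span_scale span_base insertI1 subsetD)
      then show "insert x S \<subseteq> span (insert v (e ` {..<n}))"
        using S span_superset[of S] by blast
    qed
    then show ?thesis using orthonormal_extend[OF e(1) v] by metis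
  qed
qed

lemma orthonormal_basis_finite_dim:
  assumes "subspace E" "E \<subseteq> span S" "finite S"
  obtains e where "orthonormal (dim E) (e :: nat \<Rightarrow> 'a::real_inner)" "span (e ` {..<dim E}) = E"
proof -
  obtain B where B: "B \<subseteq> E" "independent B" "E \<subseteq> span B" by (rule maximal_independent_subset)
  then have "finite B" using independent_span_bound[OF assms(3), of B] assms(2) by blast
  have BE: "span B = E" using B assms(1) by (simp add: span_subspace)
  obtain n e where e: "orthonormal n (e :: nat \<Rightarrow> 'a)" "span (e ` {..<n}) = E"
    using Gram_Schmidt[OF \<open>finite B\<close>] BE by metis
  have "n = dim E" using dim_span_orthonormal[OF e(1)] e(2) by simp
  then show ?thesis using that[of e] e by simp
qed

definition linear_indep :: "nat \<Rightarrow> (nat \<Rightarrow> 'a::real_vector) \<Rightarrow> bool"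
  where "linear_indep n v \<longleftrightarrow> (\<forall>x. (\<Sum>i<n. x i *\<^sub>R v i) = 0 \<longrightarrow> (\<forall>i<n. x i = 0))"

lemma linear_indep_independent:
  assumes "linear_indep n v"
  shows "inj_on v {..<n}" "independent (v ` {..<n})"
proof -
  show inj: "inj_on v {..<n}"
  proof (rule inj_onI, rule ccontr)
    fix i j assume ij: "i \<in> {..<n}" "j \<in> {..<n}" "v i = v j" "i \<noteq> j"
    have "(\<Sum>k<n. ((if k = i then 1 else 0) - (if k = j then 1 else 0)) *\<^sub>R v k)
        = (\<Sum>k<n. (if k = i then v k else 0)) - (\<Sum>k<n. if k = j then v k else 0)"
      unfolding sum_subtractf[symmetric] by (intro sum.cong) auto
    also have "\<dots> = 0" using ij by simp
    finally have "(\<Sum>k<n. ((if k = i then 1 else 0) - (if k = j then 1 else 0)) *\<^sub>R v k) = 0" .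
    from assms[unfolded linear_indep_def, rule_format, OF this, of i] show False using ij by simp
  qed
  show "independent (v ` {..<n})"
  proof (rule independent_if_scalars_zero)
    fix f x assume f: "(\<Sum>x\<in>v ` {..<n}. f x *\<^sub>R x) = 0" and x: "x \<in> v ` {..<n}"
    then obtain j where j: "j < n" "x = v j" by auto
    have "(\<Sum>i<n. f (v i) *\<^sub>R v i) = 0" using f by (simp add: sum.reindex[OF inj])
    then show "f x = 0" using assms j by (auto simp: linear_indep_def)
  qed simp
qed

lemma independent_linear_indep:
  assumes "inj_on v {..<n}" "independent (v ` {..<n})"
  shows "linear_indep n v"
  unfolding linear_indep_def
proof (intro allI impI)
  fix x :: "nat \<Rightarrow> real" and i assume x: "(\<Sum>i<n. x i *\<^sub>R v i) = 0" and i: "i < n"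
  define f where "f w = x (the_inv_into {..<n} v w)" for w
  have f: "f (v j) = x j" if "j < n" for j
    using the_inv_into_f_f[OF assms(1)] that by (simp add: f_def)
  have "(\<Sum>w\<in>v ` {..<n}. f w *\<^sub>R w) = (\<Sum>i<n. x i *\<^sub>R v i)"
    by (simp add: sum.reindex[OF assms(1)] f)
  then have "f (v i) = 0"
    using assms(2) x i independentD[of "v ` {..<n}" "v ` {..<n}" f "v i"] by auto
  then show "x i = 0" using f i by simp
qed

lemma linear_indep_le:
  assumes "linear_indep n v" "\<And>i. i < n \<Longrightarrow> v i \<in> span S" "finite S"
  shows "n \<le> card S"
  using independent_span_bound[of S "v ` {..<n}"] linear_indep_independent[OF assms(1)] assms(2,3)
  by (auto simp: card_image)

lemma linear_indep_orthonormal_basis: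
  assumes "linear_indep n v"
  obtains e where "orthonormal n (e :: nat \<Rightarrow> 'a::real_inner)" "span (e ` {..<n}) = span (v ` {..<n})"
proof -
  have d: "dim (span (v ` {..<n})) = n"
    using linear_indep_independent[OF assms] by (simp add: dim_eq_card_independent card_image)
  show thesis
    using orthonormal_basis_finite_dim[of "span (v ` {..<n})" "v ` {..<n}"] that unfolding d by auto
qed

lemma closed_span_orthonormal:
  assumes "orthonormal n e"
  shows "closed (span (e ` {..<n}) :: 'a::real_inner set)"
proof -
  have "v \<in> span (e ` {..<n}) \<longleftrightarrow> v = (\<Sum>i<n. inner v (e i) *\<^sub>R e i)" for v
    using orthonormal_expand[OF assms, of v] sum_in_span_family[of "\<lambda>i. inner v (e i)" e n] by metis
  then have "span (e ` {..<n}) = {v. v = (\<Sum>i<n. inner v (e i) *\<^sub>R e i)}" by blast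
  moreover have "closed {v. v = (\<Sum>i<n. inner v (e i) *\<^sub>R e i)}"
    by (intro closed_Collect_eq continuous_intros)
  ultimately show ?thesis by simp
qed

lemma closed_finite_dim_subspace:
  assumes "subspace E" "E \<subseteq> span S" "finite S"
  shows "closed (E :: 'a::real_inner set)"
proof -
  obtain e where e: "orthonormal (dim E) e" "span (e ` {..<dim E}) = E"
    using orthonormal_basis_finite_dim[OF assms] .
  show ?thesis using closed_span_orthonormal[OF e(1)] unfolding e(2) .
qed

section \<open>Singular value decomposition\<close>

lemma compact_span_sphere:
  assumes "orthonormal n e"
  shows "compact {v \<in> span (e ` {..<n}). norm (v :: 'a::real_inner) = 1}"
proof -
  define K where "K m = {v. \<exists>x. (\<forall>i<m. \<bar>x i\<bar> \<le> 1) \<and> v = (\<Sum>i<m. x i *\<^sub>R e i)}" for m :: nat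
  have K: "compact (K m)" for m
  proof (induction m)
    case (Suc m)
    have "K (Suc m) = (\<lambda>(v, a). v + a *\<^sub>R e m) ` (K m \<times> {-1..1})"
    proof (intro equalityI subsetI)
      fix v assume "v \<in> K (Suc m)"
      then obtain x where x: "\<forall>i<Suc m. \<bar>x i\<bar> \<le> 1" "v = (\<Sum>i<Suc m. x i *\<^sub>R e i)"
        by (auto simp: K_def)
      have "\<bar>x m\<bar> \<le> 1" using x(1) by blast
      then have "x m \<in> {-1..1}" by auto
      moreover have "(\<Sum>i<m. x i *\<^sub>R e i) \<in> K m"
        unfolding K_def using x(1) by (intro CollectI exI[of _ x]) auto
      ultimately
      show "v \<in> (\<lambda>(v, a). v + a *\<^sub>R e m) ` (K m \<times> {-1..1})"
        using x(2) by (auto intro!: image_eqI[of _ _ "(\<Sum>i<m. x i *\<^sub>R e i, x m)"])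
    next
      fix v assume "v \<in> (\<lambda>(v, a). v + a *\<^sub>R e m) ` (K m \<times> {-1..1})"
      then obtain x a where x: "\<forall>i<m. \<bar>x i\<bar> \<le> 1" "\<bar>a\<bar> \<le> 1" "v = (\<Sum>i<m. x i *\<^sub>R e i) + a *\<^sub>R e m"
        by (auto simp: K_def abs_le_iff)
      then have "v = (\<Sum>i<Suc m. (x(m := a)) i *\<^sub>R e i)" "\<forall>i<Suc m. \<bar>(x(m := a)) i\<bar> \<le> 1" by auto
      then show "v \<in> K (Suc m)" unfolding K_def by blast
    qed
    moreover have "compact ((\<lambda>(v, a). v + a *\<^sub>R e m) ` (K m \<times> {-1..1::real}))"
      by (intro compact_continuous_image compact_Times Suc)
        (auto intro!: continuous_intros simp: case_prod_beta)
    ultimately show ?case by simp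
  qed (simp add: K_def)
  have "{v \<in> span (e ` {..<n}). norm v = 1} = K n \<inter> (span (e ` {..<n}) \<inter> {v. norm v = 1})"
  proof -
    have "v \<in> K n" if v: "v \<in> span (e ` {..<n})" "norm v = 1" for v
    proof -
      have "\<bar>inner v (e i)\<bar> \<le> 1" if "i < n" for i
        using Cauchy_Schwarz_ineq2[of v "e i"] v(2) orthonormal_norm[OF assms that] by simp
      then have "(\<Sum>i<n. inner v (e i) *\<^sub>R e i) \<in> K n"
        unfolding K_def by (intro CollectI exI[of _ "\<lambda>i. inner v (e i)"]) simp
      then show ?thesis
        using orthonormal_expand[OF assms v(1)] by simp
    qed
    then show ?thesis by auto
  qed
  then show ?thesis
    by (simp only:) (intro compact_Int_closed closed_Int K closed_span_orthonormal[OF assms] closed_Collect_eq continuous_intros)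
qed

lemma orthonormal_complement:
  assumes e: "orthonormal (Suc n) e" and u: "u \<in> span (e ` {..<Suc n})" "norm (u :: 'a::real_inner) = 1"
  obtains f where "orthonormal n f" "\<And>i. i < n \<Longrightarrow> inner u (f i) = 0"
    "span (insert u (f ` {..<n})) = span (e ` {..<Suc n})"
proof -
  let ?E = "span (e ` {..<Suc n})"
  define F where "F = {v \<in> ?E. inner u v = 0}"
  have F: "subspace F" by (auto simp: F_def subspace_def inner_add_right span_add span_scale span_0)
  obtain f where f: "orthonormal (dim F) f" "span (f ` {..<dim F}) = F"
    using orthonormal_basis_finite_dim[OF F, of "e ` {..<Suc n}"] by (auto simp: F_def)
  have uf: "inner u (f i) = 0" if "i < dim F" for i
  proof -
    have "f i \<in> F" using f(2) that span_base[of "f i" "f ` {..<dim F}"] by auto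
    then show ?thesis by (simp add: F_def)
  qed
  have span: "span (insert u (f ` {..<dim F})) = ?E"
    unfolding span_eq
  proof
    have "f ` {..<dim F} \<subseteq> ?E" using f(2) span_superset[of "f ` {..<dim F}"] by (auto simp: F_def)
    then show "insert u (f ` {..<dim F}) \<subseteq> ?E" using u by simp
    have "v \<in> span (insert u (f ` {..<dim F}))" if v: "v \<in> ?E" for v
    proof -
      have "v - inner u v *\<^sub>R u \<in> F"
        using u v by (simp add: F_def span_diff span_scale inner_diff_right power2_norm_eq_inner[symmetric])
      then have "v - inner u v *\<^sub>R u \<in> span (insert u (f ` {..<dim F}))"
        using f(2) span_mono[of "f ` {..<dim F}" "insert u (f ` {..<dim F})"] by blast
      then have "(v - inner u v *\<^sub>R u) + inner u v *\<^sub>R u \<in> span (insert u (f ` {..<dim F}))"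
        by (rule span_add) (auto intro: span_scale span_base)
      then show ?thesis by simp
    qed
    then show "e ` {..<Suc n} \<subseteq> span (insert u (f ` {..<dim F}))"
      using span_superset[of "e ` {..<Suc n}"] by blast
  qed
  have ext: "orthonormal (Suc (dim F)) (f(dim F := u))"
    by (rule orthonormal_extend(1)[OF f(1) u(2)]) (rule uf)
  have "span ((f(dim F := u)) ` {..<Suc (dim F)}) = ?E"
    unfolding span[symmetric] by (rule orthonormal_extend(2)[OF f(1) u(2)]) (rule uf)
  with dim_span_orthonormal[OF ext] have "Suc (dim F) = dim ?E" by (simp only:)
  then have dn: "dim F = n" using dim_span_orthonormal[OF e] by simp
  show ?thesis by (rule that[OF f(1)[unfolded dn] uf[unfolded dn] span[unfolded dn]])
qed

text \<open>
  A maximiser \<open>(u, v)\<close> of \<open>B\<close> over the product of the two unit spheres is a critical point, so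
  \<open>B u\<close> and \<open>B _ v\<close> vanish on the orthogonal complements of \<open>v\<close> and \<open>u\<close>, and the decomposition
  continues on these complements.
\<close>

theorem singular_value_decomposition:
  fixes e :: "nat \<Rightarrow> 'a::real_inner" and f :: "nat \<Rightarrow> 'b::real_inner" and B :: "'a \<Rightarrow> 'b \<Rightarrow> real"
  assumes B: "bilinear B" and cont: "continuous_on UNIV (\<lambda>(x, y). B x y)"
    and "orthonormal n e" "orthonormal n f"
  shows "\<exists>u v s. orthonormal n u \<and> orthonormal n v \<and>
    span (u ` {..<n}) = span (e ` {..<n}) \<and> span (v ` {..<n}) = span (f ` {..<n}) \<and>
    (\<forall>i<n. \<forall>j<n. B (u i) (v j) = (if i = j then s i else 0)) \<and> (\<forall>i<n. 0 \<le> s i)"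
  using assms(3,4)
proof (induction n arbitrary: e f)
  case 0
  show ?case by (intro exI[of _ e] exI[of _ f] exI[of _ "\<lambda>_. 0"]) (simp add: orthonormal_def)
next
  case (Suc n)
  define SE where "SE = {v \<in> span (e ` {..<Suc n}). norm v = 1}"
  define SF where "SF = {v \<in> span (f ` {..<Suc n}). norm v = 1}"
  have comp: "compact (SE \<times> SF)"
    unfolding SE_def SF_def by (intro compact_Times compact_span_sphere Suc.prems)
  have "e 0 \<in> SE" "f 0 \<in> SF"
    using Suc.prems by (auto simp: SE_def SF_def orthonormal_norm intro!: span_base)
  then have "SE \<times> SF \<noteq> {}" by blast
  then obtain m where m: "m \<in> SE \<times> SF" "\<And>y. y \<in> SE \<times> SF \<Longrightarrow> (case y of (x, y) \<Rightarrow> B x y) \<le> (case m of (x, y) \<Rightarrow> B x y)"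
    using continuous_attains_sup[OF comp _ continuous_on_subset[OF cont subset_UNIV]] by metis
  obtain u0 v0 where uv: "m = (u0, v0)" by force
  have max: "B x y \<le> B u0 v0" if "x \<in> SE" "y \<in> SF" for x y using m(2)[of "(x, y)"] that uv by simp
  have u0: "u0 \<in> span (e ` {..<Suc n})" "norm u0 = 1" and v0: "v0 \<in> span (f ` {..<Suc n})" "norm v0 = 1"
    using m(1) uv by (auto simp: SE_def SF_def)
  have S0: "u0 \<in> SE" "v0 \<in> SF" using m(1) uv by auto
  note [simp] = bilinear_lmul[OF B] bilinear_rmul[OF B] bilinear_ladd[OF B] bilinear_radd[OF B]
  have pos: "B u0 v0 \<ge> 0"
  proof -
    have "- u0 \<in> SE" using u0 by (simp add: SE_def span_neg)
    from max[OF this S0(2)] have "B (- u0) v0 \<le> B u0 v0" .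
    then show ?thesis using bilinear_lneg[OF B] by simp
  qed
  \<comment> \<open>first-order optimality: a step \<open>t\<close> in an orthogonal direction changes \<open>B\<close> by \<open>t * b\<close>,
    but the norm only to second order; \<open>t = b / (c + 1)\<close> gives a contradiction unless \<open>b = 0\<close>\<close>
  have crit: "b = 0" if *: "\<And>t::real. c + t * b \<le> sqrt (1 + t\<^sup>2) * c" and c: "c \<ge> 0" for b c :: real
  proof (rule ccontr)
    assume b: "b \<noteq> 0"
    have sq: "sqrt (1 + t\<^sup>2) \<le> 1 + t\<^sup>2" for t :: real
    proof (rule real_le_lsqrt)
      have "(1 + t\<^sup>2)\<^sup>2 = 1 + t\<^sup>2 + (t\<^sup>2 + (t\<^sup>2)\<^sup>2)" by (simp add: power2_eq_square algebra_simps)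
      then show "1 + t\<^sup>2 \<le> (1 + t\<^sup>2)\<^sup>2" by simp
    qed auto
    have tb: "t * b \<le> t\<^sup>2 * c" for t
      using *[of t] mult_right_mono[OF sq[of t] c] by (simp add: algebra_simps)
    define t where "t = b / (c + 1)"
    have bt: "b = t * (c + 1)" using c by (simp add: t_def)
    have "t\<^sup>2 * (c + 1) \<le> t\<^sup>2 * c"
      using tb[of t] unfolding bt by (simp add: power2_eq_square mult.assoc)
    then have "t = 0" by (simp add: algebra_simps)
    then show False using b bt by simp
  qed
  have Bu: "B u0 y = 0" if y: "y \<in> span (f ` {..<Suc n})" "inner v0 y = 0" "norm y = 1" for y
  proof (rule crit[OF _ pos])
    fix t :: real
    define w where "w = v0 + t *\<^sub>R y"
    have "(norm w)\<^sup>2 = 1 + t\<^sup>2"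
      unfolding w_def power2_norm_eq_inner
      using y v0 by (simp add: inner_add_left inner_add_right inner_commute[of y v0] norm_eq_1 power2_eq_square)
    then have nw: "norm w = sqrt (1 + t\<^sup>2)" by (metis norm_ge_zero real_sqrt_unique)
    have pos1: "sqrt (1 + t\<^sup>2) > 0" by (simp add: add_pos_nonneg)
    have "(1 / norm w) *\<^sub>R w \<in> SF"
      using y v0 pos1 nw by (auto simp: SF_def w_def intro!: span_scale span_add)
    from max[OF S0(1) this] have "B u0 ((1 / norm w) *\<^sub>R w) \<le> B u0 v0" .
    then show "B u0 v0 + t * B u0 y \<le> sqrt (1 + t\<^sup>2) * B u0 v0"
      using pos1 unfolding nw by (simp add: w_def field_simps)
  qed
  have Bv: "B x v0 = 0" if y: "x \<in> span (e ` {..<Suc n})" "inner u0 x = 0" "norm x = 1" for x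
  proof (rule crit[OF _ pos])
    fix t :: real
    define w where "w = u0 + t *\<^sub>R x"
    have "(norm w)\<^sup>2 = 1 + t\<^sup>2"
      unfolding w_def power2_norm_eq_inner
      using y u0 by (simp add: inner_add_left inner_add_right inner_commute[of x u0] norm_eq_1 power2_eq_square)
    then have nw: "norm w = sqrt (1 + t\<^sup>2)" by (metis norm_ge_zero real_sqrt_unique)
    have pos1: "sqrt (1 + t\<^sup>2) > 0" by (simp add: add_pos_nonneg)
    have "(1 / norm w) *\<^sub>R w \<in> SE"
      using y u0 pos1 nw by (auto simp: SE_def w_def intro!: span_scale span_add)
    from max[OF this S0(2)] have "B ((1 / norm w) *\<^sub>R w) v0 \<le> B u0 v0" .
    then show "B u0 v0 + t * B x v0 \<le> sqrt (1 + t\<^sup>2) * B u0 v0"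
      using pos1 unfolding nw by (simp add: w_def field_simps)
  qed
  obtain e' where e': "orthonormal n e'" "\<And>i. i < n \<Longrightarrow> inner u0 (e' i) = 0"
    "span (insert u0 (e' ` {..<n})) = span (e ` {..<Suc n})"
    using orthonormal_complement[OF Suc.prems(1) u0] by blast
  obtain f' where f': "orthonormal n f'" "\<And>i. i < n \<Longrightarrow> inner v0 (f' i) = 0"
    "span (insert v0 (f' ` {..<n})) = span (f ` {..<Suc n})"
    using orthonormal_complement[OF Suc.prems(2) v0] by blast
  obtain u v s where IH: "orthonormal n u" "orthonormal n v" "span (u ` {..<n}) = span (e' ` {..<n})"
    "span (v ` {..<n}) = span (f' ` {..<n})"
    "\<And>i j. i < n \<Longrightarrow> j < n \<Longrightarrow> B (u i) (v j) = (if i = j then s i else 0)" "\<And>i. i < n \<Longrightarrow> 0 \<le> s i"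
    using Suc.IH[OF e'(1) f'(1)] by blast

  have uu: "inner u0 (u i) = 0" if "i < n" for i
  proof (rule inner_span_family_eq_0[of _ e' n])
    show "u i \<in> span (e' ` {..<n})" unfolding IH(3)[symmetric] using that by (intro span_base) blast
  qed (rule e'(2))
  have vv: "inner v0 (v i) = 0" if "i < n" for i
  proof (rule inner_span_family_eq_0[of _ f' n])
    show "v i \<in> span (f' ` {..<n})" unfolding IH(4)[symmetric] using that by (intro span_base) blast
  qed (rule f'(2))
  have spu: "span (insert u0 (u ` {..<n})) = span (e ` {..<Suc n})"
    unfolding e'(3)[symmetric] by (subst (1 2) span_insert) (simp only: IH(3))
  have spv: "span (insert v0 (v ` {..<n})) = span (f ` {..<Suc n})"
    unfolding f'(3)[symmetric] by (subst (1 2) span_insert) (simp only: IH(4))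
  have ue: "u i \<in> span (e ` {..<Suc n})" "v i \<in> span (f ` {..<Suc n})" if "i < n" for i
  proof -
    have "u i \<in> span (insert u0 (u ` {..<n}))" "v i \<in> span (insert v0 (v ` {..<n}))"
      by (rule span_base, use that in blast)+
    then show "u i \<in> span (e ` {..<Suc n})" "v i \<in> span (f ` {..<Suc n})"
      unfolding spu spv by blast+
  qed
  define U where "U = u(n := u0)" define V where "V = v(n := v0)"
  define s' where "s' = s(n := B u0 v0)"
  have U: "orthonormal (Suc n) U" "span (U ` {..<Suc n}) = span (e ` {..<Suc n})"
    unfolding U_def spu[symmetric] using orthonormal_extend[OF IH(1) u0(2)] uu by blast+
  have V: "orthonormal (Suc n) V" "span (V ` {..<Suc n}) = span (f ` {..<Suc n})"
    unfolding V_def spv[symmetric] using orthonormal_extend[OF IH(2) v0(2)] vv by blast+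
  have BUV: "B (U i) (V j) = (if i = j then s' i else 0)" if ij: "i < Suc n" "j < Suc n" for i j
  proof -
    consider "i < n" "j < n" | "i = n" "j < n" | "i < n" "j = n" | "i = n" "j = n"
      using ij unfolding less_Suc_eq by blast
    then show ?thesis
    proof cases
      case 2
      then show ?thesis using Bu[OF ue(2) vv] IH(2) by (simp add: U_def V_def orthonormal_norm)
    next
      case 3
      then show ?thesis using Bv[OF ue(1) uu] IH(1) by (simp add: U_def V_def orthonormal_norm)
    qed (auto simp: U_def V_def s'_def IH(5))
  qed
  have "\<forall>i<Suc n. 0 \<le> s' i" using IH(6) pos by (auto simp: s'_def less_Suc_eq)
  with U V BUV show ?case by blast
qed

section \<open>Orthogonal projections and the gap between subspaces\<close>

definition has_orth_proj :: "'a::real_inner set \<Rightarrow> bool"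
  where "has_orth_proj S \<longleftrightarrow> subspace S \<and> (\<forall>x. \<exists>p\<in>S. \<forall>s\<in>S. inner (x - p) s = 0)"

lemma orth_proj_eqI:
  assumes "subspace S" "p \<in> S" "\<And>s. s \<in> S \<Longrightarrow> inner (x - p) s = 0"
  shows "orth_proj S x = p"
  unfolding orth_proj_def
proof (rule the_equality)
  fix q assume q: "q \<in> S \<and> (\<forall>s\<in>S. inner (x - q) s = 0)"
  then have "q - p \<in> S" using assms by (simp add: subspace_diff)
  then have "inner (x - p) (q - p) = 0" "inner (x - q) (q - p) = 0" using assms q by auto
  then have "inner (q - p) (q - p) = 0" by (simp add: inner_diff_left)
  then show "q = p" by simp
qed (use assms in auto)

lemma orth_proj_mem: "has_orth_proj S \<Longrightarrow> orth_proj S x \<in> S"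
  and orth_proj_orth: "has_orth_proj S \<Longrightarrow> s \<in> S \<Longrightarrow> inner (x - orth_proj S x) s = 0"
proof -
  assume S: "has_orth_proj S"
  then obtain p where p: "p \<in> S" "\<And>s. s \<in> S \<Longrightarrow> inner (x - p) s = 0" and "subspace S"
    unfolding has_orth_proj_def by blast
  then have "orth_proj S x = p" by (intro orth_proj_eqI)
  then show "orth_proj S x \<in> S" "s \<in> S \<Longrightarrow> inner (x - orth_proj S x) s = 0" using p by auto
qed

lemma orth_proj_of_mem: "has_orth_proj S \<Longrightarrow> x \<in> S \<Longrightarrow> orth_proj S x = x"
  by (rule orth_proj_eqI) (auto simp: has_orth_proj_def)

lemma orth_proj_scaleR:
  assumes "has_orth_proj S"
  shows "orth_proj S (a *\<^sub>R x) = a *\<^sub>R orth_proj S x"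
proof (rule orth_proj_eqI)
  show "subspace S" using assms by (simp add: has_orth_proj_def)
  then show "a *\<^sub>R orth_proj S x \<in> S" using orth_proj_mem[OF assms] by (simp add: subspace_scale)
  show "inner (a *\<^sub>R x - a *\<^sub>R orth_proj S x) s = 0" if "s \<in> S" for s
    using orth_proj_orth[OF assms that, of x] by (simp flip: scaleR_diff_right)
qed

lemma has_orth_proj_span_orthonormal:
  assumes "orthonormal n e"
  shows "has_orth_proj (span (e ` {..<n}))"
  unfolding has_orth_proj_def
proof (intro conjI allI)
  fix x
  let ?p = "\<Sum>i<n. inner x (e i) *\<^sub>R e i"
  have "inner (x - ?p) s = 0" if "s \<in> span (e ` {..<n})" for s
    using that by (rule inner_span_family_eq_0) (simp add: inner_diff_left inner_orthonormal_sum[OF assms])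
  then show "\<exists>p\<in>span (e ` {..<n}). \<forall>s\<in>span (e ` {..<n}). inner (x - p) s = 0"
    by (intro bexI[OF _ sum_in_span_family] ballI)
qed simp

lemma has_orth_proj_finite_dim:
  assumes "subspace E" "E \<subseteq> span S" "finite S"
  shows "has_orth_proj (E :: 'a::real_inner set)"
proof -
  obtain e where e: "orthonormal (dim E) e" "span (e ` {..<dim E}) = E"
    using orthonormal_basis_finite_dim[OF assms] .
  show ?thesis using has_orth_proj_span_orthonormal[OF e(1)] unfolding e(2) .
qed

lemma has_orth_proj_orthogonal_sum:
  assumes I: "finite I" and S: "\<And>i. i \<in> I \<Longrightarrow> has_orth_proj (S i)"
    and orth: "\<And>i j s t. i \<in> I \<Longrightarrow> j \<in> I \<Longrightarrow> i \<noteq> j \<Longrightarrow> s \<in> S i \<Longrightarrow> t \<in> S j \<Longrightarrow> inner s t = 0"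
  shows "has_orth_proj {\<Sum>i\<in>I. t i | t. \<forall>i\<in>I. t i \<in> S i}" (is "has_orth_proj ?T")
  unfolding has_orth_proj_def
proof (intro conjI allI)
  have sub: "subspace (S i)" if "i \<in> I" for i using S[OF that] by (simp add: has_orth_proj_def)
  show "subspace ?T"
    unfolding subspace_def
  proof (intro conjI ballI allI)
    show "0 \<in> ?T" using sub by (auto intro!: exI[of _ "\<lambda>_. 0"] simp: subspace_0)
  next
    fix x y assume "x \<in> ?T" "y \<in> ?T"
    then obtain s t where "x = (\<Sum>i\<in>I. s i)" "y = (\<Sum>i\<in>I. t i)" "\<forall>i\<in>I. s i \<in> S i" "\<forall>i\<in>I. t i \<in> S i"
      by blast
    then show "x + y \<in> ?T"
      using sub by (auto intro!: exI[of _ "\<lambda>i. s i + t i"] simp: sum.distrib subspace_add)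
  next
    fix c :: real and x assume "x \<in> ?T"
    then obtain s where "x = (\<Sum>i\<in>I. s i)" "\<forall>i\<in>I. s i \<in> S i" by blast
    then show "c *\<^sub>R x \<in> ?T"
      using sub by (auto intro!: exI[of _ "\<lambda>i. c *\<^sub>R s i"] simp: scaleR_sum_right subspace_scale)
  qed
  fix x
  let ?p = "\<Sum>i\<in>I. orth_proj (S i) x"
  have "?p \<in> ?T" using orth_proj_mem[OF S] by blast
  moreover have "inner (x - ?p) s = 0" if "s \<in> ?T" for s
  proof -
    obtain t where t: "s = (\<Sum>i\<in>I. t i)" "\<forall>i\<in>I. t i \<in> S i" using \<open>s \<in> ?T\<close> by blast
    have "inner (x - ?p) (t i) = 0" if i: "i \<in> I" for i
    proof -
      have "inner ?p (t i) = (\<Sum>j\<in>I. if j = i then inner (orth_proj (S i) x) (t i) else 0)"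
        unfolding inner_sum_left
        by (intro sum.cong refl) (use orth t(2) i orth_proj_mem[OF S] in auto)
      then have "inner ?p (t i) = inner (orth_proj (S i) x) (t i)" using i I by simp
      then show ?thesis
        using orth_proj_orth[OF S[OF i], of "t i" x] t(2) i by (simp add: inner_diff_left)
    qed
    then show ?thesis by (simp add: t(1) inner_sum_right)
  qed
  ultimately show "\<exists>p\<in>?T. \<forall>s\<in>?T. inner (x - p) s = 0" by blast
qed

text \<open>
  With the projections \<open>P\<close>, \<open>P'\<close> onto \<open>S\<close>, \<open>S'\<close>, the difference splits as
  \<open>P - P' = (1 - P') P - P' (1 - P)\<close>, whose two parts have orthogonal values. The first is
  controlled by the approximability of \<open>S\<close> by \<open>S'\<close>. The second has the adjoint \<open>(1 - P) P'\<close>, which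
  is controlled by the approximability of \<open>S'\<close> by \<open>S\<close>. Since \<open>P Z\<close> and \<open>Z - P Z\<close> are orthogonal as
  well, the two bounds combine without loss in the constant.
\<close>

theorem norm_diff_orth_proj_le:
  assumes S: "has_orth_proj S" and S': "has_orth_proj S'" and K: "0 \<le> K"
    and gap: "\<And>t. t \<in> S \<Longrightarrow> \<exists>t'\<in>S'. norm (t - t') \<le> K * norm t"
    and gap': "\<And>t'. t' \<in> S' \<Longrightarrow> \<exists>t\<in>S. norm (t' - t) \<le> K * norm t'"
  shows "norm (orth_proj S Z - orth_proj S' Z) \<le> K * norm Z"
proof -
  have best: "norm (t - orth_proj T t) \<le> norm (t - t')" if T: "has_orth_proj T" "t' \<in> T" for T and t t' :: 'a
  proof -
    have "orth_proj T t - t' \<in> T"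
      using T orth_proj_mem[OF T(1)] by (simp add: has_orth_proj_def subspace_diff)
    then have o: "inner (t - orth_proj T t) (orth_proj T t - t') = 0" by (rule orth_proj_orth[OF T(1)])
    have "(norm ((t - orth_proj T t) + (orth_proj T t - t')))\<^sup>2
        = (norm (t - orth_proj T t))\<^sup>2 + (norm (orth_proj T t - t'))\<^sup>2"
      unfolding power2_norm_eq_inner inner_add_left inner_add_right inner_commute[of "orth_proj T t - t'" "t - orth_proj T t"] o
      by simp
    then have "(norm (t - t'))\<^sup>2 = (norm (t - orth_proj T t))\<^sup>2 + (norm (orth_proj T t - t'))\<^sup>2" by simp
    then have "(norm (t - orth_proj T t))\<^sup>2 \<le> (norm (t - t'))\<^sup>2" by simp
    then show ?thesis by (simp add: power2_le_iff_abs_le)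
  qed
  define P where "P = orth_proj S Z"
  define a where "a = P - orth_proj S' P"
  define b where "b = orth_proj S' Z - orth_proj S' P"
  have P: "P \<in> S" unfolding P_def by (rule orth_proj_mem[OF S])
  have sub': "subspace S'" using S' by (simp add: has_orth_proj_def)
  have b_mem: "b \<in> S'" unfolding b_def using sub' orth_proj_mem[OF S'] by (simp add: subspace_diff)
  have a_orth: "inner a s = 0" if "s \<in> S'" for s unfolding a_def by (rule orth_proj_orth[OF S' that])
  have diff: "P - orth_proj S' Z = a - b" by (simp add: a_def b_def)
  have a: "norm a \<le> K * norm P"
    using gap[OF P] best[OF S', of _ P] unfolding a_def by (meson order_trans)
  have Zb: "inner (Z - P - b) s = 0" if "s \<in> S'" for s
    using orth_proj_orth[OF S' that, of Z] orth_proj_orth[OF S' that, of P]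
    by (simp add: b_def inner_diff_left)
  have b: "norm b \<le> K * norm (Z - P)"
  proof -
    obtain t where t: "t \<in> S" "norm (b - t) \<le> K * norm b" using gap'[OF b_mem] by blast
    have "inner (Z - P) t = 0" using orth_proj_orth[OF S t(1), of Z] by (simp add: P_def)
    then have "(norm b)\<^sup>2 = inner (Z - P) (b - t)"
      using Zb[OF b_mem] by (simp add: power2_norm_eq_inner inner_diff_left inner_diff_right)
    also have "\<dots> \<le> norm (Z - P) * (K * norm b)"
      using norm_cauchy_schwarz[of "Z - P" "b - t"] t(2) mult_left_mono[OF t(2), of "norm (Z - P)"] by simp
    finally have "norm b * norm b \<le> norm b * (K * norm (Z - P))" by (simp add: power2_eq_square algebra_simps)
    then show ?thesis using K by (cases "b = 0") (auto simp: mult_le_cancel_left)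
  qed
  have Z: "(norm Z)\<^sup>2 = (norm P)\<^sup>2 + (norm (Z - P))\<^sup>2"
  proof -
    have "inner (Z - P) P = 0" using orth_proj_orth[OF S P, of Z] by (simp add: P_def)
    then show ?thesis by (simp add: power2_norm_eq_inner inner_diff_left inner_diff_right inner_commute)
  qed
  have "(norm (a - b))\<^sup>2 = (norm a)\<^sup>2 + (norm b)\<^sup>2"
    using a_orth[OF b_mem] by (simp add: power2_norm_eq_inner inner_diff_left inner_diff_right inner_commute)
  also have "\<dots> \<le> (K * norm P)\<^sup>2 + (K * norm (Z - P))\<^sup>2"
    by (intro add_mono power_mono a b) auto
  also have "\<dots> = (K * norm Z)\<^sup>2" using Z by (simp add: power_mult_distrib distrib_left)
  finally show ?thesis
    using K unfolding P_def[symmetric] diff by (simp add: power2_le_iff_abs_le)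
qed

section \<open>Kernels of square matrices and Gram matrices\<close>

lemma index_mult_mat_sum:
  assumes "A \<in> carrier_mat n n" "B \<in> carrier_mat n n" "i < n" "j < n"
  shows "(A * B) $$ (i, j) = (\<Sum>k<n. A $$ (i, k) * B $$ (k, j))"
  using assms by (simp add: scalar_prod_def lessThan_atLeast0)

lemma invertible_mat_imp_inverse:
  assumes A: "A \<in> carrier_mat n n" "invertible_mat (A :: real mat)"
  obtains B where "B \<in> carrier_mat n n" "invertible_mat B"
    "\<And>i j. i < n \<Longrightarrow> j < n \<Longrightarrow> (\<Sum>k<n. A $$ (i, k) * B $$ (k, j)) = (if i = j then 1 else 0)"
    "\<And>i j. i < n \<Longrightarrow> j < n \<Longrightarrow> (\<Sum>k<n. B $$ (i, k) * A $$ (k, j)) = (if i = j then 1 else 0)"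
proof -
  obtain B where B: "A * B = 1\<^sub>m n" "B * A = 1\<^sub>m (dim_row B)"
    using A unfolding invertible_mat_def inverts_mat_def by auto
  have "dim_col B = n" using arg_cong[OF B(1), of dim_col] by simp
  moreover have "dim_row B = n" using arg_cong[OF B(2), of dim_col] A by simp
  ultimately have Bc: "B \<in> carrier_mat n n" by auto
  moreover have "invertible_mat B"
    using A Bc B unfolding invertible_mat_def inverts_mat_def by auto
  moreover have "(\<Sum>k<n. A $$ (i, k) * B $$ (k, j)) = (if i = j then 1 else 0)" if "i < n" "j < n" for i j
    using index_mult_mat_sum[OF A(1) Bc that] B(1) that by simp
  moreover have "(\<Sum>k<n. B $$ (i, k) * A $$ (k, j)) = (if i = j then 1 else 0)" if "i < n" "j < n" for i j
    using index_mult_mat_sum[OF Bc A(1) that] B(2) Bc that by simp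
  ultimately show ?thesis using that by blast
qed

lemma invertible_mat_iff_kernel:
  assumes A: "A \<in> carrier_mat n n"
  shows "invertible_mat (A :: real mat) \<longleftrightarrow>
    (\<forall>x. (\<forall>i<n. (\<Sum>j<n. A $$ (i, j) * x j) = 0) \<longrightarrow> (\<forall>j<n. x j = 0))" (is "_ \<longleftrightarrow> ?K")
proof
  assume "invertible_mat A"
  then obtain B where B: "\<And>i j. i < n \<Longrightarrow> j < n \<Longrightarrow> (\<Sum>k<n. B $$ (i, k) * A $$ (k, j)) = (if i = j then 1 else 0)"
    using invertible_mat_imp_inverse[OF A] by metis
  show ?K
  proof (intro allI impI)
    fix x :: "nat \<Rightarrow> real" and i assume x: "\<forall>i<n. (\<Sum>j<n. A $$ (i, j) * x j) = 0" and i: "i < n"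
    have "0 = (\<Sum>k<n. B $$ (i, k) * (\<Sum>j<n. A $$ (k, j) * x j))" using x by simp
    also have "\<dots> = (\<Sum>j<n. (\<Sum>k<n. B $$ (i, k) * A $$ (k, j)) * x j)"
      unfolding sum_distrib_left sum_distrib_right by (subst sum.swap) (simp add: mult.assoc)
    also have "\<dots> = (\<Sum>j<n. if i = j then x j else 0)"
      by (intro sum.cong) (auto simp: B[OF i])
    finally show "x i = 0" using i by simp
  qed
next
  assume K: ?K
  have "det A \<noteq> 0"
  proof
    assume "det A = 0"
    then obtain v where v: "v \<in> carrier_vec n" "v \<noteq> 0\<^sub>v n" "A *\<^sub>v v = 0\<^sub>v n"
      using det_0_iff_vec_prod_zero_field[OF A] by blast
    have "(\<Sum>j<n. A $$ (i, j) * v $ j) = 0" if "i < n" for i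
    proof -
      have "(A *\<^sub>v v) $ i = 0" using v(3) that by simp
      then show ?thesis using A v(1) that by (simp add: scalar_prod_def lessThan_atLeast0)
    qed
    then have "\<forall>j<n. v $ j = 0" using K by blast
    then have "v = 0\<^sub>v n" using v(1) by auto
    then show False using v(2) by simp
  qed
  from det_non_zero_imp_unit[OF A this, of "()"] obtain B where
    "B \<in> carrier_mat n n" "B * A = 1\<^sub>m n" "A * B = 1\<^sub>m n"
    unfolding Units_def by (auto simp: ring_mat_simps)
  then show "invertible_mat A"
    using A unfolding invertible_mat_def inverts_mat_def by auto
qed

text \<open>
  Diagonal dominance: each \<open>\<bar>x j\<bar>\<close> is at most \<open>\<eta>\<close> times the sum of all of them, and summing over
  \<open>j\<close> forces the sum to vanish.
\<close>

lemma near_identity_kernel: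
  fixes M :: "nat \<Rightarrow> nat \<Rightarrow> real"
  assumes M: "\<And>i j. i < n \<Longrightarrow> j < n \<Longrightarrow> \<bar>M i j - (if i = j then 1 else 0)\<bar> \<le> \<eta>" and \<eta>: "real n * \<eta> < 1"
    and x: "\<And>j. j < n \<Longrightarrow> (\<Sum>i<n. x i * M i j) = 0" and "k < n"
  shows "x k = 0"
proof -
  define S where "S = (\<Sum>i<n. \<bar>x i\<bar>)"
  have "\<bar>x j\<bar> \<le> \<eta> * S" if j: "j < n" for j
  proof -
    have "(\<Sum>i<n. x i * (M i j - (if i = j then 1 else 0))) = (\<Sum>i<n. x i * M i j) - (\<Sum>i<n. if i = j then x i else 0)"
      unfolding sum_subtractf[symmetric] by (intro sum.cong) (auto simp: algebra_simps)
    also have "\<dots> = - x j" using x[OF j] j by simp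
    finally have "\<bar>x j\<bar> = \<bar>\<Sum>i<n. x i * (M i j - (if i = j then 1 else 0))\<bar>" by simp
    also have "\<dots> \<le> (\<Sum>i<n. \<bar>x i * (M i j - (if i = j then 1 else 0))\<bar>)" by (rule sum_abs)
    also have "\<dots> \<le> (\<Sum>i<n. \<bar>x i\<bar> * \<eta>)"
      unfolding abs_mult by (intro sum_mono mult_left_mono M) (use j in auto)
    finally show ?thesis by (simp add: S_def sum_distrib_left mult.commute)
  qed
  then have "S \<le> (\<Sum>j<n. \<eta> * S)" unfolding S_def[of] by (intro sum_mono) auto
  then have "(1 - real n * \<eta>) * S \<le> 0" by (simp add: algebra_simps)
  then have "S \<le> 0" using \<eta> by (simp add: mult_le_0_iff)
  then have "\<bar>x k\<bar> \<le> 0" using \<open>k < n\<close> member_le_sum[of k "{..<n}" "\<lambda>i. \<bar>x i\<bar>"] by (simp add: S_def)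
  then show ?thesis by simp
qed

lemma gram_carrier: "gram n U \<in> carrier_mat n n"
  by (simp add: gram_def)

lemma invertible_gram_iff: "invertible_mat (gram n U) \<longleftrightarrow> linear_indep n U"
proof -
  have g: "(\<Sum>j<n. gram n U $$ (i, j) * x j) = inner (U i) (\<Sum>j<n. x j *\<^sub>R U j)" if "i < n" for i x
    using that by (simp add: gram_def inner_sum_right mult.commute)
  have "(\<forall>i<n. (\<Sum>j<n. gram n U $$ (i, j) * x j) = 0) \<longleftrightarrow> (\<Sum>j<n. x j *\<^sub>R U j) = 0" for x
  proof
    assume "\<forall>i<n. (\<Sum>j<n. gram n U $$ (i, j) * x j) = 0"
    then have "inner (U i) (\<Sum>j<n. x j *\<^sub>R U j) = 0" if "i < n" for i using g that by simp
    then have "inner (\<Sum>j<n. x j *\<^sub>R U j) (\<Sum>j<n. x j *\<^sub>R U j) = 0"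
      by (subst inner_sum_left) simp
    then show "(\<Sum>j<n. x j *\<^sub>R U j) = 0" by simp
  qed (simp add: g)
  then show ?thesis
    unfolding invertible_mat_iff_kernel[OF gram_carrier] linear_indep_def by simp
qed

lemma linear_indep_orthonormal: "orthonormal n e \<Longrightarrow> linear_indep n e"
  by (intro independent_linear_indep orthonormal_independent)

section \<open>Elementary tensors\<close>

lemma ell2_eqI: "(\<And>i. coord x i = coord y i) \<Longrightarrow> x = y"
  by (simp add: coord_inject[symmetric] fun_eq_iff)

lemma coord_simps [simp]:
  "coord 0 i = 0" "coord (x + y) i = coord x i + coord y i" "coord (x - y) i = coord x i - coord y i"
  "coord (- x) i = - coord x i" "coord (a *\<^sub>R x) i = a * coord x i"
  by (transfer, simp)+

lemma coord_sum [simp]: "coord (\<Sum>j\<in>J. f j) i = (\<Sum>j\<in>J. coord (f j) i)"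
  by (induction J rule: infinite_finite_induct) auto

lemma summable_coord_square: "(\<lambda>i. (coord x i)\<^sup>2) summable_on UNIV"
  by (transfer) simp

lemma inner_ell2_eq: "inner x y = (\<Sum>\<^sub>\<infinity>i. coord x i * coord y i)"
  by transfer simp

lift_definition ell2_unit :: "'a \<Rightarrow> 'a ell2" is "\<lambda>a i. if i = a then 1 else 0"
  subgoal for a by (rule finite_nonzero_values_imp_summable_on) simp
  done

lemma coord_ell2_unit [simp]: "coord (ell2_unit a) i = (if i = a then 1 else 0)"
  by transfer simp

lemma inner_ell2_unit [simp]: "inner (ell2_unit a) x = coord x a" "inner x (ell2_unit a) = coord x a"
proof -
  have "inner (ell2_unit a) x = (\<Sum>\<^sub>\<infinity>i\<in>{a}. coord x i)"
    unfolding inner_ell2_eq by (rule infsum_cong_neutral) auto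
  then show "inner (ell2_unit a) x = coord x a" by simp
  then show "inner x (ell2_unit a) = coord x a" by (simp add: inner_commute)
qed

lemma bounded_linear_coord: "bounded_linear (\<lambda>x. coord x i)"
  using bounded_linear_inner_right[of "ell2_unit i"] by simp

lift_definition elem :: "('d::finite \<Rightarrow> nat ell2) \<Rightarrow> ('d \<Rightarrow> nat) ell2"
  is "\<lambda>u i. \<Prod>\<mu>\<in>UNIV. u \<mu> (i \<mu>)"
  by (rule square_summable_elementary_tensor)

lemma coord_elem: "coord (elem u) i = (\<Prod>\<mu>\<in>UNIV. coord (u \<mu>) (i \<mu>))"
  by transfer simp

lemma inner_elem: "inner (elem u) (elem v) = (\<Prod>\<mu>\<in>UNIV. inner (u \<mu>) (v \<mu>))"
proof -
  have "(\<lambda>k. norm (coord (u \<mu>) k * coord (v \<mu>) k)) summable_on UNIV" for \<mu>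
  proof -
    have "(\<lambda>k. \<bar>coord (u \<mu>) k\<bar> * \<bar>coord (v \<mu>) k\<bar>) summable_on UNIV"
      by (rule square_summable_mult) (simp_all add: summable_coord_square)
    then show ?thesis by (simp add: abs_mult)
  qed
  then have "infsum (\<lambda>i. \<Prod>\<mu>\<in>UNIV. coord (u \<mu>) (i \<mu>) * coord (v \<mu>) (i \<mu>)) (PiE UNIV (\<lambda>_. UNIV))
      = (\<Prod>\<mu>\<in>UNIV. \<Sum>\<^sub>\<infinity>k. coord (u \<mu>) k * coord (v \<mu>) k)"
    by (intro infsum_prod_PiE_abs) auto
  then show ?thesis
    by (simp add: inner_ell2_eq coord_elem prod.distrib PiE_UNIV_domain)
qed

lemma elem_unit: "elem (\<lambda>\<mu>. ell2_unit (i \<mu>)) = ell2_unit i"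
proof (rule ell2_eqI)
  fix j
  show "coord (elem (\<lambda>\<mu>. ell2_unit (i \<mu>))) j = coord (ell2_unit i) j"
  proof (cases "j = i")
    case False
    then obtain \<mu> where "j \<mu> \<noteq> i \<mu>" by (auto simp: fun_eq_iff)
    then have "(\<Prod>\<mu>\<in>UNIV. coord (ell2_unit (i \<mu>)) (j \<mu>)) = 0" by (intro prod_zero) auto
    then show ?thesis using False by (simp add: coord_elem)
  qed (simp add: coord_elem)
qed

section \<open>Tensors of a given size\<close>

lemma index_box_eq: "index_box r = PiE UNIV (\<lambda>\<mu>. {..<r \<mu>})"
  by (auto simp: index_box_def)

lemma finite_index_box [simp]: "finite (index_box (r :: 'd::finite \<Rightarrow> nat))"
  unfolding index_box_eq by (intro finite_PiE) auto

lemma index_boxD: "j \<in> index_box r \<Longrightarrow> j \<mu> < r \<mu>"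
  by (simp add: index_box_def)

lemma tensors_coord_0: "C \<in> tensors r \<Longrightarrow> i \<notin> index_box r \<Longrightarrow> coord C i = 0"
  by (simp add: tensors_def)

lemma subspace_tensors: "subspace (tensors r)"
  by (auto simp: subspace_def tensors_def)

lemma tensors_expand: "C \<in> tensors (r :: 'd::finite \<Rightarrow> nat) \<Longrightarrow> C = (\<Sum>i\<in>index_box r. coord C i *\<^sub>R ell2_unit i)"
  by (rule ell2_eqI) (auto simp: tensors_coord_0 if_distrib[of "\<lambda>x. _ * x"] cong: if_cong)

lemma tensors_in_span: "tensors (r :: 'd::finite \<Rightarrow> nat) \<subseteq> span (ell2_unit ` index_box r)"
proof
  fix C assume "C \<in> tensors r"
  then have "C = (\<Sum>i\<in>index_box r. coord C i *\<^sub>R ell2_unit i)" by (rule tensors_expand)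
  also have "\<dots> \<in> span (ell2_unit ` index_box r)" by (auto intro: span_sum span_scale span_base)
  finally show "C \<in> span (ell2_unit ` index_box r)" .
qed

lemma closed_tensors: "closed (tensors (r :: 'd::finite \<Rightarrow> nat))"
  using closed_finite_dim_subspace[OF subspace_tensors tensors_in_span] by simp

lemma inner_tensors:
  assumes "C \<in> tensors (r :: 'd::finite \<Rightarrow> nat)"
  shows "inner C D = (\<Sum>i\<in>index_box r. coord C i * coord D i)"
proof -
  have "inner C D = inner (\<Sum>i\<in>index_box r. coord C i *\<^sub>R ell2_unit i) D" using tensors_expand[OF assms] by simp
  then show ?thesis by (simp add: inner_sum_left)
qed

lemma norm2_tensors:
  assumes "C \<in> tensors (r :: 'd::finite \<Rightarrow> nat)"
  shows "(norm C)\<^sup>2 = (\<Sum>i\<in>index_box r. (coord C i)\<^sup>2)"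
  unfolding power2_norm_eq_inner inner_tensors[OF assms] by (simp add: power2_eq_square)

section \<open>Mode products\<close>

lemma coord_tucker: "coord (tucker r C U) i = (\<Sum>j\<in>index_box r. coord C j * (\<Prod>\<mu>\<in>UNIV. coord (U \<mu> (j \<mu>)) (i \<mu>)))"
  by transfer simp

lemma tucker_eq_sum_elem: "tucker r C U = (\<Sum>j\<in>index_box r. coord C j *\<^sub>R elem (\<lambda>\<mu>. U \<mu> (j \<mu>)))"
  by (rule ell2_eqI) (simp add: coord_tucker coord_elem)

lemma tucker_diff: "tucker r (C - D) U = tucker r C U - tucker r D U"
  by (simp add: tucker_eq_sum_elem scaleR_left_diff_distrib sum_subtractf)

lemma bounded_linear_tucker: "bounded_linear (\<lambda>C. tucker r C U)"
  unfolding tucker_eq_sum_elem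
  by (intro bounded_linear_sum bounded_linear_scaleR_const bounded_linear_coord)

lemma inner_tucker:
  "inner (tucker r C U) (tucker r' C' U') =
    (\<Sum>j\<in>index_box r. \<Sum>k\<in>index_box r'. coord C j * coord C' k * (\<Prod>\<mu>\<in>UNIV. inner (U \<mu> (j \<mu>)) (U' \<mu> (k \<mu>))))"
  by (simp add: tucker_eq_sum_elem inner_sum_left inner_sum_right inner_elem sum_distrib_left mult.assoc
      del: sum.cong_simp) (subst sum.swap, simp add: algebra_simps)

lemma inner_tucker_orthogonal_mode:
  assumes "\<And>j k. j < r \<mu> \<Longrightarrow> k < r' \<mu> \<Longrightarrow> inner (U \<mu> j) (U' \<mu> k) = 0"
  shows "inner (tucker r C U) (tucker r' C' U') = 0"
proof -
  have "(\<Prod>\<nu>\<in>UNIV. inner (U \<nu> (j \<nu>)) (U' \<nu> (k \<nu>))) = 0" if "j \<in> index_box r" "k \<in> index_box r'" for j k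
    using assms[of "j \<mu>" "k \<mu>"] index_boxD[OF that(1)] index_boxD[OF that(2)] by (intro prod_zero) auto
  then show ?thesis unfolding inner_tucker by (intro sum.neutral ballI) auto
qed

lemma inner_tucker_diagonal:
  assumes "\<And>\<mu> j k. j < r \<mu> \<Longrightarrow> k < r \<mu> \<Longrightarrow> inner (U \<mu> j) (U' \<mu> k) = (if j = k then s \<mu> k else 0)"
  shows "inner (tucker r C U) (tucker r C' U') = (\<Sum>j\<in>index_box r. coord C j * coord C' j * (\<Prod>\<mu>\<in>UNIV. s \<mu> (j \<mu>)))"
proof -
  have "(\<Prod>\<mu>\<in>UNIV. inner (U \<mu> (j \<mu>)) (U' \<mu> (k \<mu>))) = (if k = j then \<Prod>\<mu>\<in>UNIV. s \<mu> (j \<mu>) else 0)"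
    if jk: "j \<in> index_box r" "k \<in> index_box r" for j k
  proof (cases "k = j")
    case False
    then obtain \<mu> where "j \<mu> \<noteq> k \<mu>" by (metis ext)
    then have "inner (U \<mu> (j \<mu>)) (U' \<mu> (k \<mu>)) = 0" using assms index_boxD[OF jk(1)] index_boxD[OF jk(2)] by simp
    then show ?thesis using False by (auto intro!: prod_zero)
  qed (use assms index_boxD[OF jk(1)] in auto)
  then have "inner (tucker r C U) (tucker r C' U') =
      (\<Sum>j\<in>index_box r. \<Sum>k\<in>index_box r. if k = j then coord C j * coord C' j * (\<Prod>\<mu>\<in>UNIV. s \<mu> (j \<mu>)) else 0)"
    unfolding inner_tucker by (intro sum.cong) auto
  then show ?thesis by simp
qed

definition orthonormal_frames :: "('d \<Rightarrow> nat) \<Rightarrow> ('d \<Rightarrow> nat \<Rightarrow> nat ell2) \<Rightarrow> bool"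
  where "orthonormal_frames r U \<longleftrightarrow> (\<forall>\<mu>. orthonormal (r \<mu>) (U \<mu>))"

lemma orthonormal_framesD:
  "orthonormal_frames r U \<Longrightarrow> j < r \<mu> \<Longrightarrow> k < r \<mu> \<Longrightarrow> inner (U \<mu> j) (U \<mu> k) = (if j = k then 1 else 0)"
  using orthonormalD[of "r \<mu>" "U \<mu>" j k] by (simp add: orthonormal_frames_def)

lemma inner_tucker_orthonormal:
  assumes U: "orthonormal_frames r U" and "C \<in> tensors r"
  shows "inner (tucker r C U) (tucker r C' U) = inner C C'"
  using inner_tucker_diagonal[of r U U "\<lambda>_ _. 1" C C'] orthonormal_framesD[OF U]
  by (simp add: inner_tensors[OF assms(2)])

lemma norm_tucker_orthonormal:
  "orthonormal_frames r U \<Longrightarrow> C \<in> tensors r \<Longrightarrow> norm (tucker r C U) = norm C"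
  by (simp add: norm_eq_sqrt_inner inner_tucker_orthonormal)

definition mode_transform :: "('d::finite \<Rightarrow> nat) \<Rightarrow> ('d \<Rightarrow> real mat) \<Rightarrow> ('d \<Rightarrow> nat) ell2 \<Rightarrow> ('d \<Rightarrow> nat) ell2"
  where "mode_transform r T C = tucker r C (\<lambda>\<mu>. mat_columns (T \<mu>))"

lemma coord_mat_columns: "coord (mat_columns A k) i = (if i < dim_row A then A $$ (i, k) else 0)"
  by (simp add: mat_columns.rep_eq)

lemma coord_mode_transform:
  assumes "\<And>\<mu>. T \<mu> \<in> carrier_mat (r \<mu>) (r \<mu>)"
  shows "coord (mode_transform r T C) i =
    (if i \<in> index_box r then \<Sum>j\<in>index_box r. coord C j * (\<Prod>\<mu>\<in>UNIV. T \<mu> $$ (i \<mu>, j \<mu>)) else 0)"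
proof (cases "i \<in> index_box r")
  case True
  then have "i \<mu> < r \<mu>" for \<mu> by (rule index_boxD)
  then show ?thesis
    using True by (simp add: mode_transform_def coord_tucker coord_mat_columns carrier_matD(1)[OF assms])
next
  case False
  then obtain \<mu> where "\<not> i \<mu> < r \<mu>" by (auto simp: index_box_def)
  then have z: "(\<Prod>\<mu>\<in>UNIV. coord (mat_columns (T \<mu>) (j \<mu>)) (i \<mu>)) = 0" for j
    using carrier_matD(1)[OF assms] by (intro prod_zero) (auto simp: coord_mat_columns)
  show ?thesis unfolding mode_transform_def coord_tucker z using False by simp
qed

lemma mode_transform_tensors:
  "(\<And>\<mu>. T \<mu> \<in> carrier_mat (r \<mu>) (r \<mu>)) \<Longrightarrow> mode_transform r T C \<in> tensors r"
  by (auto simp: tensors_def coord_mode_transform)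

text \<open>
  By multilinearity in the factors. This relates the different representations of a point of the
  manifold.
\<close>

lemma tucker_mode_transform:
  assumes T: "\<And>\<mu>. T \<mu> \<in> carrier_mat (r \<mu>) (r \<mu>)"
    and V: "\<And>\<mu> k. k < r \<mu> \<Longrightarrow> V \<mu> k = (\<Sum>l<r \<mu>. T \<mu> $$ (l, k) *\<^sub>R U \<mu> l)"
  shows "tucker r C V = tucker r (mode_transform r T C) U"
proof (rule ell2_eqI)
  fix i
  have "coord (tucker r C V) i = (\<Sum>j\<in>index_box r. coord C j * (\<Prod>\<mu>\<in>UNIV. \<Sum>l<r \<mu>. T \<mu> $$ (l, j \<mu>) * coord (U \<mu> l) (i \<mu>)))"
    unfolding coord_tucker by (intro sum.cong refl) (simp add: V index_box_def)
  also have "\<dots> = (\<Sum>j\<in>index_box r. coord C j * (\<Sum>l\<in>index_box r. \<Prod>\<mu>\<in>UNIV. T \<mu> $$ (l \<mu>, j \<mu>) * coord (U \<mu> (l \<mu>)) (i \<mu>)))"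
    unfolding index_box_eq by (subst prod_sum_PiE) auto
  also have "\<dots> = (\<Sum>l\<in>index_box r. \<Sum>j\<in>index_box r. coord C j * (\<Prod>\<mu>\<in>UNIV. T \<mu> $$ (l \<mu>, j \<mu>)) * (\<Prod>\<mu>\<in>UNIV. coord (U \<mu> (l \<mu>)) (i \<mu>)))"
    unfolding sum_distrib_left by (subst sum.swap) (simp add: prod.distrib mult.assoc)
  also have "\<dots> = coord (tucker r (mode_transform r T C) U) i"
    unfolding coord_tucker by (intro sum.cong refl) (simp add: coord_mode_transform[OF T] sum_distrib_right)
  finally show "coord (tucker r C V) i = coord (tucker r (mode_transform r T C) U) i" .
qed

section \<open>Splitting off one mode\<close>

lemma bij_betw_split_mode:
  "bij_betw (\<lambda>(n, i). i(\<mu> := n)) (UNIV \<times> {i :: 'd \<Rightarrow> nat. i \<mu> = 0}) UNIV"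
  by (rule bij_betwI[where g = "\<lambda>i. (i \<mu>, i(\<mu> := 0))"]) (auto simp: fun_eq_iff)

lemma summable_split_mode:
  "f summable_on UNIV \<longleftrightarrow> (\<lambda>(n, i). f (i(\<mu> := n))) summable_on (UNIV \<times> {i :: 'd \<Rightarrow> nat. i \<mu> = 0})"
  using summable_on_reindex_bij_betw[OF bij_betw_split_mode, of f \<mu>] by (simp add: case_prod_unfold)

lemma infsum_split_mode:
  fixes f :: "('d \<Rightarrow> nat) \<Rightarrow> real"
  assumes "f summable_on UNIV"
  shows "infsum f UNIV = (\<Sum>\<^sub>\<infinity>n. \<Sum>\<^sub>\<infinity>i\<in>{i. i \<mu> = 0}. f (i(\<mu> := n)))"
proof -
  have "infsum f UNIV = infsum (\<lambda>(n, i). f (i(\<mu> := n))) (UNIV \<times> {i :: 'd \<Rightarrow> nat. i \<mu> = 0})"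
    using infsum_reindex_bij_betw[OF bij_betw_split_mode, of f \<mu>] by (simp add: case_prod_unfold)
  also have "\<dots> = (\<Sum>\<^sub>\<infinity>n. \<Sum>\<^sub>\<infinity>i\<in>{i. i \<mu> = 0}. f (i(\<mu> := n)))"
    using infsum_Sigma_banach[of "\<lambda>(n, i). f (i(\<mu> := n))" UNIV "\<lambda>_. {i. i \<mu> = 0}"] assms
    unfolding summable_split_mode[of f \<mu>] by simp
  finally show ?thesis .
qed

text \<open>
  The product of a vector in mode \<open>\<mu>\<close> and a tensor in the remaining modes; as in
  \<^const>\<open>matricization\<close>, the latter is represented by its entries at the \<open>i\<close> with \<open>i \<mu> = 0\<close>.
\<close>

lift_definition ins :: "'d \<Rightarrow> nat ell2 \<Rightarrow> ('d \<Rightarrow> nat) ell2 \<Rightarrow> ('d \<Rightarrow> nat) ell2"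
  is "\<lambda>\<mu> u b i. u (i \<mu>) * b (i(\<mu> := 0))"
proof -
  fix \<mu> :: 'd and u :: "nat \<Rightarrow> real" and b :: "('d \<Rightarrow> nat) \<Rightarrow> real"
  assume u: "(\<lambda>i. (u i)\<^sup>2) summable_on UNIV" and b: "(\<lambda>i. (b i)\<^sup>2) summable_on UNIV"
  let ?S = "{i :: 'd \<Rightarrow> nat. i \<mu> = 0}"
  have bS: "(\<lambda>i. (b i)\<^sup>2) summable_on ?S" using b by (rule summable_on_subset_banach) simp
  have "(\<lambda>(n, i). (u n)\<^sup>2 * (b i)\<^sup>2) summable_on (UNIV \<times> ?S)"
  proof (rule summable_on_SigmaI)
    show "((\<lambda>i. case (n, i) of (n, i) \<Rightarrow> (u n)\<^sup>2 * (b i)\<^sup>2) has_sum (u n)\<^sup>2 * (\<Sum>\<^sub>\<infinity>i\<in>?S. (b i)\<^sup>2)) ?S" for n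
      using has_sum_cmult_right[OF has_sum_infsum[OF bS]] by simp
    show "(\<lambda>n. (u n)\<^sup>2 * (\<Sum>\<^sub>\<infinity>i\<in>?S. (b i)\<^sup>2)) summable_on UNIV"
      using u by (rule summable_on_cmult_left)
  qed auto
  then have "(\<lambda>(n, i). (u ((i(\<mu> := n)) \<mu>) * b ((i(\<mu> := n))(\<mu> := 0)))\<^sup>2) summable_on (UNIV \<times> ?S)"
    by (rule summable_on_cong[THEN iffD1, rotated]) (auto simp: power_mult_distrib fun_upd_idem)
  then show "(\<lambda>i. (u (i \<mu>) * b (i(\<mu> := 0)))\<^sup>2) summable_on UNIV"
    using summable_split_mode[of "\<lambda>i. (u (i \<mu>) * b (i(\<mu> := 0)))\<^sup>2" \<mu>] by simp
qed

lemma coord_ins: "coord (ins \<mu> u b) i = coord u (i \<mu>) * coord b (i(\<mu> := 0))"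
  by transfer simp

lemma coord_matricization: "coord (matricization \<mu> X k) i = (if i \<mu> = 0 then coord X (i(\<mu> := k)) else 0)"
  by transfer simp

lemma ins_simps:
  "ins \<mu> (u + v) b = ins \<mu> u b + ins \<mu> v b" "ins \<mu> (u - v) b = ins \<mu> u b - ins \<mu> v b" "ins \<mu> (a *\<^sub>R u) b = a *\<^sub>R ins \<mu> u b"
  "ins \<mu> u (b + c) = ins \<mu> u b + ins \<mu> u c" "ins \<mu> u (b - c) = ins \<mu> u b - ins \<mu> u c" "ins \<mu> u (a *\<^sub>R b) = a *\<^sub>R ins \<mu> u b"
  "ins \<mu> 0 b = 0" "ins \<mu> u 0 = 0"
  by (rule ell2_eqI; simp add: coord_ins algebra_simps)+

lemma ins_sum_left: "ins \<mu> (\<Sum>j\<in>J. u j) b = (\<Sum>j\<in>J. ins \<mu> (u j) b)"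
  and ins_sum_right: "ins \<mu> v (\<Sum>j\<in>J. c j) = (\<Sum>j\<in>J. ins \<mu> v (c j))"
  by (rule ell2_eqI; simp add: coord_ins sum_distrib_left sum_distrib_right)+

definition rest_modes :: "'d \<Rightarrow> ('d \<Rightarrow> nat) ell2 set"
  where "rest_modes \<mu> = {b. \<forall>i. i \<mu> \<noteq> 0 \<longrightarrow> coord b i = 0}"

lemma subspace_rest_modes: "subspace (rest_modes \<mu>)"
  by (auto simp: rest_modes_def subspace_def)

lemma inner_matricization:
  "inner (matricization \<mu> Z n) b = (\<Sum>\<^sub>\<infinity>i\<in>{i. i \<mu> = 0}. coord Z (i(\<mu> := n)) * coord b i)"
  unfolding inner_ell2_eq by (rule infsum_cong_neutral) (auto simp: coord_matricization)

lemma inner_ins_eq: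
  "inner (ins \<mu> u b) Z = (\<Sum>\<^sub>\<infinity>n. coord u n * inner (matricization \<mu> Z n) b)"
proof -
  have "inner (ins \<mu> u b) Z = (\<Sum>\<^sub>\<infinity>n. \<Sum>\<^sub>\<infinity>i\<in>{i. i \<mu> = 0}. coord (ins \<mu> u b) (i(\<mu> := n)) * coord Z (i(\<mu> := n)))"
    unfolding inner_ell2_eq by (intro infsum_split_mode square_summable_mult summable_coord_square)
  also have "\<dots> = (\<Sum>\<^sub>\<infinity>n. \<Sum>\<^sub>\<infinity>i\<in>{i. i \<mu> = 0}. coord u n * (coord Z (i(\<mu> := n)) * coord b i))"
    by (intro infsum_cong) (auto simp: coord_ins fun_upd_idem)
  also have "\<dots> = (\<Sum>\<^sub>\<infinity>n. coord u n * inner (matricization \<mu> Z n) b)"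
    unfolding inner_matricization by (intro infsum_cong infsum_cmult_right')
  finally show ?thesis .
qed

lemma matricization_ins:
  assumes "b \<in> rest_modes \<mu>"
  shows "matricization \<mu> (ins \<mu> u b) n = coord u n *\<^sub>R b"
  by (rule ell2_eqI) (use assms in \<open>auto simp: coord_matricization coord_ins fun_upd_idem rest_modes_def\<close>)

lemma inner_ins_ins:
  assumes "c \<in> rest_modes \<mu>"
  shows "inner (ins \<mu> u b) (ins \<mu> v c) = inner u v * inner b c"
proof -
  have "inner (ins \<mu> u b) (ins \<mu> v c) = (\<Sum>\<^sub>\<infinity>n. (coord u n * coord v n) * inner c b)"
    unfolding inner_ins_eq matricization_ins[OF assms] by (simp add: mult.assoc)
  also have "\<dots> = inner u v * inner b c"
    by (simp add: infsum_cmult_left' inner_ell2_eq[of u v] inner_commute)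
  finally show ?thesis .
qed

lemma norm_ins: "b \<in> rest_modes \<mu> \<Longrightarrow> norm (ins \<mu> u b) = norm u * norm b"
  by (simp add: norm_eq_sqrt_inner inner_ins_ins real_sqrt_mult)

text \<open>
  The contraction of \<open>Z\<close> with \<open>b\<close> over all modes but \<open>\<mu>\<close>. For \<open>b\<close> in \<^term>\<open>rest_modes \<mu>\<close> it is
  the adjoint of \<^term>\<open>\<lambda>u. ins \<mu> u b\<close> applied to \<open>Z\<close>, and the function under \<^const>\<open>Abs_ell2\<close> is
  square-summable by Bessel's inequality for the orthogonal system
  \<^term>\<open>\<lambda>n. ins \<mu> (ell2_unit n) b\<close>.
\<close>

definition contract :: "'d \<Rightarrow> ('d \<Rightarrow> nat) ell2 \<Rightarrow> ('d \<Rightarrow> nat) ell2 \<Rightarrow> nat ell2"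
  where "contract \<mu> Z b = Abs_ell2 (\<lambda>n. inner (matricization \<mu> Z n) b)"

lemma contract_square_summable:
  assumes b: "b \<in> rest_modes \<mu>"
  shows "(\<lambda>n. (inner (matricization \<mu> Z n) b)\<^sup>2) summable_on UNIV"
proof (rule nonneg_bdd_above_summable_on)
  have e: "inner (matricization \<mu> Z n) b = inner Z (ins \<mu> (ell2_unit n) b)" for n
  proof -
    have "inner (ins \<mu> (ell2_unit n) b) Z = (\<Sum>\<^sub>\<infinity>m\<in>{n}. inner (matricization \<mu> Z m) b)"
      unfolding inner_ins_eq by (rule infsum_cong_neutral) auto
    then show ?thesis by (simp add: inner_commute)
  qed
  have "(\<Sum>n\<in>F. (inner (matricization \<mu> Z n) b)\<^sup>2) \<le> (norm b)\<^sup>2 * (norm Z)\<^sup>2" if "finite F" for F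
    unfolding e
    by (rule Bessel_scaled[OF that]) (auto simp: inner_ins_ins[OF b] norm_ins[OF b] norm_eq_sqrt_inner)
  then show "bdd_above (sum (\<lambda>n. (inner (matricization \<mu> Z n) b)\<^sup>2) ` {F. F \<subseteq> UNIV \<and> finite F})"
    by (intro bdd_aboveI[of _ "(norm b)\<^sup>2 * (norm Z)\<^sup>2"]) auto
qed simp

lemma coord_contract:
  "b \<in> rest_modes \<mu> \<Longrightarrow> coord (contract \<mu> Z b) n = inner (matricization \<mu> Z n) b"
  unfolding contract_def using contract_square_summable[of b \<mu> Z] by (simp add: Abs_ell2_inverse)

lemma inner_contract:
  "b \<in> rest_modes \<mu> \<Longrightarrow> inner u (contract \<mu> Z b) = inner (ins \<mu> u b) Z"
  unfolding inner_ins_eq inner_ell2_eq[of u] by (simp add: coord_contract)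

lemma contract_ins:
  assumes "b \<in> rest_modes \<mu>" "c \<in> rest_modes \<mu>"
  shows "contract \<mu> (ins \<mu> u c) b = inner b c *\<^sub>R u"
  by (rule ell2_eqI) (simp add: coord_contract[OF assms(1)] matricization_ins[OF assms(2)] inner_commute)

lemma matricization_simps:
  "matricization \<mu> (X + Y) n = matricization \<mu> X n + matricization \<mu> Y n"
  "matricization \<mu> (X - Y) n = matricization \<mu> X n - matricization \<mu> Y n"
  "matricization \<mu> 0 n = 0"
  by (rule ell2_eqI; simp add: coord_matricization)+

lemma matricization_sum: "matricization \<mu> (\<Sum>j\<in>J. X j) n = (\<Sum>j\<in>J. matricization \<mu> (X j) n)"
  by (induction J rule: infinite_finite_induct) (simp_all add: matricization_simps)

lemma contract_sum:
  assumes "b \<in> rest_modes \<mu>"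
  shows "contract \<mu> (\<Sum>j\<in>J. X j) b = (\<Sum>j\<in>J. contract \<mu> (X j) b)"
  by (rule ell2_eqI) (simp add: coord_contract[OF assms] matricization_sum inner_sum_left)

lemma contract_diff:
  assumes "b \<in> rest_modes \<mu>"
  shows "contract \<mu> (X - Y) b = contract \<mu> X b - contract \<mu> Y b"
  by (rule ell2_eqI) (simp add: coord_contract[OF assms] matricization_simps inner_diff_left)

lemma norm_contract_le:
  assumes "b \<in> rest_modes \<mu>"
  shows "norm (contract \<mu> Z b) \<le> norm b * norm Z"
proof -
  let ?u = "contract \<mu> Z b"
  have "norm ?u * norm ?u = inner (ins \<mu> ?u b) Z"
    using inner_contract[OF assms, of ?u Z] by (simp add: power2_norm_eq_inner flip: power2_eq_square)
  also have "\<dots> \<le> norm ?u * (norm b * norm Z)"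
    using norm_cauchy_schwarz[of "ins \<mu> ?u b" Z] by (simp add: norm_ins[OF assms] mult.assoc)
  finally show ?thesis by (cases "?u = 0") (auto simp: mult_le_cancel_left)
qed

lemma elem_eq_ins: "elem u = ins \<mu> (u \<mu>) (elem (u(\<mu> := ell2_unit 0)))"
proof (rule ell2_eqI)
  fix i
  have "coord (elem u) i = coord (u \<mu>) (i \<mu>) * (\<Prod>\<nu>\<in>UNIV - {\<mu>}. coord (u \<nu>) (i \<nu>))"
    by (simp add: coord_elem prod.remove[of UNIV \<mu>])
  also have "(\<Prod>\<nu>\<in>UNIV - {\<mu>}. coord (u \<nu>) (i \<nu>)) = coord (elem (u(\<mu> := ell2_unit 0))) (i(\<mu> := 0))"
    by (simp add: coord_elem prod.remove[of UNIV \<mu>])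
  finally show "coord (elem u) i = coord (ins \<mu> (u \<mu>) (elem (u(\<mu> := ell2_unit 0)))) i"
    by (simp add: coord_ins)
qed

lemma elem_rest_modes: "elem (u(\<mu> := ell2_unit 0)) \<in> rest_modes \<mu>"
  by (auto simp: rest_modes_def coord_elem intro!: prod_zero)

text \<open>
  The rows of the core in mode \<open>\<mu>\<close>, with all other modes expanded by the factor matrices.
\<close>

definition mode_rows ::
  "('d::finite \<Rightarrow> nat) \<Rightarrow> ('d \<Rightarrow> nat) ell2 \<Rightarrow> ('d \<Rightarrow> nat \<Rightarrow> nat ell2) \<Rightarrow> 'd \<Rightarrow> nat \<Rightarrow> ('d \<Rightarrow> nat) ell2"
  where "mode_rows r C U \<mu> k =
    (\<Sum>j\<in>{j \<in> index_box r. j \<mu> = k}. coord C j *\<^sub>R elem ((\<lambda>\<nu>. U \<nu> (j \<nu>))(\<mu> := ell2_unit 0)))"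

lemma mode_rows_rest_modes: "mode_rows r C U \<mu> k \<in> rest_modes \<mu>"
  unfolding mode_rows_def by (intro subspace_sum subspace_scale subspace_rest_modes elem_rest_modes)

lemma tucker_split_mode:
  "tucker r C (U(\<mu> := W)) = (\<Sum>k<r \<mu>. ins \<mu> (W k) (mode_rows r C U \<mu> k))"
proof -
  have "tucker r C (U(\<mu> := W)) = (\<Sum>j\<in>index_box r. coord C j *\<^sub>R ins \<mu> (W (j \<mu>)) (elem ((\<lambda>\<nu>. U \<nu> (j \<nu>))(\<mu> := ell2_unit 0))))"
    unfolding tucker_eq_sum_elem
  proof (intro sum.cong refl arg_cong2[of _ _ _ _ scaleR])
    fix j
    have "(\<lambda>\<nu>. (U(\<mu> := W)) \<nu> (j \<nu>))(\<mu> := ell2_unit 0) = (\<lambda>\<nu>. U \<nu> (j \<nu>))(\<mu> := ell2_unit 0)" by auto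
    then show "elem (\<lambda>\<nu>. (U(\<mu> := W)) \<nu> (j \<nu>)) = ins \<mu> (W (j \<mu>)) (elem ((\<lambda>\<nu>. U \<nu> (j \<nu>))(\<mu> := ell2_unit 0)))"
      using elem_eq_ins[of "\<lambda>\<nu>. (U(\<mu> := W)) \<nu> (j \<nu>)" \<mu>] by simp
  qed
  also have "\<dots> = (\<Sum>k<r \<mu>. \<Sum>j\<in>{j \<in> index_box r. j \<mu> = k}. coord C j *\<^sub>R ins \<mu> (W (j \<mu>)) (elem ((\<lambda>\<nu>. U \<nu> (j \<nu>))(\<mu> := ell2_unit 0))))"
    by (rule sum.group[symmetric]) (auto dest: index_boxD)
  also have "\<dots> = (\<Sum>k<r \<mu>. ins \<mu> (W k) (mode_rows r C U \<mu> k))"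
    unfolding mode_rows_def ins_sum_right ins_simps by (intro sum.cong refl) auto
  finally show ?thesis .
qed

lemma tucker_split_mode': "tucker r C U = (\<Sum>k<r \<mu>. ins \<mu> (U \<mu> k) (mode_rows r C U \<mu> k))"
  using tucker_split_mode[of r C U \<mu> "U \<mu>"] by simp

lemma contract_tucker:
  assumes "b \<in> rest_modes \<mu>"
  shows "contract \<mu> (tucker r C U) b = (\<Sum>k<r \<mu>. inner b (mode_rows r C U \<mu> k) *\<^sub>R U \<mu> k)"
  unfolding tucker_split_mode'[of r C U \<mu>] contract_sum[OF assms]
  by (simp add: contract_ins[OF assms mode_rows_rest_modes])

section \<open>Singular values of the matricizations\<close>

lemma matricization_eq_0: "C \<in> tensors r \<Longrightarrow> \<not> k < r \<mu> \<Longrightarrow> matricization \<mu> C k = 0"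
proof (rule ell2_eqI)
  fix i assume C: "C \<in> tensors r" and k: "\<not> k < r \<mu>"
  have "i(\<mu> := k) \<notin> index_box r" using k index_boxD[of "i(\<mu> := k)" r \<mu>] by auto
  then show "coord (matricization \<mu> C k) i = coord 0 i"
    using tensors_coord_0[OF C] by (simp add: coord_matricization)
qed

lemma full_rank_tensorsD: "C \<in> full_rank_tensors r \<Longrightarrow> C \<in> tensors r"
  by (simp add: full_rank_tensors_def)

lemma full_rank_rows_linear_indep:
  assumes "C \<in> full_rank_tensors r"
  shows "linear_indep (r \<mu>) (matricization \<mu> C)"
proof -
  have C: "C \<in> tensors r" "dim (range (matricization \<mu> C)) = r \<mu>"
    using assms by (auto simp: full_rank_tensors_def)
  obtain B where B: "B \<subseteq> range (matricization \<mu> C)" "independent B" "card B = r \<mu>"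
    using basis_exists[of "range (matricization \<mu> C)"] C(2) by metis
  have "0 \<notin> B" using B(2) dependent_zero by blast
  then have sub: "B \<subseteq> matricization \<mu> C ` {..<r \<mu>}"
    using B(1) matricization_eq_0[OF C(1), of _ \<mu>] by fastforce
  have "card (matricization \<mu> C ` {..<r \<mu>}) \<le> r \<mu>" using card_image_le[of "{..<r \<mu>}"] by simp
  then have eq: "B = matricization \<mu> C ` {..<r \<mu>}"
    using sub B(3) by (intro card_seteq) auto
  then have "inj_on (matricization \<mu> C) {..<r \<mu>}"
    using B(3) by (intro eq_card_imp_inj_on) auto
  then show ?thesis using B(2) eq by (intro independent_linear_indep) auto
qed

lemma inner_mode_rows:
  assumes U: "orthonormal_frames r U" and C: "C \<in> tensors r" and j: "\<And>\<nu>. \<nu> \<noteq> \<mu> \<Longrightarrow> j \<nu> < r \<nu>" and k: "k < r \<mu>"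
  shows "inner (mode_rows r C U \<mu> k) (elem ((\<lambda>\<nu>. U \<nu> (j \<nu>))(\<mu> := ell2_unit 0))) = coord C (j(\<mu> := k))"
proof -
  have *: "inner (elem ((\<lambda>\<nu>. U \<nu> (i \<nu>))(\<mu> := ell2_unit 0))) (elem ((\<lambda>\<nu>. U \<nu> (j \<nu>))(\<mu> := ell2_unit 0)))
      = (if i = j(\<mu> := k) then 1 else 0)" if i: "i \<in> index_box r" "i \<mu> = k" for i
  proof -
    have f: "inner (((\<lambda>\<nu>. U \<nu> (i \<nu>))(\<mu> := ell2_unit 0)) \<nu>) (((\<lambda>\<nu>. U \<nu> (j \<nu>))(\<mu> := ell2_unit 0)) \<nu>)
        = (if \<nu> = \<mu> \<or> i \<nu> = j \<nu> then 1 else 0)" for \<nu>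
      using orthonormal_framesD[OF U] j[of \<nu>] index_boxD[OF i(1), of \<nu>] by (cases "\<nu> = \<mu>") auto
    show ?thesis
    proof (cases "i = j(\<mu> := k)")
      case False
      then obtain \<nu> where "i \<nu> \<noteq> (j(\<mu> := k)) \<nu>" by (metis ext)
      then have "\<nu> \<noteq> \<mu> \<and> i \<nu> \<noteq> j \<nu>" using i(2) by (auto split: if_splits)
      then show ?thesis unfolding inner_elem f using False by (auto intro!: prod_zero)
    next
      case True
      then have "\<nu> = \<mu> \<or> i \<nu> = j \<nu>" for \<nu> by auto
      then show ?thesis unfolding inner_elem f using True by simp
    qed
  qed
  have "inner (mode_rows r C U \<mu> k) (elem ((\<lambda>\<nu>. U \<nu> (j \<nu>))(\<mu> := ell2_unit 0)))
      = (\<Sum>i\<in>{i \<in> index_box r. i \<mu> = k}. if i = j(\<mu> := k) then coord C i else 0)"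
    unfolding mode_rows_def inner_sum_left
  proof (intro sum.cong refl)
    fix i assume "i \<in> {i \<in> index_box r. i \<mu> = k}"
    then show "inner (coord C i *\<^sub>R elem ((\<lambda>\<nu>. U \<nu> (i \<nu>))(\<mu> := ell2_unit 0))) (elem ((\<lambda>\<nu>. U \<nu> (j \<nu>))(\<mu> := ell2_unit 0)))
        = (if i = j(\<mu> := k) then coord C i else 0)"
      using *[of i] by simp
  qed
  also have "\<dots> = coord C (j(\<mu> := k))"
  proof -
    have "j(\<mu> := k) \<in> {i \<in> index_box r. i \<mu> = k}" using j k by (simp add: index_box_def)
    moreover have "finite {i \<in> index_box r. i \<mu> = k}" by simp
    ultimately show ?thesis using sum.delta[of "{i \<in> index_box r. i \<mu> = k}" "j(\<mu> := k)" "coord C"]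
      by presburger
  qed
  finally show ?thesis .
qed

text \<open>
  The inner products with the elementary tensors of the remaining factors recover the rows of the
  core, which are independent as the core has full rank.
\<close>

lemma mode_rows_linear_indep:
  assumes U: "orthonormal_frames r U" and C: "C \<in> full_rank_tensors r"
  shows "linear_indep (r \<mu>) (mode_rows r C U \<mu>)"
  unfolding linear_indep_def
proof (intro allI impI)
  fix x :: "nat \<Rightarrow> real" and i
  assume x: "(\<Sum>k<r \<mu>. x k *\<^sub>R mode_rows r C U \<mu> k) = 0" and i: "i < r \<mu>"
  note Ct = full_rank_tensorsD[OF C]
  have "(\<Sum>k<r \<mu>. x k *\<^sub>R matricization \<mu> C k) = 0"
  proof (rule ell2_eqI)
    fix j
    show "coord (\<Sum>k<r \<mu>. x k *\<^sub>R matricization \<mu> C k) j = coord 0 j"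
    proof (cases "j \<mu> = 0 \<and> (\<forall>\<nu>. \<nu> \<noteq> \<mu> \<longrightarrow> j \<nu> < r \<nu>)")
      case True
      have "0 = inner (\<Sum>k<r \<mu>. x k *\<^sub>R mode_rows r C U \<mu> k) (elem ((\<lambda>\<nu>. U \<nu> (j \<nu>))(\<mu> := ell2_unit 0)))"
        using x by simp
      also have "\<dots> = (\<Sum>k<r \<mu>. x k * coord C (j(\<mu> := k)))"
        unfolding inner_sum_left using inner_mode_rows[OF U Ct, of \<mu> j] True by (intro sum.cong) auto
      finally show ?thesis using True by (simp add: coord_matricization)
    next
      case False
      have "coord (matricization \<mu> C k) j = 0" for k
      proof (cases "j \<mu> = 0")
        case True
        then obtain \<nu> where "\<nu> \<noteq> \<mu>" "\<not> j \<nu> < r \<nu>" using False by blast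
        then have "j(\<mu> := k) \<notin> index_box r" by (auto simp: index_box_def intro!: exI[of _ \<nu>])
        then show ?thesis using tensors_coord_0[OF Ct] by (simp add: coord_matricization)
      qed (simp add: coord_matricization)
      then show ?thesis by simp
    qed
  qed
  then show "x i = 0"
    using full_rank_rows_linear_indep[OF C, of \<mu>] i unfolding linear_indep_def by blast
qed

lemma matricization_tucker:
  "matricization \<mu> (tucker r C U) n = (\<Sum>l<r \<mu>. coord (U \<mu> l) n *\<^sub>R mode_rows r C U \<mu> l)"
  unfolding tucker_split_mode'[of r C U \<mu>] matricization_sum
  by (simp add: matricization_ins[OF mode_rows_rest_modes])

lemma has_sum_inner_ell2: "((\<lambda>n. coord u n * coord v n) has_sum inner u v) UNIV"
  unfolding inner_ell2_eq
  by (intro has_sum_infsum square_summable_mult summable_coord_square)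

lemma has_sum_finite_sum:
  fixes f :: "'b \<Rightarrow> 'a \<Rightarrow> real"
  assumes "\<And>j. j \<in> J \<Longrightarrow> (f j has_sum s j) A"
  shows "((\<lambda>x. \<Sum>j\<in>J. f j x) has_sum (\<Sum>j\<in>J. s j)) A"
  using assms by (induction J rule: infinite_finite_induct) (auto intro: has_sum_add)

lemma has_sum_matricization_transpose:
  "((\<lambda>n. coord (matricization \<mu> (tucker r C U) n) j * coord u n)
    has_sum coord (\<Sum>l<r \<mu>. inner (U \<mu> l) u *\<^sub>R mode_rows r C U \<mu> l) j) UNIV"
proof -
  have "((\<lambda>n. \<Sum>l<r \<mu>. coord (mode_rows r C U \<mu> l) j * (coord (U \<mu> l) n * coord u n))
      has_sum (\<Sum>l<r \<mu>. coord (mode_rows r C U \<mu> l) j * inner (U \<mu> l) u)) UNIV"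
    by (intro has_sum_finite_sum has_sum_cmult_right has_sum_inner_ell2)
  then show ?thesis
    unfolding matricization_tucker coord_sum coord_simps sum_distrib_right by (simp add: mult_ac)
qed

lemma span_mode_rows: "span (mode_rows r C U \<mu> ` {..<n}) \<subseteq> rest_modes \<mu>"
  by (rule span_minimal) (auto simp: mode_rows_rest_modes subspace_rest_modes)

text \<open>
  The decomposition of the bilinear form \<open>\<langle>X, u \<otimes> v\<rangle>\<close> on the product of the column space and the
  row space. None of the \<open>s k\<close> vanishes since the rows of the core are independent.
\<close>

lemma matricization_singular_value_decomposition:
  assumes U: "orthonormal_frames r U" and C: "C \<in> full_rank_tensors r"
  shows "\<exists>p q s. orthonormal (r \<mu>) p \<and> orthonormal (r \<mu>) q \<and> span (p ` {..<r \<mu>}) = span (U \<mu> ` {..<r \<mu>}) \<and>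
    (\<forall>k<r \<mu>. q k \<in> rest_modes \<mu> \<and> (0::real) < s k \<and>
      contract \<mu> (tucker r C U) (q k) = s k *\<^sub>R p k \<and>
      (\<Sum>l<r \<mu>. inner (U \<mu> l) (p k) *\<^sub>R mode_rows r C U \<mu> l) = s k *\<^sub>R q k)"
proof -
  define a where "a = mode_rows r C U \<mu>"
  define n where "n = r \<mu>"
  have u: "orthonormal n (U \<mu>)" using U by (simp add: orthonormal_frames_def n_def)
  obtain f where f: "orthonormal n f" "span (f ` {..<n}) = span (a ` {..<n})"
    using linear_indep_orthonormal_basis[OF mode_rows_linear_indep[OF U C, of \<mu>]] unfolding a_def n_def by blast
  define B where "B u v = (\<Sum>l<n. inner (U \<mu> l) u * inner (a l) v)" for u v
  have bil: "bilinear B"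
    unfolding bilinear_def B_def
    by (intro conjI allI bounded_linear.linear bounded_linear_sum bounded_linear_mult_const
        bounded_linear_const_mult bounded_linear_inner_right)
  have cont: "continuous_on UNIV (\<lambda>(u, v). B u v)"
    unfolding B_def case_prod_beta by (intro continuous_intros)
  obtain p q s where p: "orthonormal n p" "span (p ` {..<n}) = span (U \<mu> ` {..<n})"
    and q: "orthonormal n q" "span (q ` {..<n}) = span (f ` {..<n})"
    and B: "\<And>i j. i < n \<Longrightarrow> j < n \<Longrightarrow> B (p i) (q j) = (if i = j then s i else 0)"
    and s: "\<And>i. i < n \<Longrightarrow> 0 \<le> s i"
    using singular_value_decomposition[OF bil cont u f(1)] by blast
  have q_rest: "q k \<in> rest_modes \<mu>" if "k < n" for k
  proof -
    have "q k \<in> span (a ` {..<n})" unfolding f(2)[symmetric] q(2)[symmetric] using that by (intro span_base) blast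
    then show ?thesis using span_mode_rows unfolding a_def by blast
  qed
  have Xq: "contract \<mu> (tucker r C U) (q k) = s k *\<^sub>R p k" if k: "k < n" for k
  proof -
    define z where "z = contract \<mu> (tucker r C U) (q k)"
    have z: "z = (\<Sum>l<n. inner (q k) (a l) *\<^sub>R U \<mu> l)"
      unfolding z_def contract_tucker[OF q_rest[OF k]] by (simp add: a_def n_def)
    then have "z \<in> span (p ` {..<n})" unfolding p(2) using sum_in_span_family by metis
    then have "z = (\<Sum>i<n. inner z (p i) *\<^sub>R p i)" by (rule orthonormal_expand[OF p(1)])
    also have "\<dots> = (\<Sum>i<n. if i = k then s k *\<^sub>R p k else 0)"
    proof (rule sum.cong)
      fix i assume "i \<in> {..<n}"
      moreover have "inner z (p i) = B (p i) (q k)"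
        unfolding z B_def inner_sum_left by (intro sum.cong) (simp_all add: inner_commute mult.commute)
      ultimately show "inner z (p i) *\<^sub>R p i = (if i = k then s k *\<^sub>R p k else 0)"
        using B[of i k] k by auto
    qed simp
    finally show ?thesis using k by (simp add: z_def)
  qed
  have Xp: "(\<Sum>l<n. inner (U \<mu> l) (p k) *\<^sub>R a l) = s k *\<^sub>R q k" if k: "k < n" for k
  proof -
    define y where "y = (\<Sum>l<n. inner (U \<mu> l) (p k) *\<^sub>R a l)"
    have "y \<in> span (q ` {..<n})" unfolding q(2) f(2) y_def by (rule sum_in_span_family)
    then have "y = (\<Sum>i<n. inner y (q i) *\<^sub>R q i)" by (rule orthonormal_expand[OF q(1)])
    also have "\<dots> = (\<Sum>i<n. if i = k then s k *\<^sub>R q k else 0)"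
    proof (rule sum.cong)
      fix i assume "i \<in> {..<n}"
      moreover have "inner y (q i) = B (p k) (q i)" by (simp add: y_def B_def inner_sum_left)
      ultimately show "inner y (q i) *\<^sub>R q i = (if i = k then s k *\<^sub>R q k else 0)"
        using B[of k i] k by auto
    qed simp
    finally show ?thesis using k by (simp add: y_def)
  qed
  have "0 < s k" if k: "k < n" for k
  proof -
    have "s k \<noteq> 0"
    proof
      assume "s k = 0"
      then have "(\<Sum>l<n. inner (U \<mu> l) (p k) *\<^sub>R a l) = 0" using Xp[OF k] by simp
      then have 0: "inner (U \<mu> l) (p k) = 0" if "l < n" for l
        using mode_rows_linear_indep[OF U C, of \<mu>, unfolded linear_indep_def, rule_format,
            of "\<lambda>l. inner (U \<mu> l) (p k)" l] that by (simp add: a_def n_def)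
      have "p k \<in> span (U \<mu> ` {..<n})" unfolding p(2)[symmetric] using k by (intro span_base) blast
      from orthonormal_expand[OF u this] have "p k = 0" using 0 by (simp add: inner_commute)
      then show False using orthonormal_norm[OF p(1) k] by simp
    qed
    then show ?thesis using s[OF k] by simp
  qed
  then show ?thesis
    using p q(1) q_rest Xq Xp unfolding n_def a_def by (intro exI[of _ p] exI[of _ q] exI[of _ s]) blast
qed

text \<open>
  A singular pair for \<open>\<sigma>\<close> has a nonzero coefficient with respect to some \<open>p k\<close>, and comparing the
  singular vector equations gives \<open>\<sigma>\<^sup>2 = (s k)\<^sup>2\<close>. So the set of positive singular values is finite
  and consists of the \<open>s k\<close>, and the lower bound follows by expanding
  \<open>\<Sum>k. x k *\<^sub>R U \<mu> k\<close> in the basis \<open>p\<close>.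
\<close>

lemma smallest_singular_value_bound:
  assumes r: "0 < r \<mu>" and U: "orthonormal_frames r U" and C: "C \<in> full_rank_tensors r"
  shows "0 < smallest_singular_value \<mu> (tucker r C U)"
    and "(smallest_singular_value \<mu> (tucker r C U))\<^sup>2 * (\<Sum>k<r \<mu>. (x k)\<^sup>2)
      \<le> (norm (\<Sum>k<r \<mu>. x k *\<^sub>R mode_rows r C U \<mu> k))\<^sup>2"
proof -
  define a where "a = mode_rows r C U \<mu>"
  define n where "n = r \<mu>"
  define X where "X = tucker r C U"
  define \<Sigma> where "\<Sigma> = {\<sigma>. pos_singular_value (matricization \<mu> X) \<sigma>}"
  obtain p q s where p: "orthonormal n p" and q: "orthonormal n q"
    and sp: "span (p ` {..<n}) = span (U \<mu> ` {..<n})" and qr: "\<And>k. k < n \<Longrightarrow> q k \<in> rest_modes \<mu>"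
    and s: "\<And>k. k < n \<Longrightarrow> (0::real) < s k" and Xq: "\<And>k. k < n \<Longrightarrow> contract \<mu> X (q k) = s k *\<^sub>R p k"
    and Xp: "\<And>k. k < n \<Longrightarrow> (\<Sum>l<n. inner (U \<mu> l) (p k) *\<^sub>R a l) = s k *\<^sub>R q k"
    using matricization_singular_value_decomposition[OF U C, of \<mu>, folded a_def n_def X_def] by (elim exE conjE) blast
  have u: "orthonormal n (U \<mu>)" using U by (simp add: orthonormal_frames_def n_def)
  have sv: "s k \<in> \<Sigma>" if k: "k < n" for k
    unfolding \<Sigma>_def pos_singular_value_def mem_Collect_eq
  proof (intro conjI exI allI)
    show "inner (matricization \<mu> X i) (q k) = s k * coord (p k) i" for i
      using coord_contract[OF qr[OF k], of X i] Xq[OF k] by simp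
    show "((\<lambda>i. coord (matricization \<mu> X i) j * coord (p k) i) has_sum s k * coord (q k) j) UNIV" for j
      using has_sum_matricization_transpose[of \<mu> r C U j "p k"]
      unfolding X_def Xp[OF k, unfolded n_def a_def] by simp
  qed (use k p q s orthonormal_norm in auto)
  have sub: "\<Sigma> \<subseteq> s ` {..<n}"
  proof
    fix \<sigma> assume "\<sigma> \<in> \<Sigma>"
    then obtain w :: "nat ell2" and v where \<sigma>: "0 < \<sigma>" and w: "norm w = 1"
      and 1: "\<And>k. inner (matricization \<mu> X k) v = \<sigma> * coord w k"
      and 2: "\<And>j. ((\<lambda>k. coord (matricization \<mu> X k) j * coord w k) has_sum \<sigma> * coord v j) UNIV"
      unfolding \<Sigma>_def pos_singular_value_def by blast
    have v: "\<sigma> *\<^sub>R v = (\<Sum>l<n. inner (U \<mu> l) w *\<^sub>R a l)"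
    proof (rule ell2_eqI)
      fix j
      show "coord (\<sigma> *\<^sub>R v) j = coord (\<Sum>l<n. inner (U \<mu> l) w *\<^sub>R a l) j"
        using has_sum_unique[OF 2[of j] has_sum_matricization_transpose[of \<mu> r C U j w, folded X_def n_def a_def]]
        by simp
    qed
    have "\<sigma> *\<^sub>R v \<in> rest_modes \<mu>"
      unfolding v a_def by (intro subspace_sum subspace_scale subspace_rest_modes mode_rows_rest_modes)
    then have vr: "v \<in> rest_modes \<mu>"
      using subspace_scale[OF subspace_rest_modes, of "\<sigma> *\<^sub>R v" \<mu> "1 / \<sigma>"] \<sigma> by simp
    have "\<sigma> *\<^sub>R w = contract \<mu> X v"
      by (rule ell2_eqI) (simp add: coord_contract[OF vr] 1)
    then have w': "\<sigma> *\<^sub>R w = (\<Sum>l<n. inner v (a l) *\<^sub>R U \<mu> l)"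
      using contract_tucker[OF vr, of r C U] by (simp add: X_def n_def a_def)
    have "\<sigma> *\<^sub>R w \<in> span (U \<mu> ` {..<n})" unfolding w' by (rule sum_in_span_family)
    then have "(1 / \<sigma>) *\<^sub>R \<sigma> *\<^sub>R w \<in> span (U \<mu> ` {..<n})" by (rule span_scale)
    then have "w \<in> span (p ` {..<n})" using \<sigma> unfolding sp by simp
    then have we: "w = (\<Sum>k<n. inner w (p k) *\<^sub>R p k)" by (rule orthonormal_expand[OF p])
    obtain k where k: "k < n" "inner w (p k) \<noteq> 0"
    proof -
      have "\<exists>k<n. inner w (p k) \<noteq> 0"
      proof (rule ccontr)
        assume "\<not> (\<exists>k<n. inner w (p k) \<noteq> 0)"
        then have "(\<Sum>k<n. inner w (p k) *\<^sub>R p k) = 0" by (intro sum.neutral) auto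
        then show False using we w by simp
      qed
      then show ?thesis using that by blast
    qed
    have "\<sigma> * inner w (p k) = inner (\<sigma> *\<^sub>R w) (p k)" by simp
    also have "\<dots> = inner v (\<Sum>l<n. inner (U \<mu> l) (p k) *\<^sub>R a l)"
      unfolding w' by (simp add: inner_sum_left inner_sum_right mult.commute)
    also have "\<dots> = s k * inner v (q k)" using Xp[OF k(1)] by simp
    finally have e1: "\<sigma> * inner w (p k) = s k * inner v (q k)" .
    have "\<sigma> * inner v (q k) = inner (\<sigma> *\<^sub>R v) (q k)" by simp
    also have "\<dots> = inner w (\<Sum>l<n. inner (q k) (a l) *\<^sub>R U \<mu> l)"
      unfolding v by (simp add: inner_sum_left inner_sum_right inner_commute mult.commute)
    also have "(\<Sum>l<n. inner (q k) (a l) *\<^sub>R U \<mu> l) = s k *\<^sub>R p k"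
      using contract_tucker[OF qr[OF k(1)], of r C U] Xq[OF k(1)] by (simp add: X_def n_def a_def)
    finally have e2: "\<sigma> * inner v (q k) = s k * inner w (p k)" by simp
    have "\<sigma>\<^sup>2 * inner w (p k) = (s k)\<^sup>2 * inner w (p k)"
    proof -
      have "\<sigma> * (\<sigma> * inner w (p k)) = s k * (\<sigma> * inner v (q k))" unfolding e1 by simp
      then show ?thesis unfolding e2 by (simp add: power2_eq_square mult.assoc)
    qed
    then have "\<sigma>\<^sup>2 = (s k)\<^sup>2" using k(2) by simp
    then have "\<sigma> = s k" using \<sigma> s[OF k(1)] by (simp add: power2_eq_iff)
    then show "\<sigma> \<in> s ` {..<n}" using k(1) by blast
  qed
  have fin: "finite \<Sigma>" using sub finite_subset by blast
  have "s 0 \<in> \<Sigma>" using sv r by (simp add: n_def)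
  then have Min: "Min \<Sigma> \<in> \<Sigma>" using fin by (intro Min_in) auto
  have ssv: "smallest_singular_value \<mu> (tucker r C U) = Min \<Sigma>"
    by (simp add: smallest_singular_value_def \<Sigma>_def X_def)
  show pos: "0 < smallest_singular_value \<mu> (tucker r C U)"
    unfolding ssv using Min by (simp add: \<Sigma>_def pos_singular_value_def)
  define w where "w = (\<Sum>l<n. x l *\<^sub>R U \<mu> l)"
  have "w \<in> span (p ` {..<n})" unfolding w_def sp by (rule sum_in_span_family)
  then have we: "w = (\<Sum>k<n. inner w (p k) *\<^sub>R p k)" by (rule orthonormal_expand[OF p])
  have xl: "x l = (\<Sum>k<n. inner w (p k) * inner (U \<mu> l) (p k))" if "l < n" for l
  proof -
    have "x l = inner (U \<mu> l) w" unfolding w_def using inner_orthonormal_sum(2)[OF u that] by simp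
    also have "\<dots> = (\<Sum>k<n. inner w (p k) * inner (U \<mu> l) (p k))"
      by (subst we) (simp add: inner_sum_right)
    finally show ?thesis .
  qed
  have "(\<Sum>l<n. x l *\<^sub>R a l) = (\<Sum>l<n. \<Sum>k<n. inner w (p k) *\<^sub>R inner (U \<mu> l) (p k) *\<^sub>R a l)"
    by (intro sum.cong refl) (simp add: xl scaleR_sum_left)
  also have "\<dots> = (\<Sum>k<n. inner w (p k) *\<^sub>R (\<Sum>l<n. inner (U \<mu> l) (p k) *\<^sub>R a l))"
    unfolding scaleR_sum_right by (rule sum.swap)
  also have "\<dots> = (\<Sum>k<n. (inner w (p k) * s k) *\<^sub>R q k)"
    by (intro sum.cong refl) (simp add: Xp)
  finally have xa: "(norm (\<Sum>l<n. x l *\<^sub>R a l))\<^sup>2 = (\<Sum>k<n. (inner w (p k) * s k)\<^sup>2)"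
    using norm_orthonormal_sum[OF q] by simp
  have "(\<Sum>k<n. (x k)\<^sup>2) = (norm w)\<^sup>2" unfolding w_def norm_orthonormal_sum[OF u] ..
  also have "\<dots> = (\<Sum>k<n. (inner w (p k))\<^sup>2)" by (subst we) (rule norm_orthonormal_sum[OF p])
  finally have "(Min \<Sigma>)\<^sup>2 * (\<Sum>k<n. (x k)\<^sup>2) = (\<Sum>k<n. (inner w (p k))\<^sup>2 * (Min \<Sigma>)\<^sup>2)"
    by (simp add: sum_distrib_left mult.commute)
  also have "\<dots> \<le> (\<Sum>k<n. (inner w (p k) * s k)\<^sup>2)"
    unfolding power_mult_distrib
  proof (intro sum_mono mult_left_mono power_mono)
    fix k assume "k \<in> {..<n}"
    then show "Min \<Sigma> \<le> s k" using sv fin by (intro Min_le) auto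
  qed (use pos ssv in auto)
  finally show "(smallest_singular_value \<mu> (tucker r C U))\<^sup>2 * (\<Sum>k<r \<mu>. (x k)\<^sup>2)
      \<le> (norm (\<Sum>k<r \<mu>. x k *\<^sub>R mode_rows r C U \<mu> k))\<^sup>2"
    unfolding ssv xa[unfolded n_def a_def] n_def .
qed

lemma contract_tucker_surj:
  assumes U: "orthonormal_frames r U" and C: "C \<in> full_rank_tensors r" and w: "w \<in> span (U \<mu> ` {..<r \<mu>})"
  obtains y where "y \<in> rest_modes \<mu>" "contract \<mu> (tucker r C U) y = w"
proof -
  obtain p q s where p: "orthonormal (r \<mu>) p" and "orthonormal (r \<mu>) q"
    and sp: "span (p ` {..<r \<mu>}) = span (U \<mu> ` {..<r \<mu>})"
    and qr: "\<And>k. k < r \<mu> \<Longrightarrow> q k \<in> rest_modes \<mu>" and s: "\<And>k. k < r \<mu> \<Longrightarrow> (0::real) < s k"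
    and Xq: "\<And>k. k < r \<mu> \<Longrightarrow> contract \<mu> (tucker r C U) (q k) = s k *\<^sub>R p k"
    and "\<And>k. k < r \<mu> \<Longrightarrow> (\<Sum>l<r \<mu>. inner (U \<mu> l) (p k) *\<^sub>R mode_rows r C U \<mu> l) = s k *\<^sub>R q k"
    using matricization_singular_value_decomposition[OF U C, of \<mu>] by (elim exE conjE) blast
  define y where "y = (\<Sum>k<r \<mu>. (inner w (p k) / s k) *\<^sub>R q k)"
  have y: "y \<in> rest_modes \<mu>"
    unfolding y_def by (intro subspace_sum subspace_scale subspace_rest_modes qr) simp
  have qi: "inner y c = (\<Sum>k<r \<mu>. (inner w (p k) / s k) * inner (q k) c)" for c
    by (simp add: y_def inner_sum_left)
  have "contract \<mu> (tucker r C U) y = (\<Sum>k<r \<mu>. (inner w (p k) / s k) *\<^sub>R contract \<mu> (tucker r C U) (q k))"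
    by (rule ell2_eqI, simp only: coord_contract[OF y]) (simp add: coord_contract[OF qr] y_def inner_sum_right)
  also have "\<dots> = (\<Sum>k<r \<mu>. inner w (p k) *\<^sub>R p k)"
  proof (intro sum.cong refl)
    fix k assume "k \<in> {..<r \<mu>}"
    then have "s k \<noteq> 0" "contract \<mu> (tucker r C U) (q k) = s k *\<^sub>R p k" using Xq s[of k] by auto
    then show "(inner w (p k) / s k) *\<^sub>R contract \<mu> (tucker r C U) (q k) = inner w (p k) *\<^sub>R p k" by simp
  qed
  also have "\<dots> = w" using orthonormal_expand[OF p] w unfolding sp by simp
  finally show ?thesis using that y by blast
qed

lemma contract_tucker_in_span: "b \<in> rest_modes \<mu> \<Longrightarrow> contract \<mu> (tucker r C U) b \<in> span (U \<mu> ` {..<r \<mu>})"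
  unfolding contract_tucker by (rule sum_in_span_family)

section \<open>Representations of a point of the manifold\<close>

text \<open>Otherwise \<open>e\<close> could be extended to \<open>n + 1\<close> independent vectors in a span of \<open>n\<close> vectors.\<close>

lemma span_orthonormal_eq:
  assumes e: "orthonormal n e" and f: "orthonormal n f" and sub: "span (e ` {..<n}) \<subseteq> span (f ` {..<n})"
  shows "span (e ` {..<n}) = span (f ` {..<n} :: 'a::real_inner set)"
proof (rule ccontr)
  assume "span (e ` {..<n}) \<noteq> span (f ` {..<n})"
  then obtain v where v: "v \<in> span (f ` {..<n})" "v \<notin> span (e ` {..<n})" using sub by blast
  define p where "p = (\<Sum>i<n. inner v (e i) *\<^sub>R e i)"
  have p: "p \<in> span (e ` {..<n})" unfolding p_def by (rule sum_in_span_family)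
  define w where "w = (1 / norm (v - p)) *\<^sub>R (v - p)"
  have "v - p \<noteq> 0" using p v(2) by auto
  then have w: "norm w = 1" by (simp add: w_def)
  have orth: "inner w (e i) = 0" if "i < n" for i
    using inner_orthonormal_sum(1)[OF e that] by (simp add: w_def inner_diff_left p_def)
  have "orthonormal (Suc n) (e(n := w))" by (rule orthonormal_extend(1)[OF e w]) (rule orth)
  then have ind: "linear_indep (Suc n) (e(n := w))" by (rule linear_indep_orthonormal)
  have "w \<in> span (f ` {..<n})"
    unfolding w_def using v(1) p sub by (intro span_scale span_diff) auto
  moreover have "e i \<in> span (f ` {..<n})" if "i < n" for i
    using that sub span_base[of "e i" "e ` {..<n}"] by blast
  ultimately have "Suc n \<le> card (f ` {..<n})"
    by (intro linear_indep_le[OF ind]) (auto simp: less_Suc_eq)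
  then show False using card_image_le[of "{..<n}" f] by simp
qed

text \<open>
  The matrix of an independent family with respect to an orthonormal basis of its span has
  trivial kernel.
\<close>

lemma change_of_basis_matrix:
  assumes u: "orthonormal n u" and v: "linear_indep n (v :: nat \<Rightarrow> nat ell2)"
    and sp: "\<And>k. k < n \<Longrightarrow> v k \<in> span (u ` {..<n})"
  shows "\<exists>T. T \<in> carrier_mat n n \<and> invertible_mat T \<and> (\<forall>k<n. v k = (\<Sum>l<n. T $$ (l, k) *\<^sub>R u l))"
proof -
  define T where "T = Matrix.mat n n (\<lambda>(l, k). inner (v k) (u l))"
  have T: "T \<in> carrier_mat n n" by (simp add: T_def)
  have vk: "v k = (\<Sum>l<n. T $$ (l, k) *\<^sub>R u l)" if "k < n" for k
    using orthonormal_expand[OF u sp[OF that]] that by (simp add: T_def)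
  have "invertible_mat T"
    unfolding invertible_mat_iff_kernel[OF T]
  proof (intro allI impI)
    fix x :: "nat \<Rightarrow> real" and j assume x: "\<forall>i<n. (\<Sum>j<n. T $$ (i, j) * x j) = 0" and j: "j < n"
    have "(\<Sum>k<n. x k *\<^sub>R v k) = (\<Sum>k<n. \<Sum>l<n. (T $$ (l, k) * x k) *\<^sub>R u l)"
      by (intro sum.cong refl) (simp add: vk scaleR_sum_right mult.commute)
    also have "\<dots> = (\<Sum>l<n. (\<Sum>k<n. T $$ (l, k) * x k) *\<^sub>R u l)"
      unfolding scaleR_sum_left by (rule sum.swap)
    also have "\<dots> = 0" using x by simp
    finally show "x j = 0" using v j unfolding linear_indep_def by blast
  qed
  with T vk show ?thesis by blast
qed

text \<open>
  The assumptions on the core manifold, with the action of the general linear groups written as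
  \<^const>\<open>mode_transform\<close>.
\<close>

locale tucker_model =
  fixes r :: "'d::finite \<Rightarrow> nat" and Mc :: "('d \<Rightarrow> nat) ell2 set"
  assumes r_pos: "\<And>\<mu>. 0 < r \<mu>"
    and full_rank: "Mc \<subseteq> full_rank_tensors r"
    and submanifold: "embedded_submanifold (tensors r) Mc"
    and invariant: "\<And>C T. C \<in> Mc \<Longrightarrow> (\<And>\<mu>. T \<mu> \<in> carrier_mat (r \<mu>) (r \<mu>) \<and> invertible_mat (T \<mu>)) \<Longrightarrow>
          mode_transform r T C \<in> Mc"
begin

lemma Mc_tensors: "C \<in> Mc \<Longrightarrow> C \<in> tensors r"
  using full_rank full_rank_tensorsD by blast

lemma Mc_full_rank: "C \<in> Mc \<Longrightarrow> C \<in> full_rank_tensors r"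
  using full_rank by blast

text \<open>
  The coefficients of \<open>U\<close> with respect to \<open>V\<close> are moved into the core, which stays in \<open>Mc\<close> by
  invariance.
\<close>

lemma orthonormalise_representation:
  assumes C: "C \<in> Mc" and ind: "\<And>\<mu>. linear_indep (r \<mu>) (U \<mu>)"
    and V: "orthonormal_frames r V" and sp: "\<And>\<mu>. span (V \<mu> ` {..<r \<mu>}) = span (U \<mu> ` {..<r \<mu>})"
  shows "\<exists>T. (\<forall>\<mu>. T \<mu> \<in> carrier_mat (r \<mu>) (r \<mu>) \<and> invertible_mat (T \<mu>)) \<and>
    (\<forall>\<mu>. \<forall>k<r \<mu>. U \<mu> k = (\<Sum>l<r \<mu>. T \<mu> $$ (l, k) *\<^sub>R V \<mu> l)) \<and>
    mode_transform r T C \<in> Mc \<and> tucker r C U = tucker r (mode_transform r T C) V"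
proof -
  have "\<exists>T. T \<in> carrier_mat (r \<mu>) (r \<mu>) \<and> invertible_mat T \<and> (\<forall>k<r \<mu>. U \<mu> k = (\<Sum>l<r \<mu>. T $$ (l, k) *\<^sub>R V \<mu> l))" for \<mu>
  proof (rule change_of_basis_matrix)
    show "U \<mu> k \<in> span (V \<mu> ` {..<r \<mu>})" if "k < r \<mu>" for k
      unfolding sp using that by (intro span_base) blast
  qed (use V ind in \<open>auto simp: orthonormal_frames_def\<close>)
  then obtain T where T: "\<And>\<mu>. T \<mu> \<in> carrier_mat (r \<mu>) (r \<mu>)" "\<And>\<mu>. invertible_mat (T \<mu>)"
    and UT: "\<And>\<mu> k. k < r \<mu> \<Longrightarrow> U \<mu> k = (\<Sum>l<r \<mu>. T \<mu> $$ (l, k) *\<^sub>R V \<mu> l)"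
    by metis
  have "mode_transform r T C \<in> Mc" using invariant[OF C] T by blast
  moreover have "tucker r C U = tucker r (mode_transform r T C) V"
    using T(1) UT by (rule tucker_mode_transform)
  ultimately show ?thesis using T UT by blast
qed

lemma ex_orthonormal_frames:
  assumes ind: "\<And>\<mu>. linear_indep (r \<mu>) (U \<mu>)"
  shows "\<exists>V. orthonormal_frames r V \<and> (\<forall>\<mu>. span (V \<mu> ` {..<r \<mu>}) = span (U \<mu> ` {..<r \<mu>}))"
proof -
  have "\<exists>e. orthonormal (r \<mu>) e \<and> span (e ` {..<r \<mu>}) = span (U \<mu> ` {..<r \<mu>})" for \<mu>
    using linear_indep_orthonormal_basis[OF ind] by metis
  then obtain V where "\<And>\<mu>. orthonormal (r \<mu>) (V \<mu>) \<and> span (V \<mu> ` {..<r \<mu>}) = span (U \<mu> ` {..<r \<mu>})"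
    by metis
  then show ?thesis unfolding orthonormal_frames_def by blast
qed

text \<open>
  The column spaces of a point of the manifold are determined by the point: they are the ranges
  of its contractions, because the core has full rank.
\<close>

lemma representation_span:
  assumes C: "C \<in> Mc" and ind: "\<And>\<mu>. linear_indep (r \<mu>) (U \<mu>)"
    and V: "orthonormal_frames r V" and eq: "tucker r D V = tucker r C U"
  shows "span (V \<mu> ` {..<r \<mu>}) = span (U \<mu> ` {..<r \<mu>})"
proof -
  obtain W where W: "orthonormal_frames r W" "\<And>\<mu>. span (W \<mu> ` {..<r \<mu>}) = span (U \<mu> ` {..<r \<mu>})"
    using ex_orthonormal_frames[OF ind] by blast
  obtain T where T: "mode_transform r T C \<in> Mc" "tucker r C U = tucker r (mode_transform r T C) W"
    using orthonormalise_representation[OF C ind W] by blast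
  have "span (W \<mu> ` {..<r \<mu>}) = span (V \<mu> ` {..<r \<mu>})"
  proof (rule span_orthonormal_eq)
    show "span (W \<mu> ` {..<r \<mu>}) \<subseteq> span (V \<mu> ` {..<r \<mu>})"
    proof
      fix w assume "w \<in> span (W \<mu> ` {..<r \<mu>})"
      from contract_tucker_surj[OF W(1) Mc_full_rank[OF T(1)] this] obtain y
        where y: "y \<in> rest_modes \<mu>" "contract \<mu> (tucker r D V) y = w" unfolding eq T(2) .
      then show "w \<in> span (V \<mu> ` {..<r \<mu>})" using contract_tucker_in_span[OF y(1), of r D V] by simp
    qed
  qed (use W(1) V in \<open>auto simp: orthonormal_frames_def\<close>)
  then show ?thesis using W(2) by simp
qed

text \<open>
  With orthonormal factors \<open>V\<close> the core is determined by the point, since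
  \<^term>\<open>\<lambda>D. tucker r D V\<close> is isometric on the tensors of size \<open>r\<close>.
\<close>

lemma representation_core:
  assumes C: "C \<in> Mc" and ind: "\<And>\<mu>. linear_indep (r \<mu>) (U \<mu>)"
    and V: "orthonormal_frames r V" and D: "D \<in> tensors r" and eq: "tucker r D V = tucker r C U"
  shows "D \<in> Mc"
    and "\<exists>T. (\<forall>\<mu>. T \<mu> \<in> carrier_mat (r \<mu>) (r \<mu>) \<and> invertible_mat (T \<mu>)) \<and>
      (\<forall>\<mu>. \<forall>k<r \<mu>. U \<mu> k = (\<Sum>l<r \<mu>. T \<mu> $$ (l, k) *\<^sub>R V \<mu> l)) \<and> D = mode_transform r T C"
proof -
  obtain T where T: "\<And>\<mu>. T \<mu> \<in> carrier_mat (r \<mu>) (r \<mu>) \<and> invertible_mat (T \<mu>)"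
    "\<And>\<mu> k. k < r \<mu> \<Longrightarrow> U \<mu> k = (\<Sum>l<r \<mu>. T \<mu> $$ (l, k) *\<^sub>R V \<mu> l)"
    "mode_transform r T C \<in> Mc" "tucker r C U = tucker r (mode_transform r T C) V"
    using orthonormalise_representation[OF C ind V representation_span[OF C ind V eq]] by blast
  have "D - mode_transform r T C \<in> tensors r"
    using D Mc_tensors[OF T(3)] by (rule subspace_diff[OF subspace_tensors])
  then have "norm (D - mode_transform r T C) = norm (tucker r (D - mode_transform r T C) V)"
    by (simp add: norm_tucker_orthonormal[OF V])
  also have "\<dots> = 0" unfolding tucker_diff eq T(4) by simp
  finally have D': "D = mode_transform r T C" by simp
  with T(3) show "D \<in> Mc" by simp
  show "\<exists>T. (\<forall>\<mu>. T \<mu> \<in> carrier_mat (r \<mu>) (r \<mu>) \<and> invertible_mat (T \<mu>)) \<and>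
      (\<forall>\<mu>. \<forall>k<r \<mu>. U \<mu> k = (\<Sum>l<r \<mu>. T \<mu> $$ (l, k) *\<^sub>R V \<mu> l)) \<and> D = mode_transform r T C"
    using T(1,2) D' by blast
qed

lemma mem_tucker_manifold_iff:
  "X \<in> tucker_manifold r Mc \<longleftrightarrow> (\<exists>C U. C \<in> Mc \<and> orthonormal_frames r U \<and> X = tucker r C U)"
proof
  assume "X \<in> tucker_manifold r Mc"
  then obtain C U where C: "C \<in> Mc" and ind: "\<And>\<mu>. linear_indep (r \<mu>) (U \<mu>)" and X: "X = tucker r C U"
    by (auto simp: tucker_manifold_def invertible_gram_iff)
  obtain W where W: "orthonormal_frames r W" "\<And>\<mu>. span (W \<mu> ` {..<r \<mu>}) = span (U \<mu> ` {..<r \<mu>})"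
    using ex_orthonormal_frames[OF ind] by blast
  obtain T where T: "mode_transform r T C \<in> Mc" "tucker r C U = tucker r (mode_transform r T C) W"
    using orthonormalise_representation[OF C ind W] by blast
  with W X show "\<exists>C U. C \<in> Mc \<and> orthonormal_frames r U \<and> X = tucker r C U" by auto
next
  assume "\<exists>C U. C \<in> Mc \<and> orthonormal_frames r U \<and> X = tucker r C U"
  then show "X \<in> tucker_manifold r Mc"
    unfolding tucker_manifold_def invertible_gram_iff orthonormal_frames_def
    by (auto intro: linear_indep_orthonormal)
qed

end

section \<open>Tangent spaces\<close>

lemma cont_diff_on_bounded_linear:
  assumes L: "bounded_linear L"
  shows "cont_diff_on k E S f \<Longrightarrow> cont_diff_on k E S (\<lambda>x. L (f x))"
proof (induction k arbitrary: f)
  case 0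
  then show ?case using L by (simp add: bounded_linear.continuous_on)
next
  case (Suc k)
  then obtain f' where f': "\<And>x. x \<in> S \<Longrightarrow> (f has_derivative f' x) (at x within S)"
    "\<And>v. v \<in> E \<Longrightarrow> cont_diff_on k E S (\<lambda>x. f' x v)" by auto
  then have "\<forall>x\<in>S. ((\<lambda>x. L (f x)) has_derivative (\<lambda>v. L (f' x v))) (at x within S)"
    using bounded_linear.has_derivative[OF L] by blast
  moreover have "\<forall>v\<in>E. cont_diff_on k E S (\<lambda>x. L (f' x v))" using Suc.IH f'(2) by blast
  ultimately show ?case unfolding cont_diff_on.simps by (intro exI[of _ "\<lambda>x v. L (f' x v)"] conjI)
qed

text \<open>
  The derivatives of \<open>g\<close> along the line are those of \<open>g\<close> in the direction \<open>w\<close>, to which the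
  induction hypothesis applies again.
\<close>

lemma cont_diff_on_along_line:
  assumes E: "subspace E" and w: "w \<in> E" and I: "\<And>t. t \<in> I \<Longrightarrow> q + t *\<^sub>R w \<in> V"
  shows "cont_diff_on k E V g \<Longrightarrow> cont_diff_on k UNIV I (\<lambda>t::real. g (q + t *\<^sub>R w))"
proof (induction k arbitrary: g)
  case 0
  then have "continuous_on V g" by simp
  then have "continuous_on I (\<lambda>t. g (q + t *\<^sub>R w))"
    by (rule continuous_on_compose2) (use I in \<open>auto intro!: continuous_intros\<close>)
  then show ?case by simp
next
  case (Suc k)
  then obtain g' where g': "\<And>x. x \<in> V \<Longrightarrow> (g has_derivative g' x) (at x within V)"
    "\<And>v. v \<in> E \<Longrightarrow> cont_diff_on k E V (\<lambda>x. g' x v)" by auto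
  have "((\<lambda>t. g (q + t *\<^sub>R w)) has_derivative (\<lambda>s. g' (q + t *\<^sub>R w) (s *\<^sub>R w))) (at t within I)" if t: "t \<in> I" for t
  proof -
    have "((\<lambda>t. q + t *\<^sub>R w) has_derivative (\<lambda>s. s *\<^sub>R w)) (at t within I)"
      by (auto intro!: derivative_eq_intros)
    from has_derivative_in_compose2[where t = V, OF g'(1) _ t this] show ?thesis using I by blast
  qed
  moreover have "cont_diff_on k UNIV I (\<lambda>t. g' (q + t *\<^sub>R w) (s *\<^sub>R w))" for s
    using Suc.IH[OF g'(2)[of "s *\<^sub>R w"]] w E by (simp add: subspace_scale)
  ultimately show ?case
    unfolding cont_diff_on.simps by (intro exI[of _ "\<lambda>t s. g' (q + t *\<^sub>R w) (s *\<^sub>R w)"] conjI) auto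
qed

lemma smooth_on_has_derivative:
  assumes "smooth_on E S f"
  shows "\<exists>f'. \<forall>x\<in>S. (f has_derivative f' x) (at x within S)"
proof -
  have "cont_diff_on (Suc 0) E S f" using assms by (simp only: smooth_on_def)
  then show ?thesis by auto
qed

lemma tangent_space_bounded_linear_image:
  assumes L: "bounded_linear L" and sub: "L ` M \<subseteq> N" and v: "v \<in> tangent_space M p"
  shows "L v \<in> tangent_space N (L p)"
proof -
  obtain \<gamma> \<epsilon> where \<gamma>: "0 < \<epsilon>" "smooth_on UNIV {-\<epsilon><..<\<epsilon>} \<gamma>" "\<gamma> ` {-\<epsilon><..<\<epsilon>} \<subseteq> M" "\<gamma> 0 = p"
    "(\<gamma> has_vector_derivative v) (at (0::real))"
    using v by (auto simp: tangent_space_def)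
  have "smooth_on UNIV {-\<epsilon><..<\<epsilon>} (\<lambda>t. L (\<gamma> t))"
    using \<gamma>(2) unfolding smooth_on_def by (intro allI cont_diff_on_bounded_linear[OF L]) blast
  moreover have "((\<lambda>t. L (\<gamma> t)) has_vector_derivative L v) (at 0)"
    using bounded_linear.has_vector_derivative[OF L \<gamma>(5)] .
  ultimately show ?thesis
    unfolding tangent_space_def using \<gamma>(1,3,4) sub
    by (auto intro!: exI[of _ "\<lambda>t. L (\<gamma> t)"] exI[of _ \<epsilon>])
qed

text \<open>
  The distance vector to the subspace is a bounded linear function that vanishes along the curve,
  and hence also at its derivative.
\<close>

lemma vector_derivative_in_subspace:
  assumes e: "orthonormal n e" and \<epsilon>: "0 < \<epsilon>"
    and \<gamma>: "\<And>t. t \<in> {-\<epsilon><..<\<epsilon>} \<Longrightarrow> \<gamma> t \<in> span (e ` {..<n})" and d: "(\<gamma> has_vector_derivative v) (at (0::real))"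
  shows "v \<in> span (e ` {..<n})"
proof -
  have L: "bounded_linear (\<lambda>x. x - (\<Sum>i<n. inner x (e i) *\<^sub>R e i))"
    by (intro bounded_linear_sub bounded_linear_ident bounded_linear_sum bounded_linear_scaleR_const bounded_linear_inner_left)
  have "((\<lambda>t. \<gamma> t - (\<Sum>i<n. inner (\<gamma> t) (e i) *\<^sub>R e i)) has_vector_derivative
      (v - (\<Sum>i<n. inner v (e i) *\<^sub>R e i))) (at 0)"
    using bounded_linear.has_vector_derivative[OF L d] .
  moreover have "((\<lambda>t. \<gamma> t - (\<Sum>i<n. inner (\<gamma> t) (e i) *\<^sub>R e i)) has_vector_derivative 0) (at 0)"
  proof (rule has_vector_derivative_transform_within_open[of "\<lambda>_. 0" _ _ "{-\<epsilon><..<\<epsilon>}"])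
    show "0 = \<gamma> t - (\<Sum>i<n. inner (\<gamma> t) (e i) *\<^sub>R e i)" if "t \<in> {-\<epsilon><..<\<epsilon>}" for t
      using orthonormal_expand[OF e \<gamma>[OF that]] by simp
  qed (use \<epsilon> in auto)
  ultimately have "v - (\<Sum>i<n. inner v (e i) *\<^sub>R e i) = 0" by (rule vector_derivative_unique_at)
  then have "v = (\<Sum>i<n. inner v (e i) *\<^sub>R e i)" by simp
  then show ?thesis by (metis sum_in_span_family)
qed

text \<open>
  In a slice chart the tangent vectors are the images of the directions of the slice: straight
  lines of the slice give curves of \<open>M\<close>, and conversely a curve of \<open>M\<close> is straightened by the
  chart to a curve of the slice.
\<close>

lemma subspace_tangent_space:
  assumes M: "embedded_submanifold E M" and p: "p \<in> M"
    and E: "subspace E" "E \<subseteq> span S" "finite S"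
  shows "subspace (tangent_space M (p :: 'a::real_inner))" "tangent_space M p \<subseteq> E"
proof -
  obtain e where e: "orthonormal (dim E) e" "span (e ` {..<dim E}) = E"
    using orthonormal_basis_finite_dim[OF E] .
  have ME: "M \<subseteq> E" using M by (simp add: embedded_submanifold_def)
  show "tangent_space M p \<subseteq> E"
  proof
    fix v assume "v \<in> tangent_space M p"
    then obtain \<gamma> \<epsilon> where \<gamma>: "0 < \<epsilon>" "\<gamma> ` {-\<epsilon><..<\<epsilon>} \<subseteq> M" "(\<gamma> has_vector_derivative v) (at (0::real))"
      by (auto simp: tangent_space_def)
    show "v \<in> E"
      using vector_derivative_in_subspace[OF e(1) \<gamma>(1) _ \<gamma>(3)] \<gamma>(2) ME unfolding e(2) by blast
  qed
  obtain U V \<phi> \<psi> W where U: "openin (top_of_set E) U" "p \<in> U" and V: "openin (top_of_set E) V"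
    and hom: "homeomorphism U V \<phi> \<psi>" and \<phi>: "smooth_on E U \<phi>" and \<psi>: "smooth_on E V \<psi>"
    and W: "subspace W" "W \<subseteq> E" and slice: "\<phi> ` (M \<inter> U) = W \<inter> V"
    using M p unfolding embedded_submanifold_def by metis
  obtain f where f: "orthonormal (dim W) f" "span (f ` {..<dim W}) = W"
    using orthonormal_basis_finite_dim[OF W(1) order_trans[OF W(2) E(2)] E(3)] .
  obtain \<phi>' where \<phi>': "\<And>x. x \<in> U \<Longrightarrow> (\<phi> has_derivative \<phi>' x) (at x within U)"
    using smooth_on_has_derivative[OF \<phi>] by blast
  obtain \<psi>' where \<psi>': "\<And>x. x \<in> V \<Longrightarrow> (\<psi> has_derivative \<psi>' x) (at x within V)"
    using smooth_on_has_derivative[OF \<psi>] by blast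
  define q where "q = \<phi> p"
  have \<psi>\<phi>: "\<psi> (\<phi> x) = x" if "x \<in> U" for x using hom that by (simp add: homeomorphism_def)
  have \<phi>U: "\<phi> ` U = V" using hom by (simp add: homeomorphism_def)
  have q: "q \<in> V" "q \<in> W" "\<psi> q = p"
    using U(2) \<phi>U slice p \<psi>\<phi> by (auto simp: q_def)
  obtain \<delta> where \<delta>: "0 < \<delta>" "ball q \<delta> \<inter> E \<subseteq> V" using V q(1) by (meson openin_contains_ball)
  obtain \<rho> where \<rho>: "0 < \<rho>" "ball p \<rho> \<inter> E \<subseteq> U" using U by (meson openin_contains_ball)
  have "tangent_space M p = \<psi>' q ` W"
  proof (intro equalityI subsetI)
    fix v assume "v \<in> \<psi>' q ` W"
    then obtain w where w: "w \<in> W" "v = \<psi>' q w" by blast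
    define \<epsilon> where "\<epsilon> = \<delta> / (norm w + 1)"
    have \<epsilon>: "0 < \<epsilon>" using \<delta>(1) by (simp add: \<epsilon>_def add_nonneg_pos)
    define I where "I = {-\<epsilon><..<\<epsilon>}"
    have WV: "q + t *\<^sub>R w \<in> W \<inter> V" if "t \<in> I" for t
    proof
      show "q + t *\<^sub>R w \<in> W" using W(1) q(2) w(1) by (simp add: subspace_add subspace_scale)
      then have "q + t *\<^sub>R w \<in> E" using W(2) by blast
      moreover have "\<bar>t\<bar> * norm w < \<delta>"
      proof -
        have "\<bar>t\<bar> * norm w \<le> \<bar>t\<bar> * (norm w + 1)" by (simp add: mult_left_mono)
        also have "\<dots> < \<epsilon> * (norm w + 1)"
          using that by (intro mult_strict_right_mono) (auto simp: I_def add_nonneg_pos)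
        also have "\<dots> = \<delta>"
        proof -
          have "norm w + 1 \<noteq> 0" using norm_ge_zero[of w] by linarith
          then show ?thesis by (simp add: \<epsilon>_def)
        qed
        finally show ?thesis .
      qed
      ultimately show "q + t *\<^sub>R w \<in> V" using \<delta>(2) by (auto simp: dist_norm)
    qed
    have "\<psi> (q + t *\<^sub>R w) \<in> M" if "t \<in> I" for t
      using WV[OF that] slice \<psi>\<phi> by (metis (no_types, lifting) IntD1 IntD2 imageE)
    moreover have "smooth_on UNIV I (\<lambda>t. \<psi> (q + t *\<^sub>R w))"
      using \<psi> cont_diff_on_along_line[OF E(1), of w I q V] w(1) W(2) WV
      unfolding smooth_on_def by blast
    moreover have "((\<lambda>t. \<psi> (q + t *\<^sub>R w)) has_vector_derivative v) (at 0)"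
    proof -
      have line: "((\<lambda>t. q + t *\<^sub>R w) has_derivative (\<lambda>s. s *\<^sub>R w)) (at 0 within I)"
        by (auto intro!: derivative_eq_intros)
      have sub: "(\<lambda>t. q + t *\<^sub>R w) ` I \<subseteq> V" using WV by blast
      have "0 \<in> I" using \<epsilon> by (simp add: I_def)
      from has_derivative_in_compose2[where t = V, OF \<psi>' sub this line]
      have "((\<lambda>t. \<psi> (q + t *\<^sub>R w)) has_derivative (\<lambda>s. \<psi>' (q + 0 *\<^sub>R w) (s *\<^sub>R w))) (at 0 within I)" .
      moreover have "linear (\<psi>' q)" using \<psi>'[OF q(1)] by (rule has_derivative_linear)
      ultimately have "((\<lambda>t. \<psi> (q + t *\<^sub>R w)) has_derivative (\<lambda>s. s *\<^sub>R v)) (at 0 within I)"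
        by (simp add: w(2) linear_scale)
      moreover have "at 0 within I = at (0::real)"
        by (rule at_within_open) (use \<epsilon> in \<open>auto simp: I_def\<close>)
      ultimately show ?thesis by (simp add: has_vector_derivative_def)
    qed
    ultimately show "v \<in> tangent_space M p"
      unfolding tangent_space_def using \<epsilon> q(3)
      by (auto simp: I_def intro!: exI[of _ "\<lambda>t. \<psi> (q + t *\<^sub>R w)"] exI[of _ \<epsilon>])
  next
    fix v assume "v \<in> tangent_space M p"
    then obtain \<gamma> \<epsilon> where \<gamma>: "0 < \<epsilon>" "\<gamma> ` {-\<epsilon><..<\<epsilon>} \<subseteq> M" "\<gamma> 0 = p" "(\<gamma> has_vector_derivative v) (at (0::real))"
      by (auto simp: tangent_space_def)
    have "continuous (at 0) \<gamma>" using \<gamma>(4) by (rule has_vector_derivative_continuous)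
    then obtain \<eta> where \<eta>: "0 < \<eta>" "\<And>t. dist t 0 < \<eta> \<Longrightarrow> dist (\<gamma> t) p < \<rho>"
      using \<rho>(1) \<gamma>(3) unfolding continuous_at_eps_delta by metis
    define \<epsilon>' where "\<epsilon>' = min \<epsilon> \<eta>"
    define I where "I = {-\<epsilon>'<..<\<epsilon>'}"
    have \<epsilon>': "0 < \<epsilon>'" using \<gamma>(1) \<eta>(1) by (simp add: \<epsilon>'_def)
    have atI: "at 0 within I = at (0::real)"
      by (rule at_within_open) (use \<epsilon>' in \<open>auto simp: I_def\<close>)
    have MU: "\<gamma> t \<in> M \<inter> U" if "t \<in> I" for t
    proof -
      have "\<gamma> t \<in> M" using \<gamma>(2) that by (auto simp: I_def \<epsilon>'_def)
      moreover have "\<gamma> t \<in> ball p \<rho>" using \<eta>(2)[of t] that by (auto simp: I_def \<epsilon>'_def dist_commute)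
      ultimately show ?thesis using ME \<rho>(2) by blast
    qed
    define w where "w = \<phi>' p v"
    have d\<gamma>: "(\<gamma> has_derivative (\<lambda>s. s *\<^sub>R v)) (at 0 within I)"
      using \<gamma>(4) unfolding atI has_vector_derivative_def .
    have I0: "0 \<in> I" using \<epsilon>' by (simp add: I_def)
    have sub: "\<gamma> ` I \<subseteq> U" "(\<lambda>t. \<phi> (\<gamma> t)) ` I \<subseteq> V" using MU \<phi>U by blast+
    have "((\<lambda>t. \<phi> (\<gamma> t)) has_derivative (\<lambda>s. \<phi>' (\<gamma> 0) (s *\<^sub>R v))) (at 0 within I)"
      using has_derivative_in_compose2[where t = U, OF \<phi>' sub(1) I0 d\<gamma>] .
    moreover have "linear (\<phi>' p)" using \<phi>'[OF U(2)] by (rule has_derivative_linear)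
    ultimately have d\<phi>: "((\<lambda>t. \<phi> (\<gamma> t)) has_derivative (\<lambda>s. s *\<^sub>R w)) (at 0 within I)"
      by (simp add: w_def \<gamma>(3) linear_scale)
    then have "((\<lambda>t. \<phi> (\<gamma> t)) has_vector_derivative w) (at 0)"
      by (simp add: atI has_vector_derivative_def)
    moreover have "\<phi> (\<gamma> t) \<in> W" if "t \<in> I" for t using MU[OF that] slice by blast
    ultimately have w: "w \<in> W"
      using vector_derivative_in_subspace[OF f(1) \<epsilon>', of "\<lambda>t. \<phi> (\<gamma> t)" w] unfolding f(2) I_def by blast
    have "((\<lambda>t. \<psi> (\<phi> (\<gamma> t))) has_derivative (\<lambda>s. \<psi>' (\<phi> (\<gamma> 0)) (s *\<^sub>R w))) (at 0 within I)"
      using has_derivative_in_compose2[where t = V, OF \<psi>' sub(2) I0 d\<phi>] .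
    moreover have "linear (\<psi>' q)" using \<psi>'[OF q(1)] by (rule has_derivative_linear)
    ultimately have "((\<lambda>t. \<psi> (\<phi> (\<gamma> t))) has_derivative (\<lambda>s. s *\<^sub>R \<psi>' q w)) (at 0 within I)"
      by (simp add: \<gamma>(3) linear_scale flip: q_def)
    then have "(\<gamma> has_derivative (\<lambda>s. s *\<^sub>R \<psi>' q w)) (at 0 within I)"
      by (rule has_derivative_transform[rotated 2]) (use MU \<psi>\<phi> \<epsilon>' in \<open>auto simp: I_def\<close>)
    then have "(\<gamma> has_vector_derivative \<psi>' q w) (at 0)" unfolding atI has_vector_derivative_def .
    then have "v = \<psi>' q w" using \<gamma>(4) vector_derivative_unique_at by blast
    then show "v \<in> \<psi>' q ` W" using w by blast
  qed
  moreover have "linear (\<psi>' q)" using \<psi>'[OF q(1)] by (rule has_derivative_linear)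
  ultimately show "subspace (tangent_space M p)" using W(1) by (simp add: linear_subspace_image)
qed

text \<open>
  Submanifolds are locally closed: in a slice chart, \<open>M\<close> is the preimage of a closed subspace.
\<close>

lemma embedded_submanifold_locally_closed:
  assumes M: "embedded_submanifold E M" and p: "p \<in> M"
    and E: "subspace E" "E \<subseteq> span S" "finite S"
  obtains \<rho> where "0 < \<rho>" "ball (p :: 'a::real_inner) \<rho> \<inter> closure M \<subseteq> M"
proof -
  have ME: "M \<subseteq> E" using M by (simp add: embedded_submanifold_def)
  have clE: "closure M \<subseteq> E" using closed_finite_dim_subspace[OF E] ME by (simp add: closure_minimal)
  obtain U V \<phi> \<psi> W where U: "openin (top_of_set E) U" "p \<in> U"
    and hom: "homeomorphism U V \<phi> \<psi>"
    and W: "subspace W" "W \<subseteq> E" and slice: "\<phi> ` (M \<inter> U) = W \<inter> V"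
    using M p unfolding embedded_submanifold_def by metis
  have clW: "closed W" using closed_finite_dim_subspace[OF W(1) order_trans[OF W(2) E(2)] E(3)] .
  obtain \<rho> where \<rho>: "0 < \<rho>" "ball p \<rho> \<inter> E \<subseteq> U" using U by (meson openin_contains_ball)
  have "x \<in> M" if x: "x \<in> ball p \<rho> \<inter> closure M" for x
  proof -
    have xU: "x \<in> U" using x clE \<rho>(2) by blast
    obtain \<xi> where \<xi>: "\<And>n. \<xi> n \<in> M" "\<xi> \<longlonglongrightarrow> x" using x by (auto simp: closure_sequential)
    have ev: "eventually (\<lambda>n. \<xi> n \<in> U) sequentially"
    proof -
      have "eventually (\<lambda>n. \<xi> n \<in> ball p \<rho>) sequentially"
        using \<xi>(2) by (rule topological_tendstoD) (use x in auto)
      then show ?thesis by eventually_elim (use \<xi>(1) ME \<rho>(2) in blast)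
    qed
    have "continuous_on U \<phi>" using hom by (simp add: homeomorphism_def)
    then have "(\<lambda>n. \<phi> (\<xi> n)) \<longlonglongrightarrow> \<phi> x"
      by (rule continuous_on_tendsto_compose[OF _ \<xi>(2) xU ev])
    moreover have "eventually (\<lambda>n. \<phi> (\<xi> n) \<in> W) sequentially"
      using ev by eventually_elim (use \<xi>(1) slice in blast)
    ultimately have "\<phi> x \<in> W" by (rule Lim_in_closed_set[OF clW, rotated 2]) simp_all
    moreover have "\<phi> x \<in> V" using hom xU by (auto simp: homeomorphism_def)
    ultimately obtain y where y: "y \<in> M \<inter> U" "\<phi> x = \<phi> y" using slice by (metis IntI imageE)
    then have "x = y" using hom xU by (metis IntD2 homeomorphism_def)
    then show ?thesis using y(1) by blast
  qed
  then show ?thesis using that[OF \<rho>(1)] by blast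
qed

section \<open>The tangent space as an orthogonal sum\<close>

lemma sum_UNIV_option: "(\<Sum>i\<in>UNIV. f i) = f None + (\<Sum>\<mu>\<in>UNIV. f (Some (\<mu> :: 'd::finite)))"
  by (simp add: UNIV_option_conv sum.reindex)

lemma sum_ins_expand_right:
  "a = (\<lambda>k. \<Sum>l<m. x k l *\<^sub>R e l) \<Longrightarrow>
    (\<Sum>k<n::nat. ins \<mu> (W k) (a k)) = (\<Sum>l<m::nat. ins \<mu> (\<Sum>k<n. x k l *\<^sub>R W k) (e l))"
  by (simp add: ins_sum_left ins_sum_right ins_simps) (rule sum.swap)

lemma sum_ins_expand_left:
  "W = (\<lambda>k. \<Sum>l<m. x k l *\<^sub>R e l) \<Longrightarrow>
    (\<Sum>k<n::nat. ins \<mu> (W k) (a k)) = (\<Sum>l<m::nat. ins \<mu> (e l) (\<Sum>k<n. x k l *\<^sub>R a k))"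
  by (simp add: ins_sum_left ins_sum_right ins_simps) (rule sum.swap)

lemma inner_sum_ins_diagonal:
  assumes "\<And>k. k < n \<Longrightarrow> c k \<in> rest_modes \<mu>"
    and "\<And>k l. k < n \<Longrightarrow> l < n \<Longrightarrow> inner (x k) (y l) = (if k = l then d k else 0)"
  shows "inner (\<Sum>k<n::nat. ins \<mu> (x k) (a k)) (\<Sum>l<n. ins \<mu> (y l) (c l)) = (\<Sum>k<n. d k * inner (a k) (c k))"
proof -
  have "inner (\<Sum>k<n. ins \<mu> (x k) (a k)) (\<Sum>l<n. ins \<mu> (y l) (c l))
      = (\<Sum>k<n. \<Sum>l<n. if l = k then d k * inner (a k) (c k) else 0)"
    unfolding inner_sum_left unfolding inner_sum_right
    by (intro sum.cong refl) (auto simp: inner_ins_ins assms)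
  then show ?thesis by simp
qed

lemma norm_sum_ins_orthonormal_right:
  assumes e: "orthonormal n e" "\<And>k. k < n \<Longrightarrow> e k \<in> rest_modes \<mu>"
  shows "(norm (\<Sum>k<n. ins \<mu> (w k) (e k)))\<^sup>2 = (\<Sum>k<n. (norm (w k))\<^sup>2)"
proof -
  have "(norm (\<Sum>k<n. ins \<mu> (w k) (e k)))\<^sup>2 = (\<Sum>k<n. (norm (ins \<mu> (w k) (e k)))\<^sup>2)"
    by (rule norm_sum_orthogonal) (auto simp: inner_ins_ins e orthonormalD[OF e(1)])
  then show ?thesis using e by (simp add: norm_ins orthonormal_norm)
qed

lemma norm_sum_ins_orthonormal_left:
  assumes e: "orthonormal n e" "\<And>k. k < n \<Longrightarrow> c k \<in> rest_modes \<mu>"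
  shows "(norm (\<Sum>k<n. ins \<mu> (e k) (c k)))\<^sup>2 = (\<Sum>k<n. (norm (c k))\<^sup>2)"
proof -
  have "(norm (\<Sum>k<n. ins \<mu> (e k) (c k)))\<^sup>2 = (\<Sum>k<n. (norm (ins \<mu> (e k) (c k)))\<^sup>2)"
    by (rule norm_sum_orthogonal) (auto simp: inner_ins_ins e orthonormalD[OF e(1)])
  then show ?thesis using e by (simp add: norm_ins orthonormal_norm)
qed

text \<open>
  The part of the tangent space at \<^term>\<open>tucker r C U\<close> that moves the factor of mode \<open>\<mu>\<close>.
\<close>

definition mode_tangent ::
  "('d::finite \<Rightarrow> nat) \<Rightarrow> ('d \<Rightarrow> nat) ell2 \<Rightarrow> ('d \<Rightarrow> nat \<Rightarrow> nat ell2) \<Rightarrow> 'd \<Rightarrow> ('d \<Rightarrow> nat) ell2 set"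
  where "mode_tangent r C U \<mu> =
    {tucker r C (U(\<mu> := W)) | W. \<forall>j<r \<mu>. \<forall>k<r \<mu>. inner (U \<mu> j) (W k) = 0}"

text \<open>
  With an orthonormal basis \<open>e\<close> of the row space, the elements of \<^const>\<open>mode_tangent\<close> are the
  sums of \<^term>\<open>ins \<mu> (w l) (e l)\<close> with \<open>w l\<close> orthogonal to the column space, and the projection
  contracts with \<open>e l\<close> and removes the component in the column space.
\<close>

lemma has_orth_proj_mode_tangent:
  assumes U: "orthonormal_frames r U" and C: "C \<in> full_rank_tensors r"
  shows "has_orth_proj (mode_tangent r C U \<mu>)"
proof -
  define a where "a = mode_rows r C U \<mu>"
  define n where "n = r \<mu>"
  have u: "orthonormal n (U \<mu>)" using U by (simp add: orthonormal_frames_def n_def)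
  obtain e where e: "orthonormal n e" "span (e ` {..<n}) = span (a ` {..<n})"
    using linear_indep_orthonormal_basis[OF mode_rows_linear_indep[OF U C, of \<mu>]] unfolding a_def n_def by blast
  have er: "e l \<in> rest_modes \<mu>" if "l < n" for l
  proof -
    have "e l \<in> span (a ` {..<n})" unfolding e(2)[symmetric] using that by (intro span_base) blast
    then show ?thesis using span_mode_rows unfolding a_def by blast
  qed
  define N where "N = {w. \<forall>j<n. inner (U \<mu> j) w = 0}"
  have N: "subspace N" by (auto simp: N_def subspace_def inner_add_right)
  have "\<exists>x. \<forall>k<n. a k = (\<Sum>l<n. x k l *\<^sub>R e l)"
  proof (intro exI allI impI)
    fix k assume "k < n"
    then have "a k \<in> span (e ` {..<n})" unfolding e(2) by (intro span_base) blast
    then show "a k = (\<Sum>l<n. inner (a k) (e l) *\<^sub>R e l)" by (rule orthonormal_expand[OF e(1)])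
  qed
  then obtain x where x: "\<And>k. k < n \<Longrightarrow> a k = (\<Sum>l<n. x k l *\<^sub>R e l)" by blast
  have "\<forall>l. \<exists>y. l < n \<longrightarrow> e l = (\<Sum>k<n. y k *\<^sub>R a k)"
  proof
    fix l
    show "\<exists>y. l < n \<longrightarrow> e l = (\<Sum>k<n. y k *\<^sub>R a k)"
    proof (cases "l < n")
      case True
      then have "e l \<in> span (a ` {..<n})" unfolding e(2)[symmetric] by (intro span_base) blast
      then show ?thesis unfolding in_span_family by blast
    qed blast
  qed
  then obtain y where y: "\<And>l. l < n \<Longrightarrow> e l = (\<Sum>k<n. y l k *\<^sub>R a k)" by metis
  have eq: "mode_tangent r C U \<mu> = {\<Sum>l<n. ins \<mu> (w l) (e l) | w. \<forall>l<n. w l \<in> N}" (is "_ = ?T")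
  proof (intro equalityI subsetI)
    fix t assume "t \<in> mode_tangent r C U \<mu>"
    then obtain W where W: "\<And>k. k < n \<Longrightarrow> W k \<in> N" "t = tucker r C (U(\<mu> := W))"
      by (auto simp: mode_tangent_def N_def n_def)
    have "t = (\<Sum>k<n. ins \<mu> (W k) (\<Sum>l<n. x k l *\<^sub>R e l))"
      unfolding W(2) tucker_split_mode using x by (simp add: n_def a_def)
    also have "\<dots> = (\<Sum>l<n. ins \<mu> (\<Sum>k<n. x k l *\<^sub>R W k) (e l))"
      by (rule sum_ins_expand_right) simp
    finally show "t \<in> ?T"
      using W(1) N by (auto intro!: exI[of _ "\<lambda>l. \<Sum>k<n. x k l *\<^sub>R W k"] subspace_sum subspace_scale)
  next
    fix t assume "t \<in> ?T"
    then obtain w where w: "\<And>l. l < n \<Longrightarrow> w l \<in> N" "t = (\<Sum>l<n. ins \<mu> (w l) (e l))" by blast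
    define W where "W k = (\<Sum>l<n. y l k *\<^sub>R w l)" for k
    have "t = (\<Sum>l<n. ins \<mu> (w l) (\<Sum>k<n. y l k *\<^sub>R a k))" unfolding w(2) using y by simp
    also have "\<dots> = (\<Sum>k<n. ins \<mu> (W k) (a k))"
      unfolding W_def by (rule sum_ins_expand_right) simp
    finally have "t = tucker r C (U(\<mu> := W))" by (simp add: tucker_split_mode n_def a_def)
    moreover have "W k \<in> N" for k
      unfolding W_def using w(1) by (intro subspace_sum subspace_scale N) auto
    ultimately show "t \<in> mode_tangent r C U \<mu>" by (auto simp: mode_tangent_def N_def n_def)
  qed
  show ?thesis
    unfolding eq has_orth_proj_def
  proof (intro conjI allI)
    show "subspace ?T"
      unfolding subspace_def
    proof (intro conjI ballI allI)
      show "0 \<in> ?T" using N by (auto intro!: exI[of _ "\<lambda>_. 0"] simp: ins_simps subspace_0)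
    next
      fix s t assume "s \<in> ?T" "t \<in> ?T"
      then obtain v w where "s = (\<Sum>l<n. ins \<mu> (v l) (e l))" "t = (\<Sum>l<n. ins \<mu> (w l) (e l))"
        "\<forall>l<n. v l \<in> N" "\<forall>l<n. w l \<in> N" by blast
      then show "s + t \<in> ?T"
        using N by (auto intro!: exI[of _ "\<lambda>l. v l + w l"] simp: ins_simps sum.distrib subspace_add)
    next
      fix c :: real and s assume "s \<in> ?T"
      then obtain v where "s = (\<Sum>l<n. ins \<mu> (v l) (e l))" "\<forall>l<n. v l \<in> N" by blast
      then show "c *\<^sub>R s \<in> ?T"
        using N by (auto intro!: exI[of _ "\<lambda>l. c *\<^sub>R v l"] simp: ins_simps scaleR_sum_right subspace_scale)
    qed
    fix Z
    define z where "z l = contract \<mu> Z (e l)" for l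
    define q where "q l = z l - (\<Sum>j<n. inner (z l) (U \<mu> j) *\<^sub>R U \<mu> j)" for l
    define P where "P = (\<Sum>l<n. ins \<mu> (q l) (e l))"
    have qN: "q l \<in> N" for l
      using inner_orthonormal_sum(2)[OF u] by (simp add: N_def q_def inner_diff_right inner_commute)
    have "inner (Z - P) s = 0" if "s \<in> ?T" for s
    proof -
      obtain w where w: "\<And>l. l < n \<Longrightarrow> w l \<in> N" "s = (\<Sum>l<n. ins \<mu> (w l) (e l))" using \<open>s \<in> ?T\<close> by blast
      have "inner (Z - P) (ins \<mu> (w l) (e l)) = 0" if l: "l < n" for l
      proof -
        have "inner P (ins \<mu> (w l) (e l)) = (\<Sum>k<n. if k = l then inner (q l) (w l) else 0)"
          unfolding P_def inner_sum_left
          by (intro sum.cong refl) (use l in \<open>auto simp: inner_ins_ins er orthonormalD[OF e(1)]\<close>)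
        moreover have "inner Z (ins \<mu> (w l) (e l)) = inner (z l) (w l)"
          using inner_contract[OF er[OF l], of "w l" Z] by (simp add: z_def inner_commute)
        moreover have "inner (z l - q l) (w l) = 0"
          using w(1)[OF l] by (simp add: q_def inner_sum_left N_def)
        ultimately show ?thesis using l by (simp add: inner_diff_left)
      qed
      then show ?thesis unfolding w(2) by (simp add: inner_sum_right)
    qed
    moreover have "P \<in> ?T" using qN unfolding P_def by blast
    ultimately show "\<exists>p\<in>?T. \<forall>s\<in>?T. inner (Z - p) s = 0" by blast
  qed
qed

context tucker_model
begin

lemma subspace_tangent_space_core: "C \<in> Mc \<Longrightarrow> subspace (tangent_space Mc C)"
  and tangent_space_core_tensors: "C \<in> Mc \<Longrightarrow> tangent_space Mc C \<subseteq> tensors r"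
  using subspace_tangent_space[OF submanifold _ subspace_tensors tensors_in_span] by auto

lemma has_orth_proj_tangent_space_core: "C \<in> Mc \<Longrightarrow> has_orth_proj (tangent_space Mc C)"
  using has_orth_proj_finite_dim[OF subspace_tangent_space_core order_trans[OF tangent_space_core_tensors tensors_in_span]]
  by simp

lemma tangent_space_mode_transform:
  assumes T: "\<And>\<mu>. T \<mu> \<in> carrier_mat (r \<mu>) (r \<mu>) \<and> invertible_mat (T \<mu>)" and v: "v \<in> tangent_space Mc C"
  shows "mode_transform r T v \<in> tangent_space Mc (mode_transform r T C)"
proof (rule tangent_space_bounded_linear_image[OF _ _ v])
  show "bounded_linear (mode_transform r T)"
    using bounded_linear_tucker[of r "\<lambda>\<mu>. mat_columns (T \<mu>)"] by (simp add: mode_transform_def[abs_def])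
  show "mode_transform r T ` Mc \<subseteq> Mc" using invariant T by blast
qed

text \<open>
  Any representation of the point arises from \<open>(C, U)\<close> by invertible matrices \<open>T\<close>, and its tangent
  vectors become tangent vectors of \<open>(C, U)\<close> by applying \<open>T\<close> to \<open>C'\<close> and the inverse of \<open>T\<close> to the
  variations of the factors.
\<close>

lemma tangent_space_eq:
  assumes C: "C \<in> Mc" and U: "orthonormal_frames r U"
  shows "tucker_tangent_space r Mc (tucker r C U) =
    {tucker r C' U + (\<Sum>\<mu>\<in>UNIV. t \<mu>) | C' t. C' \<in> tangent_space Mc C \<and> (\<forall>\<mu>. t \<mu> \<in> mode_tangent r C U \<mu>)}"
    (is "_ = ?R")
proof (intro equalityI subsetI)
  fix t assume "t \<in> tucker_tangent_space r Mc (tucker r C U)"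
  then obtain C1 U1 C1' U1' where
    t: "t = tucker r C1' U1 + (\<Sum>\<mu>\<in>UNIV. tucker r C1 (U1(\<mu> := U1' \<mu>)))"
    and eq: "tucker r C U = tucker r C1 U1" and C1: "C1 \<in> Mc" and ind: "\<And>\<mu>. linear_indep (r \<mu>) (U1 \<mu>)"
    and C1': "C1' \<in> tangent_space Mc C1"
    and U1': "\<And>\<mu> j k. j < r \<mu> \<Longrightarrow> k < r \<mu> \<Longrightarrow> inner (U1 \<mu> j) (U1' \<mu> k) = 0"
    unfolding tucker_tangent_space_def invertible_gram_iff by blast
  obtain T where T: "\<And>\<mu>. T \<mu> \<in> carrier_mat (r \<mu>) (r \<mu>) \<and> invertible_mat (T \<mu>)"
    and UT: "\<And>\<mu> k. k < r \<mu> \<Longrightarrow> U1 \<mu> k = (\<Sum>l<r \<mu>. T \<mu> $$ (l, k) *\<^sub>R U \<mu> l)"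
    and CT: "C = mode_transform r T C1"
    using representation_core(2)[OF C1 ind U Mc_tensors[OF C] eq] by blast
  have "\<forall>\<mu>. \<exists>S. \<forall>m k. m < r \<mu> \<longrightarrow> k < r \<mu> \<longrightarrow> (\<Sum>l<r \<mu>. S $$ (m, l) * T \<mu> $$ (l, k)) = (if m = k then 1 else 0)"
  proof
    fix \<mu>
    have T\<mu>: "T \<mu> \<in> carrier_mat (r \<mu>) (r \<mu>)" "invertible_mat (T \<mu>)" using T by auto
    show "\<exists>S. \<forall>m k. m < r \<mu> \<longrightarrow> k < r \<mu> \<longrightarrow> (\<Sum>l<r \<mu>. S $$ (m, l) * T \<mu> $$ (l, k)) = (if m = k then 1 else 0)"
      by (rule invertible_mat_imp_inverse[OF T\<mu>]) blast
  qed
  then obtain S where S: "\<And>\<mu> m k. m < r \<mu> \<Longrightarrow> k < r \<mu> \<Longrightarrow> (\<Sum>l<r \<mu>. S \<mu> $$ (m, l) * T \<mu> $$ (l, k)) = (if m = k then 1 else 0)"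
    by metis
  define W where "W \<mu> l = (\<Sum>m<r \<mu>. S \<mu> $$ (m, l) *\<^sub>R U1' \<mu> m)" for \<mu> l
  have WT: "U1' \<mu> k = (\<Sum>l<r \<mu>. T \<mu> $$ (l, k) *\<^sub>R W \<mu> l)" if k: "k < r \<mu>" for \<mu> k
  proof -
    have "(\<Sum>l<r \<mu>. T \<mu> $$ (l, k) *\<^sub>R W \<mu> l) = (\<Sum>l<r \<mu>. \<Sum>m<r \<mu>. (S \<mu> $$ (m, l) * T \<mu> $$ (l, k)) *\<^sub>R U1' \<mu> m)"
      unfolding W_def scaleR_sum_right by (intro sum.cong refl) (simp add: mult.commute)
    also have "\<dots> = (\<Sum>m<r \<mu>. (\<Sum>l<r \<mu>. S \<mu> $$ (m, l) * T \<mu> $$ (l, k)) *\<^sub>R U1' \<mu> m)"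
      unfolding scaleR_sum_left by (rule sum.swap)
    also have "\<dots> = (\<Sum>m<r \<mu>. if m = k then U1' \<mu> k else 0)"
      by (intro sum.cong refl) (simp add: S k)
    finally show ?thesis using k by simp
  qed
  have WU: "inner (U \<mu> j) (W \<mu> k) = 0" if "j < r \<mu>" "k < r \<mu>" for \<mu> j k
  proof -
    have "U \<mu> j \<in> span (U1 \<mu> ` {..<r \<mu>})"
      unfolding representation_span[OF C1 ind U eq, symmetric] using that(1) by (intro span_base) blast
    moreover have "inner (W \<mu> k) (U1 \<mu> i) = 0" if "i < r \<mu>" for i
      unfolding W_def inner_sum_left using U1'[OF that] by (intro sum.neutral) (simp add: inner_commute)
    ultimately show ?thesis using inner_span_family_eq_0[of "U \<mu> j" "U1 \<mu>" "r \<mu>" "W \<mu> k"] by (simp add: inner_commute)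
  qed
  have "tucker r C1' U1 = tucker r (mode_transform r T C1') U"
    using T UT by (intro tucker_mode_transform) auto
  moreover have "tucker r C1 (U1(\<mu> := U1' \<mu>)) = tucker r C (U(\<mu> := W \<mu>))" for \<mu>
    unfolding CT using T UT WT by (intro tucker_mode_transform) auto
  ultimately have "t = tucker r (mode_transform r T C1') U + (\<Sum>\<mu>\<in>UNIV. tucker r C (U(\<mu> := W \<mu>)))"
    unfolding t by simp
  moreover have "mode_transform r T C1' \<in> tangent_space Mc C"
    unfolding CT by (rule tangent_space_mode_transform[OF T C1'])
  moreover have "tucker r C (U(\<mu> := W \<mu>)) \<in> mode_tangent r C U \<mu>" for \<mu>
    unfolding mode_tangent_def using WU by blast
  ultimately show "t \<in> ?R" by blast
next
  fix x assume "x \<in> ?R"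
  then obtain C' t where x: "x = tucker r C' U + (\<Sum>\<mu>\<in>UNIV. t \<mu>)" and C': "C' \<in> tangent_space Mc C"
    and t: "\<And>\<mu>. t \<mu> \<in> mode_tangent r C U \<mu>" by blast
  have "\<forall>\<mu>. \<exists>W. t \<mu> = tucker r C (U(\<mu> := W)) \<and> (\<forall>j<r \<mu>. \<forall>k<r \<mu>. inner (U \<mu> j) (W k) = 0)"
    using t unfolding mode_tangent_def by blast
  then obtain W where W: "\<And>\<mu>. t \<mu> = tucker r C (U(\<mu> := W \<mu>))" "\<And>\<mu>. \<forall>j<r \<mu>. \<forall>k<r \<mu>. inner (U \<mu> j) (W \<mu> k) = 0"
    by metis
  have "\<And>\<mu>. linear_indep (r \<mu>) (U \<mu>)" using U by (auto simp: orthonormal_frames_def linear_indep_orthonormal)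
  then show "x \<in> tucker_tangent_space r Mc (tucker r C U)"
    unfolding tucker_tangent_space_def invertible_gram_iff x W(1) mem_Collect_eq
    using C C' W(2) by (intro exI[of _ C] exI[of _ U] exI[of _ C'] exI[of _ W] conjI allI refl) auto
qed

definition tangent_part :: "('d \<Rightarrow> nat) ell2 \<Rightarrow> ('d \<Rightarrow> nat \<Rightarrow> nat ell2) \<Rightarrow> 'd option \<Rightarrow> ('d \<Rightarrow> nat) ell2 set"
  where "tangent_part C U i =
    (case i of None \<Rightarrow> (\<lambda>C'. tucker r C' U) ` tangent_space Mc C | Some \<mu> \<Rightarrow> mode_tangent r C U \<mu>)"

lemma tangent_space_eq_parts:
  assumes C: "C \<in> Mc" and U: "orthonormal_frames r U"
  shows "tucker_tangent_space r Mc (tucker r C U) = {\<Sum>i\<in>UNIV. t i | t. \<forall>i\<in>UNIV. t i \<in> tangent_part C U i}"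
  unfolding tangent_space_eq[OF assms]
proof (intro equalityI subsetI)
  fix x assume "x \<in> {tucker r C' U + (\<Sum>\<mu>\<in>UNIV. t \<mu>) | C' t. C' \<in> tangent_space Mc C \<and> (\<forall>\<mu>. t \<mu> \<in> mode_tangent r C U \<mu>)}"
  then obtain C' t where x: "x = tucker r C' U + (\<Sum>\<mu>\<in>UNIV. t \<mu>)" "C' \<in> tangent_space Mc C"
    "\<And>\<mu>. t \<mu> \<in> mode_tangent r C U \<mu>" by blast
  define s where "s i = (case i of None \<Rightarrow> tucker r C' U | Some \<mu> \<Rightarrow> t \<mu>)" for i
  have "x = (\<Sum>i\<in>UNIV. s i)" unfolding sum_UNIV_option x(1) by (simp add: s_def)
  moreover have "\<forall>i\<in>UNIV. s i \<in> tangent_part C U i"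
    using x(2,3) by (auto simp: s_def tangent_part_def split: option.split)
  ultimately show "x \<in> {\<Sum>i\<in>UNIV. t i | t. \<forall>i\<in>UNIV. t i \<in> tangent_part C U i}" by blast
next
  fix x assume "x \<in> {\<Sum>i\<in>UNIV. t i | t. \<forall>i\<in>UNIV. t i \<in> tangent_part C U i}"
  then obtain t where x: "x = (\<Sum>i\<in>UNIV. t i)" and t: "\<And>i. t i \<in> tangent_part C U i" by blast
  obtain C' where "C' \<in> tangent_space Mc C" "t None = tucker r C' U"
    using t[of None] by (auto simp: tangent_part_def)
  moreover have "t (Some \<mu>) \<in> mode_tangent r C U \<mu>" for \<mu> using t[of "Some \<mu>"] by (simp add: tangent_part_def)
  ultimately show "x \<in> {tucker r C' U + (\<Sum>\<mu>\<in>UNIV. t \<mu>) | C' t. C' \<in> tangent_space Mc C \<and> (\<forall>\<mu>. t \<mu> \<in> mode_tangent r C U \<mu>)}"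
    unfolding x sum_UNIV_option mem_Collect_eq
    by (intro exI[of _ C'] exI[of _ "\<lambda>\<mu>. t (Some \<mu>)"]) auto
qed

lemma tangent_part_orthogonal:
  assumes U: "orthonormal_frames r U" and ij: "i \<noteq> j" and s: "s \<in> tangent_part C U i" and t: "t \<in> tangent_part C U j"
  shows "inner s t = 0"
proof -
  have 1: "inner (tucker r C' U) t = 0" if "t \<in> mode_tangent r C U \<mu>" for C' t \<mu>
    using that unfolding mode_tangent_def by (auto intro!: inner_tucker_orthogonal_mode[of r \<mu>])
  have 2: "inner s t = 0" if st: "s \<in> mode_tangent r C U \<mu>" "t \<in> mode_tangent r C U \<nu>" and ne: "\<mu> \<noteq> \<nu>" for s t \<mu> \<nu>
  proof -
    obtain W W' where W: "s = tucker r C (U(\<mu> := W))" "\<forall>j<r \<mu>. \<forall>k<r \<mu>. inner (U \<mu> j) (W k) = 0"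
      "t = tucker r C (U(\<nu> := W'))" using st unfolding mode_tangent_def by blast
    show ?thesis
      unfolding W(1,3) by (rule inner_tucker_orthogonal_mode[of r \<mu>]) (use W(2) ne in \<open>auto simp: inner_commute\<close>)
  qed
  show ?thesis
  proof (cases i)
    case None
    then obtain \<mu> where "j = Some \<mu>" using ij by (cases j) auto
    then show ?thesis using s t None 1 by (auto simp: tangent_part_def)
  next
    case (Some \<mu>)
    show ?thesis
    proof (cases j)
      case None
      then show ?thesis using s t Some 1 by (auto simp: tangent_part_def inner_commute[of s])
    next
      case (Some \<nu>)
      then show ?thesis using s t \<open>i = Some \<mu>\<close> ij 2 by (auto simp: tangent_part_def)
    qed
  qed
qed

lemma has_orth_proj_tangent_part:
  assumes C: "C \<in> Mc" and U: "orthonormal_frames r U"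
  shows "has_orth_proj (tangent_part C U i)"
proof (cases i)
  case None
  have lin: "linear (\<lambda>C'. tucker r C' U)" using bounded_linear_tucker by (rule bounded_linear.linear)
  have "(\<lambda>C'. tucker r C' U) ` tangent_space Mc C \<subseteq> (\<lambda>C'. tucker r C' U) ` span (ell2_unit ` index_box r)"
    using tangent_space_core_tensors[OF C] tensors_in_span by blast
  also have "\<dots> = span ((\<lambda>C'. tucker r C' U) ` ell2_unit ` index_box r)"
    by (rule linear_span_image[OF lin, symmetric])
  finally have "has_orth_proj ((\<lambda>C'. tucker r C' U) ` tangent_space Mc C)"
    by (intro has_orth_proj_finite_dim linear_subspace_image[OF lin] subspace_tangent_space_core[OF C]) auto
  then show ?thesis by (simp add: None tangent_part_def)
next
  case (Some \<mu>)
  then show ?thesis using has_orth_proj_mode_tangent[OF U Mc_full_rank[OF C]] by (simp add: tangent_part_def)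
qed

lemma has_orth_proj_tangent_space:
  assumes C: "C \<in> Mc" and U: "orthonormal_frames r U"
  shows "has_orth_proj (tucker_tangent_space r Mc (tucker r C U))"
  unfolding tangent_space_eq_parts[OF assms]
  by (rule has_orth_proj_orthogonal_sum) (auto intro: has_orth_proj_tangent_part[OF assms] tangent_part_orthogonal[OF U])

text \<open>
  The factors are the principal vectors of the column spaces of \<open>X\<close> and \<open>Y\<close>, i.e. the singular
  vectors of the inner product between the two spaces.
\<close>

lemma principal_representations:
  assumes X: "X \<in> tucker_manifold r Mc" and Y: "Y \<in> tucker_manifold r Mc"
  shows "\<exists>C U D V s. C \<in> Mc \<and> D \<in> Mc \<and> orthonormal_frames r U \<and> orthonormal_frames r V \<and>
    X = tucker r C U \<and> Y = tucker r D V \<and>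
    (\<forall>\<mu>. \<forall>j<r \<mu>. \<forall>k<r \<mu>. inner (U \<mu> j) (V \<mu> k) = (if j = k then s \<mu> j else 0)) \<and>
    (\<forall>\<mu>. \<forall>j<r \<mu>. 0 \<le> s \<mu> j)"
proof -
  obtain C0 U0 where C0: "C0 \<in> Mc" "orthonormal_frames r U0" "X = tucker r C0 U0"
    using X unfolding mem_tucker_manifold_iff by blast
  obtain D0 V0 where D0: "D0 \<in> Mc" "orthonormal_frames r V0" "Y = tucker r D0 V0"
    using Y unfolding mem_tucker_manifold_iff by blast
  have bil: "bilinear (inner :: nat ell2 \<Rightarrow> _)"
    unfolding bilinear_def by (auto intro: bounded_linear.linear bounded_linear_inner_left bounded_linear_inner_right)
  have cont: "continuous_on UNIV (\<lambda>(x :: nat ell2, y). inner x y)"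
    unfolding case_prod_beta by (intro continuous_intros)
  have "\<exists>u v s. orthonormal (r \<mu>) u \<and> orthonormal (r \<mu>) v \<and>
    span (u ` {..<r \<mu>}) = span (U0 \<mu> ` {..<r \<mu>}) \<and> span (v ` {..<r \<mu>}) = span (V0 \<mu> ` {..<r \<mu>}) \<and>
    (\<forall>i<r \<mu>. \<forall>j<r \<mu>. inner (u i) (v j) = (if i = j then s i else 0)) \<and> (\<forall>i<r \<mu>. 0 \<le> s i)" for \<mu>
    using singular_value_decomposition[OF bil cont, of "r \<mu>" "U0 \<mu>" "V0 \<mu>"] C0(2) D0(2)
    unfolding orthonormal_frames_def by blast
  then obtain U V s where UV: "\<And>\<mu>. orthonormal (r \<mu>) (U \<mu>)" "\<And>\<mu>. orthonormal (r \<mu>) (V \<mu>)"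
    and sp: "\<And>\<mu>. span (U \<mu> ` {..<r \<mu>}) = span (U0 \<mu> ` {..<r \<mu>})" "\<And>\<mu>. span (V \<mu> ` {..<r \<mu>}) = span (V0 \<mu> ` {..<r \<mu>})"
    and s: "\<And>\<mu>. \<forall>i<r \<mu>. \<forall>j<r \<mu>. inner (U \<mu> i) (V \<mu> j) = (if i = j then s \<mu> i else 0)" "\<And>\<mu>. \<forall>i<r \<mu>. 0 \<le> s \<mu> i"
    by metis
  have U: "orthonormal_frames r U" and V: "orthonormal_frames r V" using UV by (auto simp: orthonormal_frames_def)
  have ind: "\<And>\<mu>. linear_indep (r \<mu>) (U0 \<mu>)" "\<And>\<mu>. linear_indep (r \<mu>) (V0 \<mu>)"
    using C0(2) D0(2) by (auto simp: orthonormal_frames_def linear_indep_orthonormal)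
  obtain C where "C \<in> Mc" "X = tucker r C U"
    using orthonormalise_representation[OF C0(1) ind(1) U sp(1)] C0(3) by metis
  moreover obtain D where "D \<in> Mc" "Y = tucker r D V"
    using orthonormalise_representation[OF D0(1) ind(2) V sp(2)] D0(3) by metis
  ultimately show ?thesis using U V s by blast
qed

end

section \<open>Comparison of two points in principal bases\<close>

definition lower_bound :: "nat \<Rightarrow> (nat \<Rightarrow> 'a::real_normed_vector) \<Rightarrow> real \<Rightarrow> bool"
  where "lower_bound n a \<rho> \<longleftrightarrow> (\<forall>x. \<rho> * L2_set x {..<n} \<le> norm (\<Sum>k<n. x k *\<^sub>R a k))"

lemma L2_set_power2: "(L2_set f A)\<^sup>2 = (\<Sum>i\<in>A. (f i)\<^sup>2)"
  by (simp add: L2_set_def sum_nonneg)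

lemma lower_boundD2:
  assumes "lower_bound n a \<rho>" "0 \<le> \<rho>"
  shows "\<rho>\<^sup>2 * (\<Sum>k<n. (x k)\<^sup>2) \<le> (norm (\<Sum>k<n. x k *\<^sub>R a k))\<^sup>2"
proof -
  have "(\<rho> * L2_set x {..<n})\<^sup>2 \<le> (norm (\<Sum>k<n. x k *\<^sub>R a k))\<^sup>2"
    using assms by (intro power_mono) (auto simp: lower_bound_def)
  then show ?thesis by (simp add: power_mult_distrib L2_set_power2)
qed

lemma lower_boundI2:
  assumes "\<And>x. \<rho>\<^sup>2 * (\<Sum>k<n. (x k)\<^sup>2) \<le> (norm (\<Sum>k<n. x k *\<^sub>R a k))\<^sup>2"
  shows "lower_bound n a \<rho>"
  unfolding lower_bound_def
proof
  fix x
  have "(\<rho> * L2_set x {..<n})\<^sup>2 \<le> (norm (\<Sum>k<n. x k *\<^sub>R a k))\<^sup>2"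
    using assms[of x] by (simp add: power_mult_distrib L2_set_power2)
  then show "\<rho> * L2_set x {..<n} \<le> norm (\<Sum>k<n. x k *\<^sub>R a k)"
    by (rule power2_le_imp_le) simp
qed

lemma lower_bound_member:
  assumes "lower_bound n a \<rho>" "0 \<le> \<rho>" "k < n"
  shows "\<rho>\<^sup>2 \<le> (norm (a k))\<^sup>2"
proof -
  have "(\<Sum>i<n. (if i = k then 1 else 0::real)\<^sup>2) = 1"
    using assms(3) by (simp add: if_distrib[of "\<lambda>x. x\<^sup>2"] cong: if_cong)
  moreover have "(\<Sum>i<n. (if i = k then 1 else 0) *\<^sub>R a i) = a k"
    using assms(3) by (simp add: if_distrib[of "\<lambda>c. c *\<^sub>R _"] cong: if_cong)
  ultimately show ?thesis
    using lower_boundD2[OF assms(1,2), of "\<lambda>i. if i = k then 1 else 0"] by simp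
qed

text \<open>
  A lower bound for real combinations of the rows carries over to coefficients in \<open>\<ell>\<^sub>2\<close>: expand
  the coefficients in an orthonormal basis of their span.
\<close>

lemma lower_bound_ins:
  assumes lb: "lower_bound n a \<rho>" "0 \<le> \<rho>" and a: "\<And>k. a k \<in> rest_modes \<mu>"
  shows "\<rho> * L2_set (\<lambda>k. norm (W k)) {..<n} \<le> norm (\<Sum>k<n. ins \<mu> (W k) (a k))"
proof -
  obtain m e where e: "orthonormal m e" "span (e ` {..<m}) = span (W ` {..<n})"
    using Gram_Schmidt[of "W ` {..<n}"] by blast
  define x where "x k i = inner (W k) (e i)" for k i
  have W: "W k = (\<Sum>i<m. x k i *\<^sub>R e i)" if "k < n" for k
  proof -
    have "W k \<in> span (e ` {..<m})" unfolding e(2) using that by (intro span_base) blast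
    then show ?thesis unfolding x_def by (rule orthonormal_expand[OF e(1)])
  qed
  have "(\<Sum>k<n. ins \<mu> (W k) (a k)) = (\<Sum>k<n. ins \<mu> (\<Sum>i<m. x k i *\<^sub>R e i) (a k))"
    by (intro sum.cong refl) (simp flip: W)
  also have "\<dots> = (\<Sum>i<m. ins \<mu> (e i) (\<Sum>k<n. x k i *\<^sub>R a k))"
    by (rule sum_ins_expand_left) simp
  finally have "(norm (\<Sum>k<n. ins \<mu> (W k) (a k)))\<^sup>2 = (\<Sum>i<m. (norm (\<Sum>k<n. x k i *\<^sub>R a k))\<^sup>2)"
    using norm_sum_ins_orthonormal_left[OF e(1), of "\<lambda>i. \<Sum>k<n. x k i *\<^sub>R a k" \<mu>] a
    by (simp add: subspace_sum subspace_scale subspace_rest_modes)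
  also have "\<dots> \<ge> (\<Sum>i<m. \<rho>\<^sup>2 * (\<Sum>k<n. (x k i)\<^sup>2))"
    by (intro sum_mono lower_boundD2 lb)
  also have "(\<Sum>i<m. \<rho>\<^sup>2 * (\<Sum>k<n. (x k i)\<^sup>2)) = \<rho>\<^sup>2 * (\<Sum>k<n. \<Sum>i<m. (x k i)\<^sup>2)"
    unfolding sum_distrib_left by (rule sum.swap)
  also have "\<dots> = \<rho>\<^sup>2 * (\<Sum>k<n. (norm (W k))\<^sup>2)"
  proof -
    have "(norm (W k))\<^sup>2 = (\<Sum>i<m. (x k i)\<^sup>2)" if "k < n" for k
      using norm_orthonormal_sum[OF e(1), of "x k"] W[OF that] by simp
    then show ?thesis by simp
  qed
  finally have "(\<rho> * L2_set (\<lambda>k. norm (W k)) {..<n})\<^sup>2 \<le> (norm (\<Sum>k<n. ins \<mu> (W k) (a k)))\<^sup>2"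
    by (simp add: power_mult_distrib L2_set_power2)
  then show ?thesis by (rule power2_le_imp_le) simp
qed

lemma norm_sum_ins_le:
  assumes "\<And>k. c k \<in> rest_modes \<mu>"
  shows "norm (\<Sum>k<n::nat. ins \<mu> (W k) (c k)) \<le> L2_set (\<lambda>k. norm (W k)) {..<n} * L2_set (\<lambda>k. norm (c k)) {..<n}"
proof -
  have "norm (\<Sum>k<n. ins \<mu> (W k) (c k)) \<le> (\<Sum>k<n. \<bar>norm (W k)\<bar> * \<bar>norm (c k)\<bar>)"
    using norm_sum[of "\<lambda>k. ins \<mu> (W k) (c k)" "{..<n}"] by (simp add: norm_ins assms)
  also have "\<dots> \<le> L2_set (\<lambda>k. norm (W k)) {..<n} * L2_set (\<lambda>k. norm (c k)) {..<n}"
    by (rule L2_set_mult_ineq)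
  finally show ?thesis .
qed

lemma norm_diff_power2: "(norm (x - y))\<^sup>2 = inner x x + inner y y - 2 * inner x (y :: 'a::real_inner)"
  unfolding power2_norm_eq_inner by (simp add: inner_diff_left inner_diff_right inner_commute[of y x])

lemma one_minus_prod_le:
  fixes s :: "'b \<Rightarrow> real"
  assumes "finite A" "\<And>x. x \<in> A \<Longrightarrow> 0 \<le> s x \<and> s x \<le> 1"
  shows "1 - (\<Prod>x\<in>A. s x) \<le> (\<Sum>x\<in>A. 1 - s x)"
  using assms
proof (induction A)
  case (insert y A)
  have p: "0 \<le> prod s A" "prod s A \<le> 1" using insert.prems by (auto intro: prod_nonneg prod_le_1)
  have "0 \<le> s y" "s y \<le> 1" using insert.prems by auto
  then have "(1 - s y) * prod s A \<le> 1 - s y" using p by (simp add: mult_left_le)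
  then have "1 - s y * prod s A \<le> (1 - s y) + (1 - prod s A)" by (simp add: algebra_simps)
  also have "\<dots> \<le> (1 - s y) + (\<Sum>x\<in>A. 1 - s x)" using insert by simp
  finally show ?case using insert.hyps by simp
qed simp

text \<open>
  Two points of the manifold in principal bases; \<open>s \<mu> k\<close> is the cosine of the \<open>k\<close>-th principal
  angle between the column spaces in mode \<open>\<mu>\<close>.
\<close>

locale principal_pair = tucker_model r Mc
  for r :: "'d::finite \<Rightarrow> nat" and Mc +
  fixes C :: "('d \<Rightarrow> nat) ell2" and U :: "'d \<Rightarrow> nat \<Rightarrow> nat ell2"
    and D :: "('d \<Rightarrow> nat) ell2" and V :: "'d \<Rightarrow> nat \<Rightarrow> nat ell2" and s :: "'d \<Rightarrow> nat \<Rightarrow> real"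
  assumes C: "C \<in> Mc" and D: "D \<in> Mc" and U: "orthonormal_frames r U" and V: "orthonormal_frames r V"
    and UV: "\<And>\<mu> j k. j < r \<mu> \<Longrightarrow> k < r \<mu> \<Longrightarrow> inner (U \<mu> j) (V \<mu> k) = (if j = k then s \<mu> k else 0)"
    and s_nonneg: "\<And>\<mu> k. k < r \<mu> \<Longrightarrow> 0 \<le> s \<mu> k"
begin

abbreviation X where "X \<equiv> tucker r C U"
abbreviation Y where "Y \<equiv> tucker r D V"
abbreviation a where "a \<mu> \<equiv> mode_rows r C U \<mu>"
abbreviation b where "b \<mu> \<equiv> mode_rows r D V \<mu>"

lemma s_le_1: "k < r \<mu> \<Longrightarrow> s \<mu> k \<le> 1"
  using norm_cauchy_schwarz[of "U \<mu> k" "V \<mu> k"] UV[of k \<mu> k] U V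
    orthonormal_norm[of "r \<mu>" "U \<mu>" k] orthonormal_norm[of "r \<mu>" "V \<mu>" k]
  by (simp add: orthonormal_frames_def)

lemma swap: "principal_pair r Mc D V C U s"
  by unfold_locales (use C D U V UV s_nonneg in \<open>auto simp: inner_commute\<close>)

lemma UU: "j < r \<mu> \<Longrightarrow> k < r \<mu> \<Longrightarrow> inner (U \<mu> j) (U \<mu> k) = (if j = k then 1 else 0)"
  and VV: "j < r \<mu> \<Longrightarrow> k < r \<mu> \<Longrightarrow> inner (V \<mu> j) (V \<mu> k) = (if j = k then 1 else 0)"
  and VU: "j < r \<mu> \<Longrightarrow> k < r \<mu> \<Longrightarrow> inner (V \<mu> j) (U \<mu> k) = (if j = k then s \<mu> k else 0)"
  using orthonormal_framesD[OF U] orthonormal_framesD[OF V] UV[of k \<mu> j] by (auto simp: inner_commute)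

text \<open>
  In principal bases \<open>\<parallel>X - Y\<parallel>\<^sup>2\<close> is the sum of the \<open>C\<^sub>j\<^sup>2 + D\<^sub>j\<^sup>2 - 2 C\<^sub>j D\<^sub>j S\<^sub>j\<close> with the products
  \<open>S\<^sub>j\<close> of the cosines, which lie between \<open>0\<close> and \<open>1\<close>. The factor \<open>sqrt 2\<close> comes from
  \<open>2 (C\<^sub>j\<^sup>2 + D\<^sub>j\<^sup>2 - 2 C\<^sub>j D\<^sub>j S\<^sub>j) - (C\<^sub>j - D\<^sub>j)\<^sup>2 = (1 - S\<^sub>j) (C\<^sub>j + D\<^sub>j)\<^sup>2 + S\<^sub>j (C\<^sub>j - D\<^sub>j)\<^sup>2\<close>.
\<close>

lemma norm_core_diff_le: "norm (C - D) \<le> sqrt 2 * norm (X - Y)"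
proof -
  note t = Mc_tensors[OF C] Mc_tensors[OF D]
  define S where "S j = (\<Prod>\<mu>\<in>UNIV. s \<mu> (j \<mu>))" for j
  have S: "0 \<le> S j" "S j \<le> 1" if "j \<in> index_box r" for j
    unfolding S_def using s_nonneg s_le_1 index_boxD[OF that] by (auto intro!: prod_nonneg prod_le_1)
  have XY: "inner X Y = (\<Sum>j\<in>index_box r. coord C j * coord D j * S j)"
    unfolding S_def by (rule inner_tucker_diagonal) (rule UV)
  have CC: "inner X X = (\<Sum>j\<in>index_box r. (coord C j)\<^sup>2)" "inner Y Y = (\<Sum>j\<in>index_box r. (coord D j)\<^sup>2)"
    unfolding inner_tucker_orthonormal[OF U t(1)] inner_tucker_orthonormal[OF V t(2)]
    by (simp_all add: inner_tensors t power2_eq_square)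
  have CD: "C - D \<in> tensors r" using t by (rule subspace_diff[OF subspace_tensors])
  have summand: "(x - y)\<^sup>2 \<le> 2 * (x\<^sup>2 + y\<^sup>2 - 2 * (x * y * \<sigma>))" if "0 \<le> \<sigma>" "\<sigma> \<le> 1" for x y \<sigma> :: real
  proof -
    have "2 * (x\<^sup>2 + y\<^sup>2 - 2 * (x * y * \<sigma>)) - (x - y)\<^sup>2 = (1 - \<sigma>) * (x + y)\<^sup>2 + \<sigma> * (x - y)\<^sup>2"
      by (simp add: power2_eq_square algebra_simps)
    moreover have "\<dots> \<ge> 0" using that by simp
    ultimately show ?thesis by linarith
  qed
  have "(norm (C - D))\<^sup>2 = (\<Sum>j\<in>index_box r. (coord C j - coord D j)\<^sup>2)"
    unfolding norm2_tensors[OF CD] by simp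
  also have "\<dots> \<le> (\<Sum>j\<in>index_box r. 2 * ((coord C j)\<^sup>2 + (coord D j)\<^sup>2 - 2 * (coord C j * coord D j * S j)))"
    by (intro sum_mono summand S)
  also have "\<dots> = 2 * (inner X X + inner Y Y - 2 * inner X Y)"
    unfolding XY CC sum_distrib_left sum.distrib[symmetric] sum_subtractf[symmetric] ..
  also have "\<dots> = 2 * (norm (X - Y))\<^sup>2"
    unfolding norm_diff_power2 ..
  also have "\<dots> = (sqrt 2 * norm (X - Y))\<^sup>2" by (simp add: power_mult_distrib)
  finally show ?thesis by (rule power2_le_imp_le) simp
qed

text \<open>
  In principal bases the difference acts diagonally: \<open>\<parallel>tucker r E U - tucker r E V\<parallel>\<^sup>2\<close> is the sum of
  the \<open>2 (1 - S\<^sub>j) E\<^sub>j\<^sup>2\<close>, where \<open>1 - S\<^sub>j\<close> is at most the sum of the \<open>1 - s \<mu> (j \<mu>) \<le> 1 - (s \<mu> (j \<mu>))\<^sup>2\<close>.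
\<close>

lemma norm_frame_diff_le:
  assumes E: "E \<in> tensors r" and \<epsilon>: "\<And>\<mu>. 0 \<le> \<epsilon> \<mu>" "\<And>\<mu> k. k < r \<mu> \<Longrightarrow> 1 - (s \<mu> k)\<^sup>2 \<le> (\<epsilon> \<mu>)\<^sup>2"
  shows "norm (tucker r E U - tucker r E V) \<le> sqrt 2 * (\<Sum>\<mu>\<in>UNIV. \<epsilon> \<mu>) * norm E"
proof -
  define S where "S j = (\<Prod>\<mu>\<in>UNIV. s \<mu> (j \<mu>))" for j
  have S: "1 - S j \<le> (\<Sum>\<mu>\<in>UNIV. \<epsilon> \<mu>)\<^sup>2" if j: "j \<in> index_box r" for j
  proof -
    have "1 - S j \<le> (\<Sum>\<mu>\<in>UNIV. 1 - s \<mu> (j \<mu>))"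
      unfolding S_def using s_nonneg s_le_1 index_boxD[OF j] by (intro one_minus_prod_le) auto
    also have "\<dots> \<le> (\<Sum>\<mu>\<in>UNIV. (\<epsilon> \<mu>)\<^sup>2)"
    proof (rule sum_mono)
      fix \<mu>
      have k: "j \<mu> < r \<mu>" using index_boxD[OF j] .
      have "(s \<mu> (j \<mu>))\<^sup>2 \<le> s \<mu> (j \<mu>)"
        using s_nonneg[OF k] s_le_1[OF k] by (simp add: power2_eq_square mult_left_le)
      then show "1 - s \<mu> (j \<mu>) \<le> (\<epsilon> \<mu>)\<^sup>2" using \<epsilon>(2)[OF k] by linarith
    qed
    also have "\<dots> = (L2_set \<epsilon> UNIV)\<^sup>2" by (rule L2_set_power2[symmetric])
    also have "\<dots> \<le> (\<Sum>\<mu>\<in>UNIV. \<epsilon> \<mu>)\<^sup>2"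
      using \<epsilon>(1) by (intro power_mono L2_set_le_sum) auto
    finally show ?thesis .
  qed
  have "inner (tucker r E U) (tucker r E V) = (\<Sum>j\<in>index_box r. coord E j * coord E j * S j)"
    unfolding S_def by (rule inner_tucker_diagonal) (rule UV)
  moreover have "inner (tucker r E U) (tucker r E U) = (\<Sum>j\<in>index_box r. coord E j * coord E j)"
    "inner (tucker r E V) (tucker r E V) = (\<Sum>j\<in>index_box r. coord E j * coord E j)"
    unfolding inner_tucker_orthonormal[OF U E] inner_tucker_orthonormal[OF V E] by (simp_all add: inner_tensors E)
  ultimately have "(norm (tucker r E U - tucker r E V))\<^sup>2 = (\<Sum>j\<in>index_box r. coord E j * coord E j)
      + (\<Sum>j\<in>index_box r. coord E j * coord E j) - 2 * (\<Sum>j\<in>index_box r. coord E j * coord E j * S j)"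
    by (simp only: norm_diff_power2)
  also have "\<dots> = (\<Sum>j\<in>index_box r. 2 * (1 - S j) * (coord E j)\<^sup>2)"
    unfolding sum_distrib_left sum.distrib[symmetric] sum_subtractf[symmetric]
    by (intro sum.cong refl) (simp add: power2_eq_square algebra_simps)
  also have "\<dots> \<le> (\<Sum>j\<in>index_box r. 2 * (\<Sum>\<mu>\<in>UNIV. \<epsilon> \<mu>)\<^sup>2 * (coord E j)\<^sup>2)"
    by (intro sum_mono mult_right_mono mult_left_mono S) auto
  also have "\<dots> = 2 * (\<Sum>\<mu>\<in>UNIV. \<epsilon> \<mu>)\<^sup>2 * (norm E)\<^sup>2"
    unfolding norm2_tensors[OF E] by (simp add: sum_distrib_left)
  also have "\<dots> = (sqrt 2 * (\<Sum>\<mu>\<in>UNIV. \<epsilon> \<mu>) * norm E)\<^sup>2" by (simp add: power_mult_distrib)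
  finally show ?thesis by (rule power2_le_imp_le) (simp add: sum_nonneg \<epsilon>(1))
qed

text \<open>
  Projecting mode \<open>\<mu>\<close> of \<open>X\<close> onto the complement of the column space of \<open>Y\<close> leaves a tensor \<open>G\<close> with
  \<open>\<parallel>G\<parallel>\<^sup>2 = \<langle>G, X\<rangle> = \<langle>G, X - Y\<rangle>\<close>, hence \<open>\<parallel>G\<parallel> \<le> \<parallel>X - Y\<parallel>\<close>, while \<open>\<parallel>G\<parallel>\<^sup>2\<close> is the sum of the
  \<open>(1 - s\<^sub>k\<^sup>2) \<parallel>a\<^sub>k\<parallel>\<^sup>2\<close>.
\<close>

lemma angle_bound:
  assumes lb: "lower_bound (r \<mu>) (a \<mu>) \<rho>" "0 \<le> \<rho>" and k: "k < r \<mu>"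
  shows "(1 - (s \<mu> k)\<^sup>2) * \<rho>\<^sup>2 \<le> (norm (X - Y))\<^sup>2"
proof -
  define g where "g k = U \<mu> k - s \<mu> k *\<^sub>R V \<mu> k" for k
  define G where "G = tucker r C (U(\<mu> := g))"
  have G: "G = (\<Sum>k<r \<mu>. ins \<mu> (g k) (a \<mu> k))" unfolding G_def by (rule tucker_split_mode)
  have X: "X = (\<Sum>k<r \<mu>. ins \<mu> (U \<mu> k) (a \<mu> k))" by (rule tucker_split_mode')
  have GY: "inner G Y = 0"
    unfolding G_def by (rule inner_tucker_orthogonal_mode[of r \<mu>]) (auto simp: g_def inner_diff_left UV VV)
  have GX: "inner G X = (\<Sum>k<r \<mu>. (1 - (s \<mu> k)\<^sup>2) * inner (a \<mu> k) (a \<mu> k))"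
    unfolding G X by (rule inner_sum_ins_diagonal[OF mode_rows_rest_modes])
      (auto simp: g_def inner_diff_left UU VU power2_eq_square)
  have GG: "inner G G = (\<Sum>k<r \<mu>. (1 - (s \<mu> k)\<^sup>2) * inner (a \<mu> k) (a \<mu> k))"
    unfolding G by (rule inner_sum_ins_diagonal[OF mode_rows_rest_modes])
      (auto simp: g_def inner_diff_left inner_diff_right UU VU UV VV power2_eq_square)
  have "norm G * norm G = inner G (X - Y)"
    using GX GG GY by (simp add: inner_diff_right flip: power2_eq_square power2_norm_eq_inner)
  also have "\<dots> \<le> norm G * norm (X - Y)" by (rule norm_cauchy_schwarz)
  finally have G': "norm G \<le> norm (X - Y)" by (cases "G = 0") (auto simp: mult_le_cancel_left)
  have nn: "0 \<le> 1 - (s \<mu> i)\<^sup>2" if "i < r \<mu>" for i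
    using s_nonneg[OF that] s_le_1[OF that] by (simp add: power_le_one)
  have "(1 - (s \<mu> k)\<^sup>2) * \<rho>\<^sup>2 \<le> (1 - (s \<mu> k)\<^sup>2) * inner (a \<mu> k) (a \<mu> k)"
    using lower_bound_member[OF lb k] nn[OF k] by (simp add: power2_norm_eq_inner mult_left_mono)
  also have "\<dots> \<le> (\<Sum>k<r \<mu>. (1 - (s \<mu> k)\<^sup>2) * inner (a \<mu> k) (a \<mu> k))"
    using k nn by (intro member_le_sum) auto
  also have "\<dots> = (norm G)\<^sup>2" using GG by (simp add: power2_norm_eq_inner)
  also have "\<dots> \<le> (norm (X - Y))\<^sup>2" using G' by (rule power_mono) simp
  finally show ?thesis .
qed

text \<open>
  The \<open>a\<^sub>k - s\<^sub>k b\<^sub>k\<close> are the contractions of \<open>X - Y\<close> with the orthonormal \<open>u\<^sub>k\<close> in mode \<open>\<mu>\<close>.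
\<close>

lemma row_diff_bound:
  "L2_set (\<lambda>k. norm (a \<mu> k - s \<mu> k *\<^sub>R b \<mu> k)) {..<r \<mu>} \<le> norm (X - Y)"
proof -
  define d where "d k = a \<mu> k - s \<mu> k *\<^sub>R b \<mu> k" for k
  define G where "G = (\<Sum>k<r \<mu>. ins \<mu> (U \<mu> k) (d k))"
  have dr: "d k \<in> rest_modes \<mu>" for k
    unfolding d_def by (intro subspace_diff subspace_scale subspace_rest_modes mode_rows_rest_modes)
  have X: "X = (\<Sum>k<r \<mu>. ins \<mu> (U \<mu> k) (a \<mu> k))" and Y: "Y = (\<Sum>k<r \<mu>. ins \<mu> (V \<mu> k) (b \<mu> k))"
    by (rule tucker_split_mode')+
  have GX: "inner G X = (\<Sum>k<r \<mu>. 1 * inner (d k) (a \<mu> k))"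
    unfolding G_def X by (rule inner_sum_ins_diagonal[OF mode_rows_rest_modes]) (simp add: UU)
  have GY: "inner G Y = (\<Sum>k<r \<mu>. s \<mu> k * inner (d k) (b \<mu> k))"
    unfolding G_def Y by (rule inner_sum_ins_diagonal[OF mode_rows_rest_modes]) (simp add: UV)
  have "orthonormal (r \<mu>) (U \<mu>)" using U by (simp add: orthonormal_frames_def)
  from norm_sum_ins_orthonormal_left[OF this, of d \<mu>] have GG: "(norm G)\<^sup>2 = (\<Sum>k<r \<mu>. (norm (d k))\<^sup>2)"
    using dr by (simp add: G_def)
  have "inner G (X - Y) = (\<Sum>k<r \<mu>. inner (d k) (a \<mu> k - s \<mu> k *\<^sub>R b \<mu> k))"
    unfolding inner_diff_right GX GY by (simp add: sum_subtractf)
  also have "\<dots> = (norm G)\<^sup>2" unfolding GG d_def[symmetric] by (simp add: power2_norm_eq_inner)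
  finally have "norm G * norm G \<le> norm G * norm (X - Y)"
    using norm_cauchy_schwarz[of G "X - Y"] by (simp add: power2_eq_square)
  then have "norm G \<le> norm (X - Y)" by (cases "G = 0") (auto simp: mult_le_cancel_left)
  then have "(L2_set (\<lambda>k. norm (d k)) {..<r \<mu>})\<^sup>2 \<le> (norm (X - Y))\<^sup>2"
    unfolding L2_set_power2 GG[symmetric] by (rule power_mono) simp
  then show ?thesis unfolding d_def by (rule power2_le_imp_le) simp
qed

text \<open>
  The tangent vector \<open>\<Sum> W\<^sub>k \<otimes> a\<^sub>k\<close> is approximated by replacing \<open>a\<^sub>k\<close> with \<open>s\<^sub>k b\<^sub>k\<close> and removing from
  \<open>W\<^sub>k\<close> the column space of \<open>Y\<close>. The component of \<open>W\<^sub>k\<close> in that space is small because \<open>W\<^sub>k\<close> is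
  orthogonal to the column space of \<open>X\<close>.
\<close>

lemma mode_tangent_approx:
  assumes lb: "lower_bound (r \<mu>) (a \<mu>) \<rho>" "0 < \<rho>"
    and \<epsilon>: "0 \<le> \<epsilon>" "\<And>k. k < r \<mu> \<Longrightarrow> 1 - (s \<mu> k)\<^sup>2 \<le> \<epsilon>\<^sup>2"
    and t: "t \<in> mode_tangent r C U \<mu>"
  shows "\<exists>t'\<in>mode_tangent r D V \<mu>. norm (t - t') \<le> (\<epsilon> + norm (X - Y) / \<rho>) * norm t"
proof -
  define n where "n = r \<mu>"
  have v: "orthonormal n (V \<mu>)" using V by (simp add: orthonormal_frames_def n_def)
  obtain W where W: "t = tucker r C (U(\<mu> := W))" and WU: "\<And>j k. j < n \<Longrightarrow> k < n \<Longrightarrow> inner (U \<mu> j) (W k) = 0"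
    using t by (auto simp: mode_tangent_def n_def)
  define P where "P w = (\<Sum>j<n. inner w (V \<mu> j) *\<^sub>R V \<mu> j)" for w
  define d where "d k = a \<mu> k - s \<mu> k *\<^sub>R b \<mu> k" for k
  define W' where "W' k = s \<mu> k *\<^sub>R (W k - P (W k))" for k
  define t' where "t' = tucker r D (V(\<mu> := W'))"
  have ts: "t = (\<Sum>k<n. ins \<mu> (W k) (a \<mu> k))" unfolding W n_def by (rule tucker_split_mode)
  have t's: "t' = (\<Sum>k<n. ins \<mu> (W' k) (b \<mu> k))" unfolding t'_def n_def by (rule tucker_split_mode)
  have QV: "inner (V \<mu> j) (w - P w) = 0" if "j < n" for j w
    using inner_orthonormal_sum(2)[OF v that] by (simp add: P_def inner_diff_right inner_commute)
  have "t' \<in> mode_tangent r D V \<mu>"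
    unfolding mode_tangent_def t'_def using QV by (auto simp: W'_def n_def)
  moreover have split: "t - t' = (\<Sum>k<n. ins \<mu> (P (W k)) (a \<mu> k)) + (\<Sum>k<n. ins \<mu> (W k - P (W k)) (d k))"
    unfolding ts t's sum_subtractf[symmetric] sum.distrib[symmetric]
    by (intro sum.cong refl) (simp add: W'_def d_def ins_simps)
  have "norm (\<Sum>k<n. ins \<mu> (P (W k)) (a \<mu> k)) \<le> \<epsilon> * norm t"
  proof -
    obtain e where e: "orthonormal n e" "span (e ` {..<n}) = span (a \<mu> ` {..<n})"
      using linear_indep_orthonormal_basis[OF mode_rows_linear_indep[OF U Mc_full_rank[OF C], of \<mu>]]
      unfolding n_def by blast
    have er: "e l \<in> rest_modes \<mu>" if "l < n" for l
    proof -
      have "e l \<in> span (a \<mu> ` {..<n})" unfolding e(2)[symmetric] using that by (intro span_base) blast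
      then show ?thesis using span_mode_rows by blast
    qed
    define x where "x k l = inner (a \<mu> k) (e l)" for k l
    have ax: "a \<mu> k = (\<Sum>l<n. x k l *\<^sub>R e l)" if "k < n" for k
    proof -
      have "a \<mu> k \<in> span (e ` {..<n})" unfolding e(2) using that by (intro span_base) blast
      then show ?thesis unfolding x_def by (rule orthonormal_expand[OF e(1)])
    qed
    define w where "w l = (\<Sum>k<n. x k l *\<^sub>R W k)" for l
    have Pw: "P (w l) = (\<Sum>k<n. x k l *\<^sub>R P (W k))" for l
    proof -
      have "P (w l) = (\<Sum>j<n. \<Sum>k<n. (x k l * inner (W k) (V \<mu> j)) *\<^sub>R V \<mu> j)"
        by (simp add: P_def w_def inner_sum_left scaleR_sum_left)
      also have "\<dots> = (\<Sum>k<n. x k l *\<^sub>R P (W k))"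
        unfolding P_def scaleR_sum_right scaleR_scaleR by (rule sum.swap)
      finally show ?thesis .
    qed
    have "t = (\<Sum>k<n. ins \<mu> (W k) (\<Sum>l<n. x k l *\<^sub>R e l))"
      unfolding ts by (intro sum.cong refl) (simp flip: ax)
    also have "\<dots> = (\<Sum>l<n. ins \<mu> (w l) (e l))"
      unfolding w_def by (rule sum_ins_expand_right) simp
    finally have nt: "(norm t)\<^sup>2 = (\<Sum>l<n. (norm (w l))\<^sup>2)"
      using norm_sum_ins_orthonormal_right[OF e(1) er] by simp
    have "(\<Sum>k<n. ins \<mu> (P (W k)) (a \<mu> k)) = (\<Sum>k<n. ins \<mu> (P (W k)) (\<Sum>l<n. x k l *\<^sub>R e l))"
      by (intro sum.cong refl) (simp flip: ax)
    also have "\<dots> = (\<Sum>l<n. ins \<mu> (P (w l)) (e l))"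
      unfolding Pw by (rule sum_ins_expand_right) simp
    finally have "(norm (\<Sum>k<n. ins \<mu> (P (W k)) (a \<mu> k)))\<^sup>2 = (\<Sum>l<n. (norm (P (w l)))\<^sup>2)"
      using norm_sum_ins_orthonormal_right[OF e(1) er] by simp
    also have "\<dots> \<le> (\<Sum>l<n. \<epsilon>\<^sup>2 * (norm (w l))\<^sup>2)"
    proof (rule sum_mono)
      fix l
      have wU: "inner (w l) (U \<mu> j) = 0" if "j < n" for j
        unfolding w_def inner_sum_left using WU[OF that] by (intro sum.neutral) (simp add: inner_commute)
      have "(norm (P (w l)))\<^sup>2 = (\<Sum>j<n. (inner (w l) (V \<mu> j))\<^sup>2)"
        unfolding P_def by (rule norm_orthonormal_sum[OF v])
      also have "\<dots> = (\<Sum>j<n. (inner (w l) (V \<mu> j - s \<mu> j *\<^sub>R U \<mu> j))\<^sup>2)"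
        by (intro sum.cong refl) (simp add: inner_diff_right wU)
      also have "\<dots> \<le> \<epsilon>\<^sup>2 * (norm (w l))\<^sup>2"
      proof (rule Bessel_scaled)
        fix i j assume "i \<in> {..<n}" "j \<in> {..<n}" "i \<noteq> j"
        then show "inner (V \<mu> i - s \<mu> i *\<^sub>R U \<mu> i) (V \<mu> j - s \<mu> j *\<^sub>R U \<mu> j) = 0"
          by (simp add: n_def inner_diff_left inner_diff_right UU VV UV VU)
      next
        fix i assume "i \<in> {..<n}"
        then show "(norm (V \<mu> i - s \<mu> i *\<^sub>R U \<mu> i))\<^sup>2 \<le> \<epsilon>\<^sup>2"
          unfolding power2_norm_eq_inner using \<epsilon>(2)[of i]
          by (simp add: n_def inner_diff_left inner_diff_right UU VV UV VU power2_eq_square)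
      qed auto
      finally show "(norm (P (w l)))\<^sup>2 \<le> \<epsilon>\<^sup>2 * (norm (w l))\<^sup>2" .
    qed
    also have "\<dots> = (\<epsilon> * norm t)\<^sup>2" by (simp add: nt sum_distrib_left power_mult_distrib)
    finally show ?thesis by (rule power2_le_imp_le) (simp add: \<epsilon>(1))
  qed
  moreover have "norm (\<Sum>k<n. ins \<mu> (W k - P (W k)) (d k)) \<le> norm (X - Y) / \<rho> * norm t"
  proof -
    have dr: "d k \<in> rest_modes \<mu>" for k
      unfolding d_def by (intro subspace_diff subspace_scale subspace_rest_modes mode_rows_rest_modes)
    have QW: "norm (w - P w) \<le> norm w" for w
    proof -
      have "inner (P w) (w - P w) = 0" unfolding P_def[of w] inner_sum_left
        by (intro sum.neutral) (use QV[of _ w] in \<open>simp add: P_def\<close>)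
      then have "inner w (w - P w) = inner (w - P w) (w - P w)" by (simp add: inner_diff_left)
      then have "norm (w - P w) * norm (w - P w) \<le> norm w * norm (w - P w)"
        using norm_cauchy_schwarz[of w "w - P w"] by (simp flip: power2_eq_square power2_norm_eq_inner)
      then show ?thesis by (cases "w - P w = 0") (auto simp: mult_le_cancel_right)
    qed
    have "norm (\<Sum>k<n. ins \<mu> (W k - P (W k)) (d k))
        \<le> L2_set (\<lambda>k. norm (W k - P (W k))) {..<n} * L2_set (\<lambda>k. norm (d k)) {..<n}"
      by (rule norm_sum_ins_le[OF dr])
    also have "\<dots> \<le> L2_set (\<lambda>k. norm (W k)) {..<n} * norm (X - Y)"
      using row_diff_bound[of \<mu>] QW by (intro mult_mono L2_set_mono) (auto simp: d_def n_def)
    also have "\<dots> \<le> norm t / \<rho> * norm (X - Y)"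
    proof (rule mult_right_mono)
      show "L2_set (\<lambda>k. norm (W k)) {..<n} \<le> norm t / \<rho>"
        using lower_bound_ins[OF lb(1) _ mode_rows_rest_modes, of W] lb(2) unfolding ts n_def
        by (simp add: field_simps)
    qed simp
    finally show ?thesis by (simp add: mult.commute)
  qed
  ultimately have "norm (t - t') \<le> (\<epsilon> + norm (X - Y) / \<rho>) * norm t"
    unfolding split distrib_right by (intro order_trans[OF norm_triangle_ineq] add_mono)
  then show ?thesis using \<open>t' \<in> _\<close> by blast
qed

text \<open>
  Weyl's inequality for the smallest singular value, from \<open>s\<^sub>k b\<^sub>k = a\<^sub>k - (a\<^sub>k - s\<^sub>k b\<^sub>k)\<close>; the cosines
  do not vanish because of the strict inequality.
\<close>

lemma lower_bound_swap:
  assumes lb: "lower_bound (r \<mu>) (a \<mu>) \<rho>" and lt: "norm (X - Y) < \<rho>"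
  shows "lower_bound (r \<mu>) (b \<mu>) (\<rho> - norm (X - Y))"
  unfolding lower_bound_def
proof
  fix x
  define n where "n = r \<mu>"
  have \<rho>: "0 < \<rho>" using lt norm_ge_zero[of "X - Y"] by linarith
  have s: "0 < s \<mu> k" if k: "k < n" for k
  proof (rule ccontr)
    assume "\<not> 0 < s \<mu> k"
    then have "s \<mu> k = 0" using s_nonneg[of k \<mu>] k by (simp add: n_def)
    then have "\<rho>\<^sup>2 \<le> (norm (X - Y))\<^sup>2" using angle_bound[OF lb, of k] \<rho> k by (simp add: n_def)
    then have "\<rho> \<le> norm (X - Y)" by (rule power2_le_imp_le) simp
    then show False using lt by simp
  qed
  define y where "y k = x k / s \<mu> k" for k
  define d where "d k = a \<mu> k - s \<mu> k *\<^sub>R b \<mu> k" for k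
  have "(\<Sum>k<n. x k *\<^sub>R b \<mu> k) = (\<Sum>k<n. y k *\<^sub>R a \<mu> k - y k *\<^sub>R d k)"
    by (intro sum.cong refl) (use s in \<open>auto simp: d_def y_def scaleR_diff_right less_imp_neq[THEN not_sym]\<close>)
  then have eq: "(\<Sum>k<n. x k *\<^sub>R b \<mu> k) = (\<Sum>k<n. y k *\<^sub>R a \<mu> k) - (\<Sum>k<n. y k *\<^sub>R d k)"
    by (simp add: sum_subtractf)
  have "norm (\<Sum>k<n. y k *\<^sub>R d k) \<le> (\<Sum>k<n. \<bar>y k\<bar> * \<bar>norm (d k)\<bar>)"
    using norm_sum[of "\<lambda>k. y k *\<^sub>R d k" "{..<n}"] by simp
  also have "\<dots> \<le> L2_set y {..<n} * L2_set (\<lambda>k. norm (d k)) {..<n}" by (rule L2_set_mult_ineq)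
  also have "\<dots> \<le> L2_set y {..<n} * norm (X - Y)"
    using row_diff_bound[of \<mu>] by (intro mult_left_mono) (auto simp: d_def n_def)
  finally have 1: "norm (\<Sum>k<n. y k *\<^sub>R d k) \<le> L2_set y {..<n} * norm (X - Y)" .
  have 2: "\<rho> * L2_set y {..<n} \<le> norm (\<Sum>k<n. y k *\<^sub>R a \<mu> k)"
    using lb by (simp add: lower_bound_def n_def)
  have "L2_set x {..<n} = L2_set (\<lambda>k. \<bar>x k\<bar>) {..<n}" by (simp add: L2_set_def)
  also have "\<dots> \<le> L2_set (\<lambda>k. \<bar>y k\<bar>) {..<n}"
  proof (rule L2_set_mono)
    fix k assume "k \<in> {..<n}"
    then have "0 < s \<mu> k" "s \<mu> k \<le> 1" using s s_le_1[of k \<mu>] by (auto simp: n_def)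
    then show "\<bar>x k\<bar> \<le> \<bar>y k\<bar>" by (simp add: y_def divide_simps mult_left_le)
  qed simp
  also have "\<dots> = L2_set y {..<n}" by (simp add: L2_set_def)
  finally have 3: "L2_set x {..<n} \<le> L2_set y {..<n}" .
  have "(\<rho> - norm (X - Y)) * L2_set x {..<n} \<le> (\<rho> - norm (X - Y)) * L2_set y {..<n}"
    using 3 lt by (intro mult_left_mono) auto
  also have "\<dots> \<le> norm (\<Sum>k<n. y k *\<^sub>R a \<mu> k) - norm (\<Sum>k<n. y k *\<^sub>R d k)"
    using 1 2 by (simp add: algebra_simps)
  also have "\<dots> \<le> norm (\<Sum>k<n. x k *\<^sub>R b \<mu> k)" unfolding eq by (rule norm_triangle_ineq2)
  finally show "(\<rho> - norm (X - Y)) * L2_set x {..<r \<mu>} \<le> norm (\<Sum>k<r \<mu>. x k *\<^sub>R b \<mu> k)"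
    by (simp add: n_def)
qed

text \<open>
  The parts of \<open>t\<close> are orthogonal, so each has at most the norm of \<open>t\<close>, and each is approximated
  separately: the core part by projecting the variation of the core and exchanging the factors,
  the part of each mode by the preceding estimate.
\<close>

lemma tangent_space_approx:
  assumes lb: "\<And>\<mu>. lower_bound (r \<mu>) (a \<mu>) (\<rho> \<mu>)" "\<And>\<mu>. 0 < \<rho> \<mu>"
    and \<epsilon>: "\<And>\<mu>. 0 \<le> \<epsilon> \<mu>" "\<And>\<mu> k. k < r \<mu> \<Longrightarrow> 1 - (s \<mu> k)\<^sup>2 \<le> (\<epsilon> \<mu>)\<^sup>2"
    and \<kappa>: "\<And>Z. Z \<in> tangent_space Mc C \<Longrightarrow> norm (Z - orth_proj (tangent_space Mc D) Z) \<le> \<kappa> * norm Z" "0 \<le> \<kappa>"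
    and t: "t \<in> tucker_tangent_space r Mc X"
  shows "\<exists>t'\<in>tucker_tangent_space r Mc Y.
    norm (t - t') \<le> (\<kappa> + (\<Sum>\<mu>\<in>UNIV. (sqrt 2 + 1) * \<epsilon> \<mu> + norm (X - Y) / \<rho> \<mu>)) * norm t"
proof -
  obtain p where tp: "t = (\<Sum>i\<in>UNIV. p i)" and p: "\<And>i. p i \<in> tangent_part C U i"
    using t unfolding tangent_space_eq_parts[OF C U] by blast
  have "(norm t)\<^sup>2 = (\<Sum>i\<in>UNIV. (norm (p i))\<^sup>2)"
    unfolding tp by (rule norm_sum_orthogonal) (simp, rule tangent_part_orthogonal[OF U _ p p])
  then have "(norm (p i))\<^sup>2 \<le> (norm t)\<^sup>2" for i
    using member_le_sum[of i UNIV "\<lambda>i. (norm (p i))\<^sup>2"] by simp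
  then have le: "norm (p i) \<le> norm t" for i by (rule power2_le_imp_le) simp
  obtain C' where C': "C' \<in> tangent_space Mc C" "p None = tucker r C' U"
    using p[of None] by (auto simp: tangent_part_def)
  have C't: "C' \<in> tensors r" using C'(1) tangent_space_core_tensors[OF C] by blast
  have nC': "norm C' \<le> norm t" using le[of None] unfolding C'(2) norm_tucker_orthonormal[OF U C't] .
  define D' where "D' = orth_proj (tangent_space Mc D) C'"
  have D': "D' \<in> tangent_space Mc D"
    unfolding D'_def by (rule orth_proj_mem[OF has_orth_proj_tangent_space_core[OF D]])
  have D't: "D' \<in> tensors r" using D' tangent_space_core_tensors[OF D] by blast
  have "norm (p None - tucker r D' V) \<le> (\<kappa> + sqrt 2 * (\<Sum>\<mu>\<in>UNIV. \<epsilon> \<mu>)) * norm t"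
  proof -
    have "p None - tucker r D' V = (tucker r C' U - tucker r C' V) + tucker r (C' - D') V"
      by (simp add: C'(2) tucker_diff)
    then have "norm (p None - tucker r D' V) \<le> norm (tucker r C' U - tucker r C' V) + norm (tucker r (C' - D') V)"
      by (simp only: norm_triangle_ineq)
    also have "norm (tucker r (C' - D') V) = norm (C' - D')"
      by (rule norm_tucker_orthonormal[OF V subspace_diff[OF subspace_tensors C't D't]])
    also have "norm (C' - D') \<le> \<kappa> * norm C'" unfolding D'_def by (rule \<kappa>(1)[OF C'(1)])
    also have "norm (tucker r C' U - tucker r C' V) \<le> sqrt 2 * (\<Sum>\<mu>\<in>UNIV. \<epsilon> \<mu>) * norm C'"
      by (rule norm_frame_diff_le[OF C't \<epsilon>])
    finally have "norm (p None - tucker r D' V) \<le> (\<kappa> + sqrt 2 * (\<Sum>\<mu>\<in>UNIV. \<epsilon> \<mu>)) * norm C'"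
      by (simp add: algebra_simps)
    also have "\<dots> \<le> (\<kappa> + sqrt 2 * (\<Sum>\<mu>\<in>UNIV. \<epsilon> \<mu>)) * norm t"
      using \<kappa>(2) \<epsilon>(1) by (intro mult_left_mono nC') (simp add: sum_nonneg)
    finally show ?thesis .
  qed
  moreover have "\<exists>t'\<in>mode_tangent r D V \<mu>. norm (p (Some \<mu>) - t') \<le> (\<epsilon> \<mu> + norm (X - Y) / \<rho> \<mu>) * norm t" for \<mu>
  proof -
    have "p (Some \<mu>) \<in> mode_tangent r C U \<mu>" using p[of "Some \<mu>"] by (simp add: tangent_part_def)
    then obtain t' where t': "t' \<in> mode_tangent r D V \<mu>"
      "norm (p (Some \<mu>) - t') \<le> (\<epsilon> \<mu> + norm (X - Y) / \<rho> \<mu>) * norm (p (Some \<mu>))"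
      using mode_tangent_approx[OF lb \<epsilon>] by blast
    note t'(2)
    also have "(\<epsilon> \<mu> + norm (X - Y) / \<rho> \<mu>) * norm (p (Some \<mu>)) \<le> (\<epsilon> \<mu> + norm (X - Y) / \<rho> \<mu>) * norm t"
      using \<epsilon>(1)[of \<mu>] lb(2)[of \<mu>] by (intro mult_left_mono le) simp
    finally show ?thesis using t'(1) by blast
  qed
  then obtain q where q: "\<And>\<mu>. q \<mu> \<in> mode_tangent r D V \<mu>"
    "\<And>\<mu>. norm (p (Some \<mu>) - q \<mu>) \<le> (\<epsilon> \<mu> + norm (X - Y) / \<rho> \<mu>) * norm t" by metis
  define t' where "t' = tucker r D' V + (\<Sum>\<mu>\<in>UNIV. q \<mu>)"
  have "t' \<in> tucker_tangent_space r Mc Y"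
    unfolding tangent_space_eq[OF D V] t'_def using D' q(1) by blast
  moreover have "norm (t - t') \<le> (\<kappa> + sqrt 2 * (\<Sum>\<mu>\<in>UNIV. \<epsilon> \<mu>)) * norm t
      + (\<Sum>\<mu>\<in>UNIV. (\<epsilon> \<mu> + norm (X - Y) / \<rho> \<mu>) * norm t)"
  proof -
    have "t - t' = (p None - tucker r D' V) + (\<Sum>\<mu>\<in>UNIV. p (Some \<mu>) - q \<mu>)"
      by (simp add: tp t'_def sum_UNIV_option sum_subtractf)
    also have "norm \<dots> \<le> norm (p None - tucker r D' V) + (\<Sum>\<mu>\<in>UNIV. norm (p (Some \<mu>) - q \<mu>))"
      by (intro order_trans[OF norm_triangle_ineq] add_mono norm_sum order_refl)
    also have "\<dots> \<le> (\<kappa> + sqrt 2 * (\<Sum>\<mu>\<in>UNIV. \<epsilon> \<mu>)) * norm t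
        + (\<Sum>\<mu>\<in>UNIV. (\<epsilon> \<mu> + norm (X - Y) / \<rho> \<mu>) * norm t)"
      by (intro add_mono sum_mono q(2)) fact
    finally show ?thesis .
  qed
  moreover have "(\<kappa> + sqrt 2 * (\<Sum>\<mu>\<in>UNIV. \<epsilon> \<mu>)) * norm t + (\<Sum>\<mu>\<in>UNIV. (\<epsilon> \<mu> + norm (X - Y) / \<rho> \<mu>) * norm t)
      = (\<kappa> + (\<Sum>\<mu>\<in>UNIV. (sqrt 2 + 1) * \<epsilon> \<mu> + norm (X - Y) / \<rho> \<mu>)) * norm t"
  proof -
    have "(\<Sum>\<mu>\<in>UNIV. (sqrt 2 + 1) * \<epsilon> \<mu> + norm (X - Y) / \<rho> \<mu>)
        = sqrt 2 * (\<Sum>\<mu>\<in>UNIV. \<epsilon> \<mu>) + (\<Sum>\<mu>\<in>UNIV. \<epsilon> \<mu> + norm (X - Y) / \<rho> \<mu>)"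
      unfolding sum_distrib_left sum.distrib[symmetric] by (intro sum.cong refl) (simp add: algebra_simps)
    then show ?thesis unfolding sum_distrib_right[symmetric] by (simp add: algebra_simps)
  qed
  ultimately show ?thesis by (intro bexI[of _ t']) simp_all
qed

end

section \<open>Weak closures\<close>

lemma topspace_weak_topology: "topspace (weak_topology :: 'a::real_normed_vector topology) = UNIV"
proof -
  have "UNIV = (\<lambda>_. 0 :: real) -` UNIV" by simp
  then have "(UNIV :: 'a set) \<in> {f -` U | (f :: 'a \<Rightarrow> real) U. bounded_linear f \<and> open U}"
    using bounded_linear_zero open_UNIV by blast
  then show ?thesis unfolding weak_topology_def topology_generated_by_topspace by blast
qed

lemma openin_weak_topology_imp_open: "openin weak_topology T \<Longrightarrow> open T"
  unfolding weak_topology_def openin_topology_generated_by_iff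
proof (induction rule: generate_topology_on.induct)
  case (Basis s)
  then obtain f :: "'a \<Rightarrow> real" and U where s: "s = f -` U" and f: "bounded_linear f" and U: "open U" by blast
  show ?case unfolding s by (rule open_vimage[OF U linear_continuous_on[OF f]])
qed auto

lemma closure_subset_weak_closure: "closure M \<subseteq> weak_topology closure_of M"
proof
  fix x assume x: "x \<in> closure M"
  have "\<exists>y. y \<in> M \<and> y \<in> T" if "x \<in> T" "openin weak_topology T" for T
    using x that openin_weak_topology_imp_open[of T] by (auto simp: closure_iff_nhds_not_empty)
  then show "x \<in> weak_topology closure_of M"
    by (auto simp: in_closure_of topspace_weak_topology)
qed

lemma weak_closure_approx:
  assumes Z: "Z \<in> weak_topology closure_of M" and F: "finite F" and \<eta>: "0 < \<eta>"
  shows "\<exists>W\<in>M. \<forall>f\<in>F. \<bar>inner f W - inner f (Z :: 'a::real_inner)\<bar> < \<eta>"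
proof -
  define N where "N f = {W. \<bar>inner f W - inner f Z\<bar> < \<eta>}" for f
  have N: "openin weak_topology (N f)" for f
    unfolding weak_topology_def
  proof (rule topology_generated_by_Basis)
    have "N f = (\<lambda>W. inner f W) -` ball (inner f Z) \<eta>"
      by (auto simp: N_def dist_real_def abs_minus_commute)
    then show "N f \<in> {g -` U | (g :: 'a \<Rightarrow> real) U. bounded_linear g \<and> open U}"
      using bounded_linear_inner_right open_ball by blast
  qed
  have "openin weak_topology (\<Inter>(N ` insert 0 F))"
    using F N by (intro openin_Inter) auto
  moreover have "Z \<in> \<Inter>(N ` insert 0 F)" using \<eta> by (simp add: N_def)
  ultimately obtain W where "W \<in> M" "W \<in> \<Inter>(N ` insert 0 F)" using Z unfolding in_closure_of by blast
  then show ?thesis by (auto simp: N_def)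
qed

section \<open>The distances to the boundary\<close>

text \<open>By the preceding results the transpose is invertible, and its inverse is transposed back.\<close>

lemma invertible_mat_of_left_kernel:
  assumes A: "A \<in> carrier_mat n n"
    and K: "\<And>x j. (\<And>j. j < n \<Longrightarrow> (\<Sum>i<n. x i * A $$ (i, j)) = 0) \<Longrightarrow> j < n \<Longrightarrow> x j = 0"
  shows "invertible_mat (A :: real mat)"
proof -
  have At: "A\<^sup>T \<in> carrier_mat n n" using A by simp
  have t: "A\<^sup>T $$ (i, j) = A $$ (j, i)" if "i < n" "j < n" for i j using A that by simp
  have "invertible_mat A\<^sup>T"
    unfolding invertible_mat_iff_kernel[OF At]
  proof (intro allI impI)
    fix x :: "nat \<Rightarrow> real" and j assume x: "\<forall>i<n. (\<Sum>j<n. A\<^sup>T $$ (i, j) * x j) = 0" and j: "j < n"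
    show "x j = 0"
    proof (rule K[OF _ j])
      fix i assume i: "i < n"
      have "(\<Sum>j<n. x j * A $$ (j, i)) = (\<Sum>j<n. A\<^sup>T $$ (i, j) * x j)"
        by (intro sum.cong refl) (use i in \<open>simp add: t\<close>)
      then show "(\<Sum>j<n. x j * A $$ (j, i)) = 0" using x i by simp
    qed
  qed
  then obtain B where B: "\<And>i j. i < n \<Longrightarrow> j < n \<Longrightarrow> (\<Sum>k<n. A\<^sup>T $$ (i, k) * B $$ (k, j)) = (if i = j then 1 else 0)"
    using invertible_mat_imp_inverse[OF At] by metis
  show ?thesis
    unfolding invertible_mat_iff_kernel[OF A]
  proof (intro allI impI)
    fix x :: "nat \<Rightarrow> real" and j assume x: "\<forall>i<n. (\<Sum>j<n. A $$ (i, j) * x j) = 0" and j: "j < n"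
    have "0 = (\<Sum>k<n. B $$ (k, j) * (\<Sum>i<n. A $$ (k, i) * x i))" using x by simp
    also have "\<dots> = (\<Sum>i<n. (\<Sum>k<n. A\<^sup>T $$ (i, k) * B $$ (k, j)) * x i)"
      unfolding sum_distrib_left sum_distrib_right
      by (subst sum.swap) (intro sum.cong refl, simp add: t mult_ac)
    also have "\<dots> = (\<Sum>i<n. if i = j then x j else 0)" by (intro sum.cong refl) (simp add: B j)
    finally show "x j = 0" using j by simp
  qed
qed

lemma le_infdist:
  assumes "A \<noteq> {}" "\<And>y. y \<in> A \<Longrightarrow> e \<le> dist x y"
  shows "e \<le> infdist x A"
  unfolding infdist_notempty[OF assms(1)] using assms by (intro cINF_greatest)

lemma elem_frames_eq_tucker:
  assumes "j \<in> index_box r"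
  shows "elem (\<lambda>\<mu>. U \<mu> (j \<mu>)) = tucker r (ell2_unit j) U"
proof -
  have "tucker r (ell2_unit j) U = (\<Sum>i\<in>index_box r. if i = j then elem (\<lambda>\<mu>. U \<mu> (j \<mu>)) else 0)"
    unfolding tucker_eq_sum_elem by (intro sum.cong refl) auto
  then show ?thesis using assms by simp
qed

lemma ell2_unit_tensors: "j \<in> index_box r \<Longrightarrow> ell2_unit j \<in> tensors r"
  by (auto simp: tensors_def)

lemma inner_tucker_elem:
  "inner (tucker r C U) (elem x) = (\<Sum>k\<in>index_box r. coord C k * (\<Prod>\<mu>\<in>UNIV. inner (U \<mu> (k \<mu>)) (x \<mu>)))"
  by (simp add: tucker_eq_sum_elem inner_sum_left inner_elem)

lemma elem_sum_expand:
  "elem (\<lambda>\<mu>. \<Sum>k<r \<mu>. c \<mu> k *\<^sub>R U \<mu> k) = (\<Sum>j\<in>index_box r. (\<Prod>\<mu>\<in>UNIV. c \<mu> (j \<mu>)) *\<^sub>R elem (\<lambda>\<mu>. U \<mu> (j \<mu>)))"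
proof (rule ell2_eqI)
  fix i
  have "coord (elem (\<lambda>\<mu>. \<Sum>k<r \<mu>. c \<mu> k *\<^sub>R U \<mu> k)) i = (\<Prod>\<mu>\<in>UNIV. \<Sum>k<r \<mu>. c \<mu> k * coord (U \<mu> k) (i \<mu>))"
    by (simp add: coord_elem)
  also have "\<dots> = (\<Sum>j\<in>index_box r. \<Prod>\<mu>\<in>UNIV. c \<mu> (j \<mu>) * coord (U \<mu> (j \<mu>)) (i \<mu>))"
    unfolding index_box_eq by (rule prod_sum_PiE) auto
  finally show "coord (elem (\<lambda>\<mu>. \<Sum>k<r \<mu>. c \<mu> k *\<^sub>R U \<mu> k)) i
      = coord (\<Sum>j\<in>index_box r. (\<Prod>\<mu>\<in>UNIV. c \<mu> (j \<mu>)) *\<^sub>R elem (\<lambda>\<mu>. U \<mu> (j \<mu>))) i"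
    by (simp add: coord_elem prod.distrib)
qed

text \<open>
  A tensor whose column spaces lie in the spans of the \<open>v \<mu>\<close> is determined by its entries with
  respect to a dual system \<open>U\<close>: in each mode the component annihilated by the \<open>v \<mu> k\<close> drops out.
\<close>

lemma tucker_reconstruction:
  fixes Z :: "('d::finite \<Rightarrow> nat) ell2"
  assumes Z: "\<And>\<mu> b. b \<in> rest_modes \<mu> \<Longrightarrow>
      contract \<mu> Z b = (\<Sum>k<r \<mu>. inner (U \<mu> k) (contract \<mu> Z b) *\<^sub>R v \<mu> k)"
    and D: "\<And>j. j \<in> index_box r \<Longrightarrow> coord D j = inner Z (elem (\<lambda>\<mu>. U \<mu> (j \<mu>)))"
  shows "Z = tucker r D v"
proof -
  define R where "R \<mu> x = (\<Sum>k<r \<mu>. inner (v \<mu> k) x *\<^sub>R U \<mu> k)" for \<mu> x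
  have step: "inner Z (elem x) = inner Z (elem (x(\<mu> := R \<mu> (x \<mu>))))" for x \<mu>
  proof -
    define b where "b = elem (x(\<mu> := ell2_unit 0))"
    have b: "b \<in> rest_modes \<mu>" unfolding b_def by (rule elem_rest_modes)
    have e: "elem x = ins \<mu> (x \<mu>) b" "elem (x(\<mu> := R \<mu> (x \<mu>))) = ins \<mu> (R \<mu> (x \<mu>)) b"
      using elem_eq_ins[of x \<mu>] elem_eq_ins[of "x(\<mu> := R \<mu> (x \<mu>))" \<mu>] by (simp_all add: b_def)
    have "inner (x \<mu>) (contract \<mu> Z b) = inner (x \<mu>) (\<Sum>k<r \<mu>. inner (U \<mu> k) (contract \<mu> Z b) *\<^sub>R v \<mu> k)"
      using Z[OF b] by simp
    also have "\<dots> = inner (R \<mu> (x \<mu>)) (contract \<mu> Z b)"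
      by (simp add: R_def inner_sum_left inner_sum_right inner_commute mult.commute)
    finally show ?thesis
      unfolding e using inner_contract[OF b, of "x \<mu>" Z] inner_contract[OF b, of "R \<mu> (x \<mu>)" Z]
      by (simp add: inner_commute)
  qed
  have "inner Z (elem x) = inner Z (elem (\<lambda>\<mu>. if \<mu> \<in> A then R \<mu> (x \<mu>) else x \<mu>))" if "finite A" for A :: "'d set" and x :: "'d \<Rightarrow> nat ell2"
    using that
  proof (induction A)
    case (insert \<nu> A)
    let ?y = "\<lambda>\<mu>. if \<mu> \<in> A then R \<mu> (x \<mu>) else x \<mu>"
    have "?y(\<nu> := R \<nu> (?y \<nu>)) = (\<lambda>\<mu>. if \<mu> \<in> insert \<nu> A then R \<mu> (x \<mu>) else x \<mu>)"
      using insert.hyps by auto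
    then show ?case using insert.IH step[of ?y \<nu>] by simp
  qed simp
  from this[of UNIV] have all: "inner Z (elem x) = inner Z (elem (\<lambda>\<mu>. R \<mu> (x \<mu>)))" for x by simp
  show ?thesis
  proof (rule ell2_eqI)
    fix i :: "'d \<Rightarrow> nat"
    define x where "x \<mu> = (ell2_unit (i \<mu>) :: nat ell2)" for \<mu> :: 'd
    have ex: "elem x = ell2_unit i" unfolding x_def by (rule elem_unit)
    have "coord Z i = inner Z (elem (\<lambda>\<mu>. R \<mu> (x \<mu>)))" unfolding all[symmetric] ex by simp
    also have "\<dots> = (\<Sum>j\<in>index_box r. (\<Prod>\<mu>\<in>UNIV. inner (v \<mu> (j \<mu>)) (x \<mu>)) * inner Z (elem (\<lambda>\<mu>. U \<mu> (j \<mu>))))"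
      unfolding R_def elem_sum_expand by (simp add: inner_sum_right)
    also have "\<dots> = (\<Sum>j\<in>index_box r. coord D j * (\<Prod>\<mu>\<in>UNIV. inner (v \<mu> (j \<mu>)) (x \<mu>)))"
      by (intro sum.cong refl) (simp add: D mult.commute)
    also have "\<dots> = coord (tucker r D v) i" unfolding inner_tucker_elem[symmetric] ex by simp
    finally show "coord Z i = coord (tucker r D v) i" .
  qed
qed

context tucker_model
begin

lemma mode_transform_scalar:
  assumes C: "C \<in> tensors r"
  shows "mode_transform r (\<lambda>\<mu>. t \<cdot>\<^sub>m 1\<^sub>m (r \<mu>)) C = t ^ CARD('d) *\<^sub>R C"
proof (rule ell2_eqI)
  fix i
  have cm: "t \<cdot>\<^sub>m 1\<^sub>m (r \<mu>) \<in> carrier_mat (r \<mu>) (r \<mu>)" for \<mu> by simp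
  show "coord (mode_transform r (\<lambda>\<mu>. t \<cdot>\<^sub>m 1\<^sub>m (r \<mu>)) C) i = coord (t ^ CARD('d) *\<^sub>R C) i"
  proof (cases "i \<in> index_box r")
    case True
    have "(\<Prod>\<mu>\<in>UNIV. (t \<cdot>\<^sub>m 1\<^sub>m (r \<mu>)) $$ (i \<mu>, j \<mu>)) = (if j = i then t ^ CARD('d) else 0)" if j: "j \<in> index_box r" for j
    proof -
      have e: "(t \<cdot>\<^sub>m 1\<^sub>m (r \<mu>)) $$ (i \<mu>, j \<mu>) = (if i \<mu> = j \<mu> then t else 0)" for \<mu>
        using index_boxD[OF True, of \<mu>] index_boxD[OF j, of \<mu>] by simp
      show ?thesis
      proof (cases "j = i")
        case False
        then obtain \<mu> where "i \<mu> \<noteq> j \<mu>" by (metis ext)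
        then show ?thesis unfolding e using False by (auto intro!: prod_zero)
      next
        case True
        then show ?thesis unfolding e by simp
      qed
    qed
    then have "coord (mode_transform r (\<lambda>\<mu>. t \<cdot>\<^sub>m 1\<^sub>m (r \<mu>)) C) i
        = (\<Sum>j\<in>index_box r. if j = i then coord C i * t ^ CARD('d) else 0)"
      unfolding coord_mode_transform[OF cm] if_P[OF True] by (intro sum.cong refl) auto
    then show ?thesis using True by simp
  qed (simp add: coord_mode_transform[OF cm] tensors_coord_0[OF C])
qed

text \<open>
  Scaling all modes of \<open>C\<close> by a factor that tends to \<open>0\<close>. In particular the boundary is not empty,
  so that \<^const>\<open>infdist\<close> does not take its default value \<open>0\<close>.
\<close>

lemma zero_in_boundary:
  assumes C: "C \<in> Mc"
  shows "0 \<in> closure Mc - Mc"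
proof
  have "t ^ CARD('d) *\<^sub>R C \<in> Mc" if t: "0 < t" for t
  proof -
    have "mode_transform r (\<lambda>\<mu>. t \<cdot>\<^sub>m 1\<^sub>m (r \<mu>)) C \<in> Mc"
    proof (rule invariant[OF C])
      fix \<mu>
      have cm: "t \<cdot>\<^sub>m 1\<^sub>m (r \<mu>) \<in> carrier_mat (r \<mu>) (r \<mu>)" by simp
      have "invertible_mat (t \<cdot>\<^sub>m 1\<^sub>m (r \<mu>))"
      proof (rule invertible_mat_of_left_kernel[OF cm])
        fix x :: "nat \<Rightarrow> real" and j
        assume x: "\<And>j. j < r \<mu> \<Longrightarrow> (\<Sum>i<r \<mu>. x i * (t \<cdot>\<^sub>m 1\<^sub>m (r \<mu>)) $$ (i, j)) = 0" and j: "j < r \<mu>"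
        have "(\<Sum>i<r \<mu>. x i * (t \<cdot>\<^sub>m 1\<^sub>m (r \<mu>)) $$ (i, j)) = (\<Sum>i<r \<mu>. if i = j then x j * t else 0)"
          by (intro sum.cong refl) (use j in auto)
        then show "x j = 0" using x[OF j] j t by simp
      qed
      then show "t \<cdot>\<^sub>m 1\<^sub>m (r \<mu>) \<in> carrier_mat (r \<mu>) (r \<mu>) \<and> invertible_mat (t \<cdot>\<^sub>m 1\<^sub>m (r \<mu>))" using cm by blast
    qed
    then show ?thesis unfolding mode_transform_scalar[OF Mc_tensors[OF C]] .
  qed
  then have "(inverse (real (Suc n))) ^ CARD('d) *\<^sub>R C \<in> Mc" for n by simp
  moreover have "(\<lambda>n. (inverse (real (Suc n))) ^ CARD('d) *\<^sub>R C) \<longlonglongrightarrow> 0 ^ CARD('d) *\<^sub>R C"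
    by (intro tendsto_intros LIMSEQ_inverse_real_of_nat)
  ultimately show "0 \<in> closure Mc"
    unfolding closure_sequential by (intro exI[of _ "\<lambda>n. (inverse (real (Suc n))) ^ CARD('d) *\<^sub>R C"]) (simp add: power_0_left)
  show "0 \<notin> Mc"
  proof
    assume "0 \<in> Mc"
    from full_rank_rows_linear_indep[OF Mc_full_rank[OF this], of undefined,
        unfolded linear_indep_def, rule_format, of "\<lambda>_. 1" 0]
    show False using r_pos[of undefined] by (simp add: matricization_simps)
  qed
qed

lemma boundary_distance_pos:
  assumes C: "C \<in> Mc"
  shows "0 < infdist C (closure Mc - Mc)"
proof -
  obtain \<rho> where \<rho>: "0 < \<rho>" "ball C \<rho> \<inter> closure Mc \<subseteq> Mc"
    using embedded_submanifold_locally_closed[OF submanifold C subspace_tensors tensors_in_span finite_imageI[OF finite_index_box]] .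
  have "\<rho> \<le> infdist C (closure Mc - Mc)"
    by (rule le_infdist) (use zero_in_boundary[OF C] \<rho>(2) in \<open>auto simp: not_less[symmetric]\<close>)
  then show ?thesis using \<rho>(1) by simp
qed

lemma closure_Mc_tensors: "closure Mc \<subseteq> tensors r"
  by (rule closure_minimal) (use Mc_tensors closed_tensors in auto)

abbreviation M where "M \<equiv> tucker_manifold r Mc"
abbreviation weak_boundary where "weak_boundary \<equiv> weak_topology closure_of M - M"

text \<open>
  If the point belonged to the manifold then its core with respect to the orthonormal factors \<open>U\<close>
  would belong to \<open>Mc\<close>.
\<close>

lemma tucker_in_weak_boundary:
  assumes U: "orthonormal_frames r U" and D: "D \<in> closure Mc - Mc"
  shows "tucker r D U \<in> weak_boundary"
proof
  have "(\<lambda>D. tucker r D U) ` closure Mc \<subseteq> closure M"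
  proof (rule image_closure_subset)
    show "continuous_on (closure Mc) (\<lambda>D. tucker r D U)"
      using bounded_linear_tucker by (rule bounded_linear.continuous_on) (rule continuous_on_id)
    show "(\<lambda>D. tucker r D U) ` Mc \<subseteq> closure M"
      using U mem_tucker_manifold_iff closure_subset by blast
  qed simp
  then show "tucker r D U \<in> weak_topology closure_of M" using D closure_subset_weak_closure[of M] by blast
  show "tucker r D U \<notin> M"
  proof
    assume "tucker r D U \<in> M"
    then obtain C1 U1 where C1: "C1 \<in> Mc" "orthonormal_frames r U1" "tucker r D U = tucker r C1 U1"
      unfolding mem_tucker_manifold_iff by blast
    have "\<And>\<mu>. linear_indep (r \<mu>) (U1 \<mu>)" using C1(2) by (auto simp: orthonormal_frames_def linear_indep_orthonormal)
    then have "D \<in> Mc" using representation_core(1)[OF C1(1) _ U _ C1(3)] D closure_Mc_tensors by blast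
    then show False using D by blast
  qed
qed

lemma weak_boundary_distance_le:
  assumes C: "C \<in> Mc" and U: "orthonormal_frames r U"
  shows "infdist (tucker r C U) weak_boundary \<le> infdist C (closure Mc - Mc)"
proof (rule le_infdist)
  show "closure Mc - Mc \<noteq> {}" using zero_in_boundary[OF C] by blast
  fix D assume D: "D \<in> closure Mc - Mc"
  have "C - D \<in> tensors r"
    using Mc_tensors[OF C] D closure_Mc_tensors by (intro subspace_diff subspace_tensors) auto
  then have "dist (tucker r C U) (tucker r D U) = dist C D"
    unfolding dist_norm tucker_diff[symmetric] by (rule norm_tucker_orthonormal[OF U])
  then show "infdist (tucker r C U) weak_boundary \<le> dist C D"
    using infdist_le[OF tucker_in_weak_boundary[OF U D], of "tucker r C U"] by simp
qed

text \<open>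
  The multilinear rank does not increase under weak limits: otherwise some matrix
  \<open>\<langle>x\<^sub>i \<otimes> y\<^sub>j, Z\<rangle>\<close> of size \<open>r \<mu> + 1\<close> would be the identity, and the corresponding matrix of a weakly
  close point of the manifold would be invertible.
\<close>

lemma weak_closure_rank:
  assumes Z: "Z \<in> weak_topology closure_of M" and y: "\<And>j. j \<le> r \<mu> \<Longrightarrow> y j \<in> rest_modes \<mu>"
    and I: "\<And>i j. i \<le> r \<mu> \<Longrightarrow> j \<le> r \<mu> \<Longrightarrow> inner (x i) (contract \<mu> Z (y j)) = (if i = j then 1 else 0)"
  shows False
proof -
  define n where "n = Suc (r \<mu>)"
  define F where "F = (\<lambda>(i, j). ins \<mu> (x i) (y j)) ` ({..<n} \<times> {..<n})"
  define \<eta> where "\<eta> = 1 / (2 * real n)"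
  have "0 < \<eta>" by (simp add: \<eta>_def n_def)
  then obtain W where W: "W \<in> M" "\<forall>f\<in>F. \<bar>inner f W - inner f Z\<bar> < \<eta>"
    using weak_closure_approx[OF Z, of F \<eta>] by (auto simp: F_def)
  obtain C1 U1 where W1: "W = tucker r C1 U1" using W(1) unfolding mem_tucker_manifold_iff by blast
  define w where "w j = contract \<mu> W (y j)" for j
  have yr: "y j \<in> rest_modes \<mu>" if "j < n" for j using y that by (simp add: n_def)
  have near: "\<bar>inner (x i) (w j) - (if j = i then 1 else 0)\<bar> \<le> \<eta>" if "i < n" "j < n" for i j
  proof -
    have "ins \<mu> (x i) (y j) \<in> F" unfolding F_def using that by force
    then have "\<bar>inner (ins \<mu> (x i) (y j)) W - inner (ins \<mu> (x i) (y j)) Z\<bar> < \<eta>" using W(2) by blast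
    then show ?thesis
      unfolding inner_contract[OF yr[OF that(2)], symmetric] w_def using I[of i j] that by (simp add: n_def eq_commute)
  qed
  have "linear_indep n w"
    unfolding linear_indep_def
  proof (intro allI impI)
    fix c :: "nat \<Rightarrow> real" and k assume c: "(\<Sum>j<n. c j *\<^sub>R w j) = 0" and k: "k < n"
    show "c k = 0"
    proof (rule near_identity_kernel[where M = "\<lambda>j i. inner (x i) (w j)" and n = n and \<eta> = \<eta>])
      show "real n * \<eta> < 1" by (simp add: \<eta>_def n_def)
      show "(\<Sum>j<n. c j * inner (x i) (w j)) = 0" if "i < n" for i
      proof -
        have "(\<Sum>j<n. c j * inner (x i) (w j)) = inner (x i) (\<Sum>j<n. c j *\<^sub>R w j)" by (simp add: inner_sum_right)
        then show ?thesis by (simp add: c)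
      qed
    qed (use near k in auto)
  qed
  moreover have "w j \<in> span (U1 \<mu> ` {..<r \<mu>})" if "j < n" for j
    unfolding w_def W1 by (rule contract_tucker_in_span[OF yr[OF that]])
  ultimately have "n \<le> card (U1 \<mu> ` {..<r \<mu>})" by (rule linear_indep_le) auto
  then show False using card_image_le[of "{..<r \<mu>}" "U1 \<mu>"] by (simp add: n_def)
qed

text \<open>
  Let \<open>Z\<close> be a weak limit of points of the manifold close to \<open>X\<close>, and \<open>D\<close> its core with respect
  to the factors \<open>U\<close> of \<open>X\<close>. Then \<open>Z\<close> has the multilinear rank of \<open>X\<close>, hence \<open>Z = tucker r D v\<close>
  for the basis \<open>v\<close> of its column spaces dual to \<open>U\<close>; and \<open>D\<close> is a limit of the cores of points of
  the manifold with respect to \<open>U\<close>, which belong to \<open>Mc\<close>. So if \<open>Z\<close> is not in the manifold then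
  \<open>D\<close> is in the boundary of \<open>Mc\<close>, at distance at most \<open>\<parallel>X - Z\<parallel>\<close> of \<open>C\<close>.
\<close>

lemma weak_boundary_distance_pos:
  assumes C: "C \<in> Mc" and U: "orthonormal_frames r U"
  shows "0 < infdist (tucker r C U) weak_boundary"
proof -
  define X where "X = tucker r C U"
  have "\<forall>\<mu> k. \<exists>y. k < r \<mu> \<longrightarrow> y \<in> rest_modes \<mu> \<and> contract \<mu> X y = U \<mu> k"
  proof (intro allI)
    fix \<mu> k
    show "\<exists>y. k < r \<mu> \<longrightarrow> y \<in> rest_modes \<mu> \<and> contract \<mu> X y = U \<mu> k"
    proof (cases "k < r \<mu>")
      case True
      then have "U \<mu> k \<in> span (U \<mu> ` {..<r \<mu>})" by (intro span_base) blast
      then show ?thesis using contract_tucker_surj[OF U Mc_full_rank[OF C]] unfolding X_def by metis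
    qed blast
  qed
  then obtain y where y: "\<And>\<mu> k. k < r \<mu> \<Longrightarrow> y \<mu> k \<in> rest_modes \<mu>"
    and Xy: "\<And>\<mu> k. k < r \<mu> \<Longrightarrow> contract \<mu> X (y \<mu> k) = U \<mu> k" by metis
  \<comment> \<open>the matrices of the pairings of \<open>U \<mu> j\<close> and \<open>y \<mu> k\<close> are within \<open>\<eta>\<close> of the identity for \<open>Z\<close>
    near \<open>X\<close>, and within \<open>2 * \<eta>\<close> for points weakly close to \<open>Z\<close>; diagonal dominance makes them
    invertible\<close>
  define N where "N = 1 + (\<Sum>\<mu>\<in>UNIV. real (r \<mu>))"
  define B where "B = 1 + (\<Sum>\<mu>\<in>UNIV. \<Sum>k<r \<mu>. norm (y \<mu> k))"
  define \<eta> where "\<eta> = 1 / (4 * N)"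
  have rN: "real (r \<mu>) < N" for \<mu>
    using member_le_sum[of \<mu> UNIV "\<lambda>\<mu>. real (r \<mu>)"] by (simp add: N_def)
  have N: "1 \<le> N" by (simp add: N_def sum_nonneg)
  have \<eta>: "0 < \<eta>" "real (r \<mu>) * (2 * \<eta>) < 1" for \<mu>
    using N rN[of \<mu>] by (simp_all add: \<eta>_def field_simps)
  have B: "norm (y \<mu> k) \<le> B" if "k < r \<mu>" for \<mu> k
  proof -
    have "norm (y \<mu> k) \<le> (\<Sum>k<r \<mu>. norm (y \<mu> k))" using that by (intro member_le_sum) auto
    also have "\<dots> \<le> (\<Sum>\<mu>\<in>UNIV. \<Sum>k<r \<mu>. norm (y \<mu> k))"
      by (rule member_le_sum[of \<mu> UNIV "\<lambda>\<mu>. \<Sum>k<r \<mu>. norm (y \<mu> k)"]) (auto simp: sum_nonneg)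
    finally show ?thesis by (simp add: B_def)
  qed
  have Bpos: "0 < B" unfolding B_def by (intro add_pos_nonneg sum_nonneg) auto
  define e where "e = min (infdist C (closure Mc - Mc)) (\<eta> / B)"
  have e: "0 < e" using boundary_distance_pos[OF C] \<eta>(1) Bpos by (simp add: e_def)
  have "e \<le> dist X Z" if Z: "Z \<in> weak_boundary" for Z
  proof (rule ccontr)
    assume "\<not> e \<le> dist X Z"
    then have Z1: "norm (Z - X) < infdist C (closure Mc - Mc)" and Z2: "norm (Z - X) < \<eta> / B"
      by (auto simp: e_def dist_norm norm_minus_commute)
    have Zc: "Z \<in> weak_topology closure_of M" and ZM: "Z \<notin> M" using Z by auto
    have near: "\<bar>inner (U \<mu> j) (contract \<mu> Z (y \<mu> k)) - (if j = k then 1 else 0)\<bar> \<le> \<eta>"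
      if jk: "j < r \<mu>" "k < r \<mu>" for \<mu> j k
    proof -
      have "inner (U \<mu> j) (contract \<mu> Z (y \<mu> k)) - (if j = k then 1 else 0)
          = inner (U \<mu> j) (contract \<mu> (Z - X) (y \<mu> k))"
        unfolding contract_diff[OF y[OF jk(2)]] using Xy[OF jk(2)] orthonormal_framesD[OF U jk]
        by (simp add: inner_diff_right)
      also have "\<bar>\<dots>\<bar> \<le> norm (U \<mu> j) * norm (contract \<mu> (Z - X) (y \<mu> k))" by (rule Cauchy_Schwarz_ineq2)
      also have "\<dots> \<le> norm (y \<mu> k) * norm (Z - X)"
        using norm_contract_le[OF y[OF jk(2)], of "Z - X"] U jk(1) orthonormal_norm[of "r \<mu>" "U \<mu>" j]
        by (simp add: orthonormal_frames_def)
      also have "\<dots> \<le> B * (\<eta> / B)" using Z2 B[OF jk(2)] Bpos by (intro mult_mono) auto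
      finally show ?thesis using Bpos by simp
    qed
    define T where "T \<mu> = Matrix.mat (r \<mu>) (r \<mu>) (\<lambda>(j, k). inner (U \<mu> j) (contract \<mu> Z (y \<mu> k)))" for \<mu>
    have T: "T \<mu> \<in> carrier_mat (r \<mu>) (r \<mu>)" for \<mu> by (simp add: T_def)
    have "invertible_mat (T \<mu>)" for \<mu>
    proof (rule invertible_mat_of_left_kernel[OF T])
      fix x :: "nat \<Rightarrow> real" and k assume x: "\<And>j. j < r \<mu> \<Longrightarrow> (\<Sum>i<r \<mu>. x i * T \<mu> $$ (i, j)) = 0" and k: "k < r \<mu>"
      show "x k = 0"
      proof (rule near_identity_kernel[where M = "\<lambda>i j. T \<mu> $$ (i, j)" and n = "r \<mu>" and \<eta> = \<eta>])
        show "real (r \<mu>) * \<eta> < 1" using \<eta>(2)[of \<mu>] \<eta>(1) by (simp add: algebra_simps)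
      qed (use near x k in \<open>auto simp: T_def\<close>)
    qed
    then have "\<forall>\<mu>. \<exists>S. \<forall>i<r \<mu>. \<forall>j<r \<mu>. (\<Sum>k<r \<mu>. T \<mu> $$ (i, k) * S $$ (k, j)) = (if i = j then 1 else 0)"
      using invertible_mat_imp_inverse[OF T] by metis
    then obtain S where S: "\<And>\<mu> i j. i < r \<mu> \<Longrightarrow> j < r \<mu> \<Longrightarrow> (\<Sum>k<r \<mu>. T \<mu> $$ (i, k) * S \<mu> $$ (k, j)) = (if i = j then 1 else 0)"
      by metis
    define y' where "y' \<mu> k = (\<Sum>l<r \<mu>. S \<mu> $$ (l, k) *\<^sub>R y \<mu> l)" for \<mu> k
    have y': "y' \<mu> k \<in> rest_modes \<mu>" for \<mu> k
      unfolding y'_def using y by (intro subspace_sum subspace_scale subspace_rest_modes) auto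
    define v where "v \<mu> k = contract \<mu> Z (y' \<mu> k)" for \<mu> k
    have v: "v \<mu> k = (\<Sum>l<r \<mu>. S \<mu> $$ (l, k) *\<^sub>R contract \<mu> Z (y \<mu> l))" for \<mu> k
      by (rule ell2_eqI, unfold v_def coord_contract[OF y']) (simp add: coord_contract[OF y] y'_def inner_sum_right)
    have Uv: "inner (U \<mu> j) (v \<mu> k) = (if j = k then 1 else 0)" if "j < r \<mu>" "k < r \<mu>" for \<mu> j k
    proof -
      have "inner (U \<mu> j) (v \<mu> k) = (\<Sum>l<r \<mu>. T \<mu> $$ (j, l) * S \<mu> $$ (l, k))"
        unfolding v inner_sum_right by (intro sum.cong refl) (use that in \<open>simp add: T_def mult.commute\<close>)
      then show ?thesis using S[OF that] by simp
    qed
    have col: "contract \<mu> Z b = (\<Sum>k<r \<mu>. inner (U \<mu> k) (contract \<mu> Z b) *\<^sub>R v \<mu> k)" if b: "b \<in> rest_modes \<mu>" for \<mu> b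
    proof (rule ccontr)
      define n where "n = r \<mu>"
      define \<beta> where "\<beta> k = inner (U \<mu> k) (contract \<mu> Z b)" for k
      define y'' where "y'' = b - (\<Sum>k<n. \<beta> k *\<^sub>R y' \<mu> k)"
      have y'': "y'' \<in> rest_modes \<mu>"
        unfolding y''_def using b y' by (intro subspace_diff subspace_sum subspace_scale subspace_rest_modes) auto
      define w where "w = contract \<mu> Z y''"
      have w: "w = contract \<mu> Z b - (\<Sum>k<n. \<beta> k *\<^sub>R v \<mu> k)"
        by (rule ell2_eqI, unfold w_def coord_contract[OF y''])
          (simp add: coord_contract[OF b] coord_contract[OF y'] v_def y''_def inner_diff_right inner_sum_right)
      assume "contract \<mu> Z b \<noteq> (\<Sum>k<r \<mu>. inner (U \<mu> k) (contract \<mu> Z b) *\<^sub>R v \<mu> k)"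
      then have w0: "inner w w \<noteq> 0" unfolding w by (simp add: \<beta>_def n_def)
      have Uw: "inner (U \<mu> k) w = 0" if k: "k < n" for k
      proof -
        have "(\<Sum>l<n. \<beta> l * inner (U \<mu> k) (v \<mu> l)) = (\<Sum>l<n. if l = k then \<beta> k else 0)"
          by (intro sum.cong refl) (use k Uv[of k \<mu>] in \<open>auto simp: n_def\<close>)
        then show ?thesis using k by (simp add: w inner_diff_right inner_sum_right \<beta>_def[of k])
      qed
      define x where "x = (1 / inner w w) *\<^sub>R (w - (\<Sum>k<n. inner w (v \<mu> k) *\<^sub>R U \<mu> k))"
      have xv: "inner x (v \<mu> k) = 0" if k: "k < n" for k
      proof -
        have "(\<Sum>l<n. inner w (v \<mu> l) * inner (U \<mu> l) (v \<mu> k)) = (\<Sum>l<n. if l = k then inner w (v \<mu> k) else 0)"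
          by (intro sum.cong refl) (use k Uv[of _ \<mu> k] in \<open>auto simp: n_def\<close>)
        then show ?thesis using k by (simp add: x_def inner_diff_left inner_sum_left)
      qed
      have xw: "inner x w = 1"
        using w0 Uw by (simp add: x_def inner_diff_left inner_sum_left)
      show False
      proof (rule weak_closure_rank[OF Zc, of \<mu> "(y' \<mu>)(n := y'')" "(U \<mu>)(n := x)"])
        fix i j assume "i \<le> r \<mu>" "j \<le> r \<mu>"
        then have "i < n \<or> i = n" "j < n \<or> j = n" by (auto simp: n_def)
        then show "inner (((U \<mu>)(n := x)) i) (contract \<mu> Z (((y' \<mu>)(n := y'')) j)) = (if i = j then 1 else 0)"
          using Uv[of i \<mu> j] Uw[of i] xv[of j] xw by (auto simp: n_def v_def w_def)
      qed (use y' y'' in auto)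
    qed
    define D where "D = (\<Sum>j\<in>index_box r. inner Z (elem (\<lambda>\<mu>. U \<mu> (j \<mu>))) *\<^sub>R ell2_unit j)"
    have Dc: "coord D i = (if i \<in> index_box r then inner Z (elem (\<lambda>\<mu>. U \<mu> (i \<mu>))) else 0)" for i
      by (simp add: D_def if_distrib[of "\<lambda>x. _ * x"] cong: if_cong)
    have Dt: "D \<in> tensors r" by (auto simp: tensors_def Dc)
    have ZD: "Z = tucker r D v" by (rule tucker_reconstruction[OF col]) (simp_all add: Dc)
    have "D \<notin> Mc"
    proof
      assume "D \<in> Mc"
      moreover have "linear_indep (r \<mu>) (v \<mu>)" for \<mu>
        unfolding linear_indep_def
      proof (intro allI impI)
        fix x :: "nat \<Rightarrow> real" and i assume x: "(\<Sum>k<r \<mu>. x k *\<^sub>R v \<mu> k) = 0" and i: "i < r \<mu>"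
        have "0 = inner (U \<mu> i) (\<Sum>k<r \<mu>. x k *\<^sub>R v \<mu> k)" using x by simp
        also have "\<dots> = (\<Sum>k<r \<mu>. if k = i then x i else 0)"
          unfolding inner_sum_right by (intro sum.cong refl) (use Uv[OF i] in auto)
        finally show "x i = 0" using i by simp
      qed
      ultimately have "Z \<in> M" unfolding tucker_manifold_def invertible_gram_iff ZD by blast
      then show False using ZM by blast
    qed
    moreover have "D \<in> closure Mc"
      unfolding closure_approachable
    proof (intro allI impI)
      fix \<tau> :: real assume \<tau>: "0 < \<tau>"
      define m where "m = real (card (index_box r)) + 1"
      have m: "0 < m" by (simp add: m_def)
      define F where "F = (\<lambda>j. elem (\<lambda>\<mu>. U \<mu> (j \<mu>))) ` index_box r
        \<union> (\<Union>\<mu>. (\<lambda>(j, k). ins \<mu> (U \<mu> j) (y \<mu> k)) ` ({..<r \<mu>} \<times> {..<r \<mu>}))"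
      have "finite F" by (simp add: F_def)
      moreover have "0 < min \<eta> (\<tau> / m)" using \<eta>(1) \<tau> m by simp
      ultimately obtain W where W: "W \<in> M" "\<forall>f\<in>F. \<bar>inner f W - inner f Z\<bar> < min \<eta> (\<tau> / m)"
        using weak_closure_approx[OF Zc] by blast
      obtain C1 U1 where C1: "C1 \<in> Mc" "W = tucker r C1 U1" using W(1) unfolding mem_tucker_manifold_iff by blast
      define A where "A \<mu> = Matrix.mat (r \<mu>) (r \<mu>) (\<lambda>(j, k). inner (U \<mu> j) (U1 \<mu> k))" for \<mu>
      have A: "A \<mu> \<in> carrier_mat (r \<mu>) (r \<mu>)" for \<mu> by (simp add: A_def)
      have invA: "invertible_mat (A \<mu>)" for \<mu>
      proof (rule invertible_mat_of_left_kernel[OF A])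
        fix x :: "nat \<Rightarrow> real" and k assume x: "\<And>j. j < r \<mu> \<Longrightarrow> (\<Sum>i<r \<mu>. x i * A \<mu> $$ (i, j)) = 0" and k: "k < r \<mu>"
        define u where "u = (\<Sum>i<r \<mu>. x i *\<^sub>R U \<mu> i)"
        have uU1: "inner u (U1 \<mu> j) = 0" if "j < r \<mu>" for j
          using x[OF that] that by (simp add: u_def inner_sum_left A_def)
        show "x k = 0"
        proof (rule near_identity_kernel[where M = "\<lambda>i j. inner (U \<mu> i) (contract \<mu> W (y \<mu> j))" and n = "r \<mu>" and \<eta> = "2 * \<eta>"])
          show "\<bar>inner (U \<mu> i) (contract \<mu> W (y \<mu> j)) - (if i = j then 1 else 0)\<bar> \<le> 2 * \<eta>" if ij: "i < r \<mu>" "j < r \<mu>" for i j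
          proof -
            have "ins \<mu> (U \<mu> i) (y \<mu> j) \<in> F" unfolding F_def using ij by force
            then have "\<bar>inner (ins \<mu> (U \<mu> i) (y \<mu> j)) W - inner (ins \<mu> (U \<mu> i) (y \<mu> j)) Z\<bar> < \<eta>" using W(2) by fastforce
            then show ?thesis unfolding inner_contract[OF y[OF ij(2)], symmetric] using near[OF ij] by linarith
          qed
          show "(\<Sum>i<r \<mu>. x i * inner (U \<mu> i) (contract \<mu> W (y \<mu> j))) = 0" if j: "j < r \<mu>" for j
          proof -
            have "(\<Sum>i<r \<mu>. x i * inner (U \<mu> i) (contract \<mu> W (y \<mu> j))) = inner u (contract \<mu> W (y \<mu> j))"
              by (simp add: u_def inner_sum_left)
            also have "\<dots> = 0"
              unfolding C1(2) using contract_tucker_in_span[OF y[OF j]]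
              by (rule inner_span_family_eq_0) (rule uU1)
            finally show ?thesis .
          qed
        qed (use \<eta>(2) k in auto)
      qed
      define C2 where "C2 = mode_transform r A C1"
      have "C2 \<in> Mc" unfolding C2_def using A invA by (intro invariant C1(1)) blast
      moreover have "dist C2 D < \<tau>"
      proof -
        have C2c: "coord C2 j = inner W (elem (\<lambda>\<mu>. U \<mu> (j \<mu>)))" if j: "j \<in> index_box r" for j
        proof -
          have "(\<Prod>\<mu>\<in>UNIV. A \<mu> $$ (j \<mu>, k \<mu>)) = (\<Prod>\<mu>\<in>UNIV. inner (U1 \<mu> (k \<mu>)) (U \<mu> (j \<mu>)))" if "k \<in> index_box r" for k
            using index_boxD[OF j] index_boxD[OF that] by (simp add: A_def inner_commute)
          then show ?thesis
            unfolding C2_def coord_mode_transform[OF A] C1(2) inner_tucker_elem using j by (simp cong: sum.cong)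
        qed
        have "C2 - D \<in> tensors r"
          unfolding C2_def using mode_transform_tensors[where T = A and r = r, OF A] Dt
          by (rule subspace_diff[OF subspace_tensors])
        then have "C2 - D = (\<Sum>j\<in>index_box r. coord (C2 - D) j *\<^sub>R ell2_unit j)" by (rule tensors_expand)
        then have "norm (C2 - D) \<le> (\<Sum>j\<in>index_box r. norm (coord (C2 - D) j *\<^sub>R ell2_unit j))"
          by (metis norm_sum)
        also have "\<dots> = (\<Sum>j\<in>index_box r. \<bar>coord (C2 - D) j\<bar>)" by (simp add: norm_eq_sqrt_inner)
        also have "\<dots> \<le> (\<Sum>j\<in>index_box r. \<tau> / m)"
        proof (rule sum_mono)
          fix j assume j: "j \<in> index_box r"
          then have "elem (\<lambda>\<mu>. U \<mu> (j \<mu>)) \<in> F" by (simp add: F_def)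
          then have "\<bar>inner (elem (\<lambda>\<mu>. U \<mu> (j \<mu>))) W - inner (elem (\<lambda>\<mu>. U \<mu> (j \<mu>))) Z\<bar> < \<tau> / m" using W(2) by fastforce
          then show "\<bar>coord (C2 - D) j\<bar> \<le> \<tau> / m" using j by (simp add: C2c Dc inner_commute)
        qed
        also have "\<dots> < \<tau>" using \<tau> m by (simp add: m_def field_simps)
        finally show ?thesis by (simp add: dist_norm)
      qed
      ultimately show "\<exists>y\<in>Mc. dist y D < \<tau>" by blast
    qed
    ultimately have "infdist C (closure Mc - Mc) \<le> dist C D" by (intro infdist_le) blast
    also have "dist C D \<le> norm (Z - X)"
    proof -
      note Ct = Mc_tensors[OF C]
      have cc: "coord (C - D) j = - inner (Z - X) (tucker r (ell2_unit j) U)" if j: "j \<in> index_box r" for j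
        using j inner_tucker_orthonormal[OF U Ct, of "ell2_unit j"]
        by (simp add: Dc inner_diff_left X_def elem_frames_eq_tucker[OF j])
      have "(norm (C - D))\<^sup>2 = (\<Sum>j\<in>index_box r. (inner (Z - X) (tucker r (ell2_unit j) U))\<^sup>2)"
        unfolding norm2_tensors[OF subspace_diff[OF subspace_tensors Ct Dt]]
        by (intro sum.cong refl) (simp only: cc power2_minus)
      also have "\<dots> \<le> 1 * (norm (Z - X))\<^sup>2"
        by (rule Bessel_scaled)
          (auto simp: inner_tucker_orthonormal[OF U ell2_unit_tensors] norm_tucker_orthonormal[OF U ell2_unit_tensors] norm_eq_sqrt_inner[of "ell2_unit _"])
      finally have "(norm (C - D))\<^sup>2 \<le> (norm (Z - X))\<^sup>2" by simp
      then show ?thesis unfolding dist_norm by (rule power2_le_imp_le) simp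
    qed
    finally show False using Z1 by simp
  qed
  then have "e \<le> infdist X weak_boundary"
    using tucker_in_weak_boundary[OF U zero_in_boundary[OF C]] by (intro le_infdist) auto
  then show ?thesis using e by (simp add: X_def)
qed

end

section \<open>The curvature estimate\<close>

theorem proposition4p7:
  fixes r :: "'d::finite \<Rightarrow> nat"
    and Mc :: "('d \<Rightarrow> nat) ell2 set"
    and c :: real
    and X Y :: "('d \<Rightarrow> nat) ell2"
  assumes r_pos: "\<forall>\<mu>. 0 < r \<mu>"
    and full_rank: "Mc \<subseteq> full_rank_tensors r"
    and submanifold: "embedded_submanifold (tensors r) Mc"
    and invariant: "\<forall>C\<in>Mc. \<forall>T. (\<forall>\<mu>. T \<mu> \<in> carrier_mat (r \<mu>) (r \<mu>) \<and> invertible_mat (T \<mu>)) \<longrightarrow>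
          tucker r C (\<lambda>\<mu>. mat_columns (T \<mu>)) \<in> Mc"
    and c_pos: "0 < c"
    and curvature: "\<forall>C\<in>Mc. \<forall>C'\<in>Mc. \<forall>Z\<in>tensors r. norm Z = 1 \<longrightarrow>
          norm (orth_proj (tangent_space Mc C) Z - orth_proj (tangent_space Mc C') Z)
            \<le> c / infdist C (closure Mc - Mc) * norm (C - C')"
    and X: "X \<in> tucker_manifold r Mc"
    and Y: "Y \<in> tucker_manifold r Mc"
  shows "onorm (\<lambda>Z. orth_proj (tucker_tangent_space r Mc X) Z
                   - orth_proj (tucker_tangent_space r Mc Y) Z)
    \<le> (sqrt 2 * c / infdist X ((weak_topology closure_of tucker_manifold r Mc) - tucker_manifold r Mc)
        + 2 * (sqrt 2 + 1) * (\<Sum>\<mu>\<in>UNIV. 1 / smallest_singular_value \<mu> X)) * norm (X - Y)"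
proof -
  interpret tucker_model r Mc
    by unfold_locales (use r_pos full_rank submanifold invariant in \<open>auto simp: mode_transform_def\<close>)
  obtain C U D V s where C: "C \<in> Mc" and D: "D \<in> Mc" and U: "orthonormal_frames r U" and V: "orthonormal_frames r V"
    and XC: "X = tucker r C U" and YD: "Y = tucker r D V"
    and s: "\<forall>\<mu>. \<forall>j<r \<mu>. \<forall>k<r \<mu>. inner (U \<mu> j) (V \<mu> k) = (if j = k then s \<mu> j else 0)"
    and s0: "\<forall>\<mu>. \<forall>j<r \<mu>. 0 \<le> s \<mu> j"
    using principal_representations[OF X Y] by blast
  interpret pp: principal_pair r Mc C U D V s
    by unfold_locales (use C D U V s s0 in auto)
  interpret qq: principal_pair r Mc D V C U s by (rule pp.swap)
  define \<delta> where "\<delta> = norm (X - Y)"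
  define \<sigma> where "\<sigma> = infdist X (weak_topology closure_of tucker_manifold r Mc - tucker_manifold r Mc)"
  define \<tau> where "\<tau> \<mu> = smallest_singular_value \<mu> X" for \<mu>
  define \<Sigma> where "\<Sigma> = (\<Sum>\<mu>\<in>UNIV. 1 / \<tau> \<mu>)"
  define K where "K = (sqrt 2 * c / \<sigma> + 2 * (sqrt 2 + 1) * \<Sigma>) * \<delta>"
  define TX where "TX = tucker_tangent_space r Mc X"
  define TY where "TY = tucker_tangent_space r Mc Y"
  have TX: "has_orth_proj TX" and TY: "has_orth_proj TY"
    unfolding TX_def TY_def XC YD using has_orth_proj_tangent_space[OF C U] has_orth_proj_tangent_space[OF D V] by auto
  have \<delta>: "0 \<le> \<delta>" by (simp add: \<delta>_def)
  have \<delta>': "norm (tucker r C U - tucker r D V) = \<delta>" "norm (tucker r D V - tucker r C U) = \<delta>"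
    by (simp_all add: \<delta>_def XC YD norm_minus_commute)
  have \<sigma>: "0 < \<sigma>" unfolding \<sigma>_def XC by (rule weak_boundary_distance_pos[OF C U])
  have \<tau>: "0 < \<tau> \<mu>" for \<mu>
    unfolding \<tau>_def XC by (rule smallest_singular_value_bound(1)[OF _ U Mc_full_rank[OF C]]) (simp add: r_pos)
  have lbX: "lower_bound (r \<mu>) (mode_rows r C U \<mu>) (\<tau> \<mu>)" for \<mu>
    unfolding \<tau>_def XC
    by (rule lower_boundI2, rule smallest_singular_value_bound(2)[OF _ U Mc_full_rank[OF C]]) (simp add: r_pos)
  have \<Sigma>: "0 \<le> \<Sigma>" unfolding \<Sigma>_def using \<tau> by (intro sum_nonneg) (simp add: less_imp_le)
  define \<kappa> where "\<kappa> = c / infdist C (closure Mc - Mc) * norm (C - D)"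
  have \<kappa>0: "0 \<le> \<kappa>" unfolding \<kappa>_def using c_pos by (simp add: infdist_nonneg)
  have \<kappa>: "\<kappa> \<le> sqrt 2 * c / \<sigma> * \<delta>"
  proof -
    have "c / infdist C (closure Mc - Mc) \<le> c / \<sigma>"
      using weak_boundary_distance_le[OF C U] c_pos \<sigma> unfolding \<sigma>_def XC by (intro divide_left_mono) auto
    then have "\<kappa> \<le> c / \<sigma> * (sqrt 2 * \<delta>)"
      unfolding \<kappa>_def using pp.norm_core_diff_le c_pos \<sigma> unfolding \<delta>' by (intro mult_mono) auto
    then show ?thesis by (simp add: mult_ac)
  qed
  have curv: "norm (orth_proj (tangent_space Mc C) Z - orth_proj (tangent_space Mc D) Z) \<le> \<kappa> * norm Z"
    if Z: "Z \<in> tensors r" for Z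
  proof (cases "Z = 0")
    case True
    then show ?thesis
      using orth_proj_scaleR[OF has_orth_proj_tangent_space_core[OF C], of 0 Z]
        orth_proj_scaleR[OF has_orth_proj_tangent_space_core[OF D], of 0 Z] by simp
  next
    case False
    define Z1 where "Z1 = (1 / norm Z) *\<^sub>R Z"
    have Z1: "Z1 \<in> tensors r" "norm Z1 = 1" "Z = norm Z *\<^sub>R Z1"
      using Z False by (auto simp: Z1_def subspace_scale[OF subspace_tensors])
    have "orth_proj (tangent_space Mc C) Z - orth_proj (tangent_space Mc D) Z
        = norm Z *\<^sub>R (orth_proj (tangent_space Mc C) Z1 - orth_proj (tangent_space Mc D) Z1)"
      using Z1(3) orth_proj_scaleR[OF has_orth_proj_tangent_space_core[OF C], of "norm Z" Z1]
        orth_proj_scaleR[OF has_orth_proj_tangent_space_core[OF D], of "norm Z" Z1]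
      by (simp add: scaleR_diff_right)
    moreover have "norm (orth_proj (tangent_space Mc C) Z1 - orth_proj (tangent_space Mc D) Z1) \<le> \<kappa>"
      unfolding \<kappa>_def using curvature C D Z1 by blast
    ultimately show ?thesis by (simp add: mult.commute[of \<kappa>] mult_left_mono)
  qed
  have curvC: "norm (Z - orth_proj (tangent_space Mc D) Z) \<le> \<kappa> * norm Z" if "Z \<in> tangent_space Mc C" for Z
    using curv[of Z] that tangent_space_core_tensors[OF C] orth_proj_of_mem[OF has_orth_proj_tangent_space_core[OF C] that]
    by auto
  have curvD: "norm (Z - orth_proj (tangent_space Mc C) Z) \<le> \<kappa> * norm Z" if "Z \<in> tangent_space Mc D" for Z
    using curv[of Z] that tangent_space_core_tensors[OF D] orth_proj_of_mem[OF has_orth_proj_tangent_space_core[OF D] that]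
    by (auto simp: norm_minus_commute)
  have K0: "0 \<le> K" unfolding K_def using c_pos \<sigma> \<Sigma> \<delta> by simp
  have "norm (orth_proj TX Z - orth_proj TY Z) \<le> K * norm Z" for Z
  proof (cases "1 \<le> K")
    case True
    have 0: "0 \<in> TX" "0 \<in> TY" using TX TY by (auto simp: has_orth_proj_def subspace_0)
    have "norm (t - 0) \<le> K * norm t" for t :: "('d \<Rightarrow> nat) ell2"
      using mult_right_mono[OF True, of "norm t"] by simp
    with 0 show ?thesis by (intro norm_diff_orth_proj_le[OF TX TY K0]) blast+
  next
    case False
    define \<epsilon> where "\<epsilon> \<mu> = \<delta> / \<tau> \<mu>" for \<mu>
    have \<epsilon>0: "0 \<le> \<epsilon> \<mu>" for \<mu> using \<tau>[of \<mu>] \<delta> by (simp add: \<epsilon>_def)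
    have sum\<epsilon>: "(\<Sum>\<mu>\<in>UNIV. \<epsilon> \<mu>) = \<Sigma> * \<delta>"
      by (simp add: \<epsilon>_def \<Sigma>_def sum_distrib_right)
    have small: "2 * (sqrt 2 + 1) * \<epsilon> \<mu> < 1" for \<mu>
    proof -
      have "\<epsilon> \<mu> \<le> \<Sigma> * \<delta>" unfolding sum\<epsilon>[symmetric] using \<epsilon>0 by (intro member_le_sum) auto
      then have "2 * (sqrt 2 + 1) * \<epsilon> \<mu> \<le> 2 * (sqrt 2 + 1) * (\<Sigma> * \<delta>)" by (intro mult_left_mono) auto
      also have "\<dots> \<le> K" unfolding K_def using c_pos \<sigma> \<delta> by (simp add: algebra_simps)
      finally show ?thesis using False by linarith
    qed
    have \<epsilon>_half: "2 * \<epsilon> \<mu> < 1" for \<mu>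
    proof -
      have "2 * \<epsilon> \<mu> \<le> 2 * (sqrt 2 + 1) * \<epsilon> \<mu>" using \<epsilon>0[of \<mu>] by (simp add: algebra_simps)
      then show ?thesis using small[of \<mu>] by linarith
    qed
    have \<delta>\<tau>: "\<delta> = \<epsilon> \<mu> * \<tau> \<mu>" for \<mu> using \<tau>[of \<mu>] by (simp add: \<epsilon>_def)
    have \<delta>_less: "\<delta> < \<tau> \<mu>" for \<mu>
      using \<epsilon>_half[of \<mu>] \<epsilon>0[of \<mu>] \<tau>[of \<mu>] mult_strict_right_mono[of "\<epsilon> \<mu>" 1 "\<tau> \<mu>"] by (simp add: \<delta>\<tau>[of \<mu>])
    have s\<epsilon>: "1 - (s \<mu> k)\<^sup>2 \<le> (\<epsilon> \<mu>)\<^sup>2" if "k < r \<mu>" for \<mu> k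
      using pp.angle_bound[OF lbX _ that] \<tau>[of \<mu>] unfolding \<delta>'
      by (simp add: \<epsilon>_def power_divide pos_le_divide_eq)
    have lbY: "lower_bound (r \<mu>) (mode_rows r D V \<mu>) (\<tau> \<mu> - \<delta>)" for \<mu>
      using pp.lower_bound_swap[OF lbX] \<delta>_less unfolding \<delta>' by blast
    \<comment> \<open>\<open>1 / (1 - \<epsilon>) \<le> sqrt 2 + 1\<close> for \<open>\<epsilon> \<le> 1 / 2\<close>, so the loss in the lower bound for \<open>Y\<close> is affordable\<close>
    have quot: "\<delta> / \<tau> \<mu> \<le> (sqrt 2 + 1) * \<epsilon> \<mu>" "\<delta> / (\<tau> \<mu> - \<delta>) \<le> (sqrt 2 + 1) * \<epsilon> \<mu>" for \<mu>
    proof -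
      show "\<delta> / \<tau> \<mu> \<le> (sqrt 2 + 1) * \<epsilon> \<mu>" using \<epsilon>0[of \<mu>] by (simp add: \<epsilon>_def[symmetric] algebra_simps)
      have "(1::real) \<le> sqrt 2" by simp
      then have "2 * (1 / 2) \<le> (sqrt 2 + 1) * (1 - \<epsilon> \<mu>)" using \<epsilon>_half[of \<mu>] by (intro mult_mono) auto
      then have "(\<epsilon> \<mu> * \<tau> \<mu>) * 1 \<le> (\<epsilon> \<mu> * \<tau> \<mu>) * ((sqrt 2 + 1) * (1 - \<epsilon> \<mu>))"
        using \<epsilon>0[of \<mu>] \<tau>[of \<mu>] by (intro mult_left_mono) auto
      also have "\<dots> = (sqrt 2 + 1) * \<epsilon> \<mu> * (\<tau> \<mu> - \<epsilon> \<mu> * \<tau> \<mu>)" by (simp add: algebra_simps)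
      finally have "\<delta> \<le> (sqrt 2 + 1) * \<epsilon> \<mu> * (\<tau> \<mu> - \<delta>)" by (simp flip: \<delta>\<tau>)
      then show "\<delta> / (\<tau> \<mu> - \<delta>) \<le> (sqrt 2 + 1) * \<epsilon> \<mu>" using \<delta>_less[of \<mu>] by (simp add: pos_divide_le_eq)
    qed
    have total: "\<kappa> + (\<Sum>\<mu>\<in>UNIV. (sqrt 2 + 1) * \<epsilon> \<mu> + q \<mu>) \<le> K" if "\<And>\<mu>. q \<mu> \<le> (sqrt 2 + 1) * \<epsilon> \<mu>" for q
    proof -
      have "(\<Sum>\<mu>\<in>UNIV. (sqrt 2 + 1) * \<epsilon> \<mu> + q \<mu>) \<le> (\<Sum>\<mu>\<in>UNIV. 2 * (sqrt 2 + 1) * \<epsilon> \<mu>)"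
      proof (rule sum_mono)
        fix \<mu>
        show "(sqrt 2 + 1) * \<epsilon> \<mu> + q \<mu> \<le> 2 * (sqrt 2 + 1) * \<epsilon> \<mu>" using that[of \<mu>] by (simp add: algebra_simps)
      qed
      also have "\<dots> = 2 * (sqrt 2 + 1) * (\<Sigma> * \<delta>)" unfolding sum\<epsilon>[symmetric] by (rule sum_distrib_left[symmetric])
      finally show ?thesis using \<kappa> unfolding K_def by (simp add: algebra_simps)
    qed
    show ?thesis
    proof (rule norm_diff_orth_proj_le[OF TX TY K0])
      fix t assume "t \<in> TX"
      then obtain t' where t': "t' \<in> TY"
        "norm (t - t') \<le> (\<kappa> + (\<Sum>\<mu>\<in>UNIV. (sqrt 2 + 1) * \<epsilon> \<mu> + \<delta> / \<tau> \<mu>)) * norm t"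
        using pp.tangent_space_approx[OF lbX \<tau> \<epsilon>0 s\<epsilon> curvC \<kappa>0] unfolding TX_def TY_def XC YD \<delta>' by blast
      from t'(2) have "norm (t - t') \<le> K * norm t"
        by (rule order_trans) (intro mult_right_mono total quot norm_ge_zero)
      then show "\<exists>t'\<in>TY. norm (t - t') \<le> K * norm t" using t'(1) by blast
    next
      fix t assume "t \<in> TY"
      have pos: "0 < \<tau> \<mu> - \<delta>" for \<mu> using \<delta>_less[of \<mu>] by simp
      obtain t' where t': "t' \<in> TX"
        "norm (t - t') \<le> (\<kappa> + (\<Sum>\<mu>\<in>UNIV. (sqrt 2 + 1) * \<epsilon> \<mu> + \<delta> / (\<tau> \<mu> - \<delta>))) * norm t"
        using qq.tangent_space_approx[OF lbY pos \<epsilon>0 s\<epsilon> curvD \<kappa>0] \<open>t \<in> TY\<close> unfolding TX_def TY_def XC YD \<delta>' by blast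
      from t'(2) have "norm (t - t') \<le> K * norm t"
        by (rule order_trans) (intro mult_right_mono total quot norm_ge_zero)
      then show "\<exists>t'\<in>TX. norm (t - t') \<le> K * norm t" using t'(1) by blast
    qed
  qed
  then have "onorm (\<lambda>Z. orth_proj TX Z - orth_proj TY Z) \<le> K" by (rule onorm_bound[OF K0])
  then show ?thesis unfolding K_def TX_def TY_def \<sigma>_def \<Sigma>_def \<tau>_def \<delta>_def .
qed

end
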